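(* Let $d\ge 3$ be odd, let $k$ be even, and let $\pmb{\lambda} = (\lambda^{(1)},\ldots,\lambda^{(d)})$ be a $d$-tuple of partitions of the same integer $m\le k^d/2$, each with all parts at most $k$. Let $a = \max_i (\lambda^{(i)})'_1$, $b = \min_i (\lambda^{(i)})'_k$ and $V=(\mathbb{C}^k)^{\otimes d}$. Suppose that the following property $\mathrm{LP}_{\pmb{\lambda},k}$ holds: for some integer $n_0\in[-b,k^{d-1}-a]$ the map $$L:\ \mathrm{HWV}_{(\rho_k^n\pmb{\lambda})'}\bigwedge V\longrightarrow \mathrm{HWV}_{(\rho_k^{n+1}\pmb{\lambda})'}\bigwedge V,\qquad L(v)=\omega\wedge v,$$ is injective for each integer $n\in[-b,n_0)$ and surjective for each integer $n\in[n_0,k^{d-1}-a)$. Then the sequence of generalized Kronecker coefficients $$\{g(\rho_k^n\,\pmb{\lambda})\}_{n=-b,\ldots,k^{d-1}-a}$$ is unimodal.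
   Context: For partitions $\mu^{(1)},\ldots,\mu^{(d)}$ of the same integer $N$, the (generalized) Kronecker coefficient $g(\mu^{(1)},\ldots,\mu^{(d)})$ is the multiplicity of the trivial representation $[(N)]$ in $[\mu^{(1)}]\otimes\cdots\otimes[\mu^{(d)}]$, where $[\mu]$ is the irreducible complex representation of $S_N$ indexed by $\mu$. $\lambda'$ denotes the conjugate partition (on tuples, componentwise). For a partition $\lambda$ with parts at most $k$, $\rho_k\lambda=(k,\lambda_1,\lambda_2,\ldots)$ adds a first part $k$; $\rho_k^{-1}$ removes a first part equal to $k$; $\rho_k^n$ is the iterate for $n\in\mathbb{Z}$; on tuples it acts componentwise. A finite sequence $x_p,\ldots,x_q$ is unimodal if $x_p\le\cdots\le x_r\ge\cdots\ge x_q$ for some $r\in[p,q]$. The group $\mathrm{GL}(k)^{\times d}$ acts on $V=(\mathbb{C}^k)^{\otimes d}$ multilinearly and hence on $\bigwedge V$. A vector $v\in\bigwedge V$ is a weight vector of weight $\pmb{\mu}=(\mu^{(1)},\ldots,\mu^{(d)})$, $\mu^{(j)}\in\mathbb{Z}^k$, if every tuple of diagonal matrices $(\mathrm{diag}(a^{(1)}_1,\ldots,a^{(1)}_k),\ldots,\mathrm{diag}(a^{(d)}_1,\ldots,a^{(d)}_k))$ acts on $v$ as the scalar $\prod_{j}\prod_i (a^{(j)}_i)^{\mu^{(j)}_i}$. $\mathrm{HWV}_{\pmb{\mu}}\bigwedge V$ is the space consisting of $0$ and the highest weight vectors of weight $\pmb{\mu}$, i.e. nonzero weight vectors of weight $\pmb{\mu}$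 invariant under $U(k)^{\times d}$, with $U(k)$ the group of upper unitriangular matrices. Partitions of length at most $k$ are padded with zeros to vectors in $\mathbb{Z}^k$. The Cayley form is $$\omega=\omega_{d,k}=\sum_{\pi_1,\ldots,\pi_d\in S_k}\mathrm{sgn}(\pi_1\cdots\pi_d)\bigwedge_{i=1}^k \left(e_{\pi_1(i)}\otimes\cdots\otimes e_{\pi_d(i)}\right)\in\bigwedge^k V,$$ where $e_1,\ldots,e_k$ is the standard basis of $\mathbb{C}^k$. For odd $d$ it is a highest weight vector of weight $((1,\ldots,1),\ldots,(1,\ldots,1))$, and $L$ maps between the stated spaces. *)

theory Defs
  imports
    Complex_Main
    "HOL-Library.FuncSet"
    "HOL-Library.Function_Algebras"
    "HOL-Library.More_List"
    "HOL-Combinatorics.Permutations"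
    "Jordan_Normal_Form.Matrix"
begin

section \<open>Spaces of complex functions\<close>

text \<open>
  Every vector space below is a subspace of some function space \<^typ>\<open>'i \<Rightarrow> complex\<close>, with pointwise
  operations; \<^typ>\<open>'i\<close> indexes a basis.
\<close>

definition cscale :: "complex \<Rightarrow> ('i \<Rightarrow> complex) \<Rightarrow> 'i \<Rightarrow> complex" where
  "cscale c f = (\<lambda>x. c * f x)"

interpretation cfun: vector_space "cscale :: complex \<Rightarrow> ('i \<Rightarrow> complex) \<Rightarrow> 'i \<Rightarrow> complex"
  by unfold_locales (auto simp: cscale_def fun_eq_iff algebra_simps)

text \<open>
  If \<open>f\<^sub>j\<close> is a function on \<open>X\<^sub>j\<close>, then \<open>f\<^sub>1 \<otimes> \<dots> \<otimes> f\<^sub>d\<close> is realised as the function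
  \<open>(x\<^sub>1,\<dots>,x\<^sub>d) \<mapsto> f\<^sub>1(x\<^sub>1) \<cdots> f\<^sub>d(x\<^sub>d)\<close> on lists of length \<open>d\<close>. For subspaces \<open>W\<^sub>j\<close> the span of these
  functions is a model of \<open>W\<^sub>1 \<otimes> \<dots> \<otimes> W\<^sub>d\<close>.
\<close>

definition pure_tensor :: "('x \<Rightarrow> complex) list \<Rightarrow> 'x list \<Rightarrow> complex" where
  "pure_tensor fs = (\<lambda>xs. if length xs = length fs then (\<Prod>j<length fs. (fs ! j) (xs ! j)) else 0)"

definition tensor_space :: "('x \<Rightarrow> complex) set list \<Rightarrow> ('x list \<Rightarrow> complex) set" where
  "tensor_space Ws = cfun.span (pure_tensor ` {fs. list_all2 (\<in>) fs Ws})"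


section \<open>Partitions\<close>

definition partition_of :: "nat \<Rightarrow> nat list \<Rightarrow> bool" where
  "partition_of m l \<longleftrightarrow> sorted_wrt (\<ge>) l \<and> 0 \<notin> set l \<and> sum_list l = m"

definition conjugate :: "nat list \<Rightarrow> nat list" where
  "conjugate l = map (\<lambda>i. card {j. j < length l \<and> i < l ! j}) [0..<nth_default 0 l 0]"

text \<open>
  For negative \<open>n\<close> the first \<open>-n\<close> parts are deleted; this is \<open>\<rho>\<^sub>k\<^sup>n\<close> when these parts all equal \<open>k\<close>.
\<close>

definition rho_pow :: "nat \<Rightarrow> int \<Rightarrow> nat list \<Rightarrow> nat list" where
  "rho_pow k n l = (if n \<ge> 0 then replicate (nat n) k @ l else drop (nat (- n)) l)"


section \<open>Representations of symmetric groups\<close>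

text \<open>
  A representation of \<open>S\<^sub>N\<close>, the group of permutations of \<open>{..<N}\<close>, is a subspace \<open>W\<close> of a function
  space together with an action \<open>act \<sigma>\<close> by linear maps.
\<close>

definition subrep ::
  "nat \<Rightarrow> ((nat \<Rightarrow> nat) \<Rightarrow> ('i \<Rightarrow> complex) \<Rightarrow> 'i \<Rightarrow> complex) \<Rightarrow> ('i \<Rightarrow> complex) set \<Rightarrow> bool" where
  "subrep N act W \<longleftrightarrow> cfun.subspace W \<and> (\<forall>\<sigma>. \<sigma> permutes {..<N} \<longrightarrow> act \<sigma> ` W \<subseteq> W)"

definition irreducible_rep ::
  "nat \<Rightarrow> ((nat \<Rightarrow> nat) \<Rightarrow> ('i \<Rightarrow> complex) \<Rightarrow> 'i \<Rightarrow> complex) \<Rightarrow> ('i \<Rightarrow> complex) set \<Rightarrow> bool" where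
  "irreducible_rep N act W \<longleftrightarrow>
     subrep N act W \<and> W \<noteq> {0} \<and> (\<forall>U\<subseteq>W. subrep N act U \<longrightarrow> U = {0} \<or> U = W)"

text \<open>
  A linear map between subspaces always extends to the ambient function spaces, so it is harmless to
  take \<open>T\<close> linear everywhere.
\<close>

definition isomorphic_rep ::
  "nat \<Rightarrow> ((nat \<Rightarrow> nat) \<Rightarrow> ('i \<Rightarrow> complex) \<Rightarrow> 'i \<Rightarrow> complex) \<Rightarrow> ('i \<Rightarrow> complex) set
    \<Rightarrow> ((nat \<Rightarrow> nat) \<Rightarrow> ('j \<Rightarrow> complex) \<Rightarrow> 'j \<Rightarrow> complex) \<Rightarrow> ('j \<Rightarrow> complex) set \<Rightarrow> bool" where
  "isomorphic_rep N act W act' W' \<longleftrightarrow>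
     (\<exists>T. Vector_Spaces.linear cscale cscale T \<and> bij_betw T W W' \<and>
        (\<forall>\<sigma>. \<sigma> permutes {..<N} \<longrightarrow> (\<forall>w\<in>W. T (act \<sigma> w) = act' \<sigma> (T w))))"

text \<open>\<open>W\<close> is the internal direct sum of the irreducible subrepresentations in the list \<open>Us\<close>.\<close>

definition irreducible_decomposition ::
  "nat \<Rightarrow> ((nat \<Rightarrow> nat) \<Rightarrow> ('i \<Rightarrow> complex) \<Rightarrow> 'i \<Rightarrow> complex) \<Rightarrow> ('i \<Rightarrow> complex) set
    \<Rightarrow> ('i \<Rightarrow> complex) set list \<Rightarrow> bool" where
  "irreducible_decomposition N act W Us \<longleftrightarrow>
     (\<forall>U\<in>set Us. irreducible_rep N act U) \<and>
     bij_betw (\<lambda>u. \<Sum>i<length Us. u i) (\<Pi>\<^sub>E i\<in>{..<length Us}. Us ! i) W"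

definition rep_multiplicity ::
  "nat \<Rightarrow> ((nat \<Rightarrow> nat) \<Rightarrow> ('j \<Rightarrow> complex) \<Rightarrow> 'j \<Rightarrow> complex) \<Rightarrow> ('j \<Rightarrow> complex) set
    \<Rightarrow> ((nat \<Rightarrow> nat) \<Rightarrow> ('i \<Rightarrow> complex) \<Rightarrow> 'i \<Rightarrow> complex) \<Rightarrow> ('i \<Rightarrow> complex) set \<Rightarrow> nat" where
  "rep_multiplicity N actU U act W =
     (THE n. \<exists>Us. irreducible_decomposition N act W Us \<and>
        n = card {i. i < length Us \<and> isomorphic_rep N act (Us ! i) actU U})"

definition trivial_space :: "(unit \<Rightarrow> complex) set" where
  "trivial_space = UNIV"

definition trivial_act :: "(nat \<Rightarrow> nat) \<Rightarrow> (unit \<Rightarrow> complex) \<Rightarrow> unit \<Rightarrow> complex" where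
  "trivial_act \<sigma> f = f"


section \<open>Specht modules and Kronecker coefficients\<close>

definition diagram :: "nat list \<Rightarrow> (nat \<times> nat) set" where
  "diagram l = {(i, j). i < length l \<and> j < l ! i}"

definition tableau :: "nat list \<Rightarrow> (nat \<times> nat \<Rightarrow> nat) \<Rightarrow> bool" where
  "tableau l t \<longleftrightarrow> bij_betw t (diagram l) {..<sum_list l}"

text \<open>
  The tabloid of a tableau (its class up to reordering entries within rows) is encoded as the list
  whose \<open>x\<close>-th element is the index of the row containing the entry \<open>x\<close>.
\<close>

definition tabloid :: "nat list \<Rightarrow> (nat \<times> nat \<Rightarrow> nat) \<Rightarrow> nat list" where
  "tabloid l t = map (\<lambda>x. fst (inv_into (diagram l) t x)) [0..<sum_list l]"

definition column_stabilizer :: "nat list \<Rightarrow> (nat \<times> nat \<Rightarrow> nat) \<Rightarrow> (nat \<Rightarrow> nat) set" where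
  "column_stabilizer l t =
     {\<pi>. \<pi> permutes {..<sum_list l} \<and>
         (\<forall>c\<in>diagram l. snd (inv_into (diagram l) t (\<pi> (t c))) = snd c)}"

definition polytabloid :: "nat list \<Rightarrow> (nat \<times> nat \<Rightarrow> nat) \<Rightarrow> nat list \<Rightarrow> complex" where
  "polytabloid l t =
     (\<lambda>s. \<Sum>\<pi>\<in>column_stabilizer l t. of_int (sign \<pi>) * of_bool (s = tabloid l (\<pi> \<circ> t)))"

text \<open>The irreducible representation \<open>[\<lambda>]\<close>, with the action \<open>specht_act\<close>.\<close>

definition specht :: "nat list \<Rightarrow> (nat list \<Rightarrow> complex) set" where
  "specht l = cfun.span (polytabloid l ` {t. tableau l t})"

text \<open>
  The permutation \<open>\<sigma>\<close> sends the tabloid \<open>s\<close> to \<open>\<lambda>x. s (\<sigma>\<^sup>-\<^sup>1 x)\<close>, hence a function \<open>f\<close> of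
  tabloids to \<open>\<lambda>s. f (\<sigma>\<^sup>-\<^sup>1 \<cdot> s)\<close>, and \<open>\<sigma>\<^sup>-\<^sup>1 \<cdot> s = permute_list \<sigma> s\<close>.
\<close>

definition specht_act ::
  "(nat \<Rightarrow> nat) \<Rightarrow> (nat list \<Rightarrow> complex) \<Rightarrow> nat list \<Rightarrow> complex" where
  "specht_act \<sigma> f = (\<lambda>s. f (permute_list \<sigma> s))"

definition diagonal_act ::
  "(nat \<Rightarrow> nat) \<Rightarrow> (nat list list \<Rightarrow> complex) \<Rightarrow> nat list list \<Rightarrow> complex" where
  "diagonal_act \<sigma> f = (\<lambda>ss. f (map (permute_list \<sigma>) ss))"

text \<open>Meaningful for nonempty lists of partitions of one and the same integer.\<close>

definition kronecker :: "nat list list \<Rightarrow> nat" where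
  "kronecker ls =
     rep_multiplicity (sum_list (hd ls)) trivial_act trivial_space
       diagonal_act (tensor_space (map specht ls))"


section \<open>The exterior algebra of \<open>(\<complex>\<^sup>k)\<^sup>\<otimes>\<^sup>d\<close>\<close>

text \<open>
  The standard basis of \<open>V = (\<complex>\<^sup>k)\<^sup>\<otimes>\<^sup>d\<close> is indexed by the lists in \<open>basis_index d k\<close>, with coordinates
  counted from 0. The exterior algebra is realised by alternating tensors: \<open>v\<^sub>1 \<and> \<dots> \<and> v\<^sub>n\<close> is
  \<open>\<Sum>\<^sub>\<sigma> sgn \<sigma> v\<^sub>\<sigma>\<^sub>(\<^sub>1\<^sub>) \<otimes> \<dots> \<otimes> v\<^sub>\<sigma>\<^sub>(\<^sub>n\<^sub>)\<close> in \<open>V\<^sup>\<otimes>\<^sup>n\<close>, and a function \<open>f\<close> on lists of basis indices has as its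
  component in \<open>V\<^sup>\<otimes>\<^sup>n\<close> the restriction to lists of length \<open>n\<close>. An alternating \<open>f\<close> vanishes on lists
  with repetitions, so only the degrees \<open>n \<le> k\<^sup>d\<close> occur.
\<close>

definition basis_index :: "nat \<Rightarrow> nat \<Rightarrow> nat list set" where
  "basis_index d k = {w. length w = d \<and> set w \<subseteq> {..<k}}"

definition ext_alg :: "nat \<Rightarrow> nat \<Rightarrow> (nat list list \<Rightarrow> complex) set" where
  "ext_alg d k =
     {f. (\<forall>ws. f ws \<noteq> 0 \<longrightarrow> set ws \<subseteq> basis_index d k) \<and>
         (\<forall>ws \<sigma>. \<sigma> permutes {..<length ws} \<longrightarrow> f (permute_list \<sigma> ws) = of_int (sign \<sigma>) * f ws)}"

definition wedge ::
  "('x list \<Rightarrow> complex) \<Rightarrow> ('x list \<Rightarrow> complex) \<Rightarrow> 'x list \<Rightarrow> complex" where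
  "wedge f g = (\<lambda>ws. \<Sum>p\<le>length ws. 1 / (fact p * fact (length ws - p)) *
     (\<Sum>\<sigma> | \<sigma> permutes {..<length ws}.
        of_int (sign \<sigma>) * f (take p (permute_list \<sigma> ws)) * g (drop p (permute_list \<sigma> ws))))"

definition ext_one :: "'x list \<Rightarrow> complex" where
  "ext_one = (\<lambda>ws. of_bool (ws = []))"

text \<open>The inclusion of \<open>V\<close> as the degree-one part.\<close>

definition ext_incl :: "('x \<Rightarrow> complex) \<Rightarrow> 'x list \<Rightarrow> complex" where
  "ext_incl v = (\<lambda>ws. if length ws = 1 then v (hd ws) else 0)"

definition wedge_list :: "('x \<Rightarrow> complex) list \<Rightarrow> 'x list \<Rightarrow> complex" where
  "wedge_list vs = foldr (\<lambda>v. wedge (ext_incl v)) vs ext_one"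

definition std_basis :: "nat \<Rightarrow> nat \<Rightarrow> complex" where
  "std_basis i = (\<lambda>x. of_bool (x = i))"

definition cayley_form :: "nat \<Rightarrow> nat \<Rightarrow> nat list list \<Rightarrow> complex" where
  "cayley_form d k =
     (\<Sum>\<pi>s | length \<pi>s = d \<and> (\<forall>\<pi>\<in>set \<pi>s. \<pi> permutes {..<k}).
        cscale (of_int (sign (foldr (\<circ>) \<pi>s id)))
          (wedge_list (map (\<lambda>i. pure_tensor (map (\<lambda>\<pi>. std_basis (\<pi> i)) \<pi>s)) [0..<k])))"

text \<open>
  The action of a tuple of \<open>k \<times> k\<close> matrices: on each \<open>V\<^sup>\<otimes>\<^sup>n\<close> it is the \<open>n\<close>-th tensor power of
  \<open>A\<^sub>1 \<otimes> \<dots> \<otimes> A\<^sub>d\<close>.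
\<close>

definition gl_act ::
  "nat \<Rightarrow> nat \<Rightarrow> complex mat list \<Rightarrow> (nat list list \<Rightarrow> complex) \<Rightarrow> nat list list \<Rightarrow> complex" where
  "gl_act d k As f = (\<lambda>ws. if set ws \<subseteq> basis_index d k then
     (\<Sum>us | length us = length ws \<and> set us \<subseteq> basis_index d k.
        (\<Prod>r<length ws. \<Prod>j<d. As ! j $$ (ws ! r ! j, us ! r ! j)) * f us) else 0)"


section \<open>Highest weight vectors\<close>

text \<open>A weight is given as \<open>\<mu> j i\<close>, with \<open>j < d\<close> and \<open>i < k\<close> both counted from 0.\<close>

definition weight_vector ::
  "nat \<Rightarrow> nat \<Rightarrow> (nat \<Rightarrow> nat \<Rightarrow> int) \<Rightarrow> (nat list list \<Rightarrow> complex) \<Rightarrow> bool" where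
  "weight_vector d k \<mu> v \<longleftrightarrow> v \<in> ext_alg d k \<and>
     (\<forall>a :: nat \<Rightarrow> nat \<Rightarrow> complex. (\<forall>j<d. \<forall>i<k. a j i \<noteq> 0) \<longrightarrow>
        gl_act d k (map (\<lambda>j. mat_diag k (a j)) [0..<d]) v =
        cscale (\<Prod>j<d. \<Prod>i<k. a j i powi \<mu> j i) v)"

definition unitriangular :: "nat \<Rightarrow> complex mat set" where
  "unitriangular k =
     {A \<in> carrier_mat k k. upper_triangular A \<and> (\<forall>i<k. A $$ (i, i) = 1)}"

definition highest_weight_vector ::
  "nat \<Rightarrow> nat \<Rightarrow> (nat \<Rightarrow> nat \<Rightarrow> int) \<Rightarrow> (nat list list \<Rightarrow> complex) \<Rightarrow> bool" where
  "highest_weight_vector d k \<mu> v \<longleftrightarrow> v \<noteq> 0 \<and> weight_vector d k \<mu> v \<and>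
     (\<forall>As. length As = d \<and> set As \<subseteq> unitriangular k \<longrightarrow> gl_act d k As v = v)"

definition HWV :: "nat \<Rightarrow> nat \<Rightarrow> (nat \<Rightarrow> nat \<Rightarrow> int) \<Rightarrow> (nat list list \<Rightarrow> complex) set" where
  "HWV d k \<mu> = insert 0 {v. highest_weight_vector d k \<mu> v}"

definition padded_weight :: "nat list list \<Rightarrow> nat \<Rightarrow> nat \<Rightarrow> int" where
  "padded_weight ls = (\<lambda>j i. int (nth_default 0 (ls ! j) i))"


section \<open>The Lefschetz property and unimodality\<close>

definition HWV_rho :: "nat \<Rightarrow> nat \<Rightarrow> nat list list \<Rightarrow> int \<Rightarrow> (nat list list \<Rightarrow> complex) set" where
  "HWV_rho d k ls n = HWV d k (padded_weight (map (\<lambda>l. conjugate (rho_pow k n l)) ls))"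

definition a_max :: "nat list list \<Rightarrow> int" where
  "a_max ls = int (Max ((\<lambda>l. nth_default 0 (conjugate l) 0) ` set ls))"

definition b_min :: "nat \<Rightarrow> nat list list \<Rightarrow> int" where
  "b_min k ls = int (Min ((\<lambda>l. nth_default 0 (conjugate l) (k - 1)) ` set ls))"

definition LP :: "nat \<Rightarrow> nat \<Rightarrow> nat list list \<Rightarrow> bool" where
  "LP d k ls \<longleftrightarrow>
     (\<exists>n0\<in>{- b_min k ls .. int (k ^ (d - 1)) - a_max ls}.
        (\<forall>n\<in>{- b_min k ls ..< n0}. inj_on (wedge (cayley_form d k)) (HWV_rho d k ls n)) \<and>
        (\<forall>n\<in>{n0 ..< int (k ^ (d - 1)) - a_max ls}.
           wedge (cayley_form d k) ` HWV_rho d k ls n = HWV_rho d k ls (n + 1)))"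

definition unimodal_on :: "int \<Rightarrow> int \<Rightarrow> (int \<Rightarrow> nat) \<Rightarrow> bool" where
  "unimodal_on p q x \<longleftrightarrow>
     (\<exists>r\<in>{p..q}. (\<forall>n\<in>{p..<r}. x n \<le> x (n + 1)) \<and> (\<forall>n\<in>{r..<q}. x (n + 1) \<le> x n))"

end

theory Submission
  imports Defs
begin

text \<open>
  For odd \<open>d\<close> the coefficient \<open>g(\<lambda>)\<close> is the dimension of the space of highest weight vectors of weight
  \<open>\<lambda>'\<close> in \<open>\<And>V\<close>. Since \<open>L\<close> maps each of these spaces to the next one, injectivity of \<open>L\<close> makes the
  sequence increase and surjectivity makes it decrease.

  For a partition \<open>l\<close> consider the matrix whose entry at a row word \<open>r\<close> and a column word \<open>w\<close> is the
  sign of the tableau of shape \<open>l\<close> that they describe, and \<open>0\<close> if they describe none. Its columns span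
  the Specht module of \<open>l\<close>. Its rows span the highest weight vectors of weight \<open>l'\<close> in the tensor power
  of \<open>\<complex>\<^sup>k\<close>: the word at which such a vector is supported and which is largest in colexicographic order
  is a ballot word, and every ballot word is the leading word of a row, so the rows allow to eliminate.
  The same holds for the tensor product of \<open>d\<close> such matrices. A real matrix maps its column space
  isomorphically onto its row space, and for odd \<open>d\<close> this isomorphism turns invariant into
  alternating tensors.

  The multiplicity of the trivial representation is the dimension of the invariants, by complete
  reducibility. The Cayley form is a multiple of a row of such a tensor product, for the shapes
  \<open>(k), \<dots>, (k)\<close>, so it is a highest weight vector as well.
\<close>

section \<open>Linear algebra of finitely supported functions\<close>

text \<open>The matrix stands in for skew Howe duality: one explicit array carries the symmetric
  group on one side and \<open>U(k)\<close> on the other. The delicate half is that its rows exhaust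
  the invariants. A vector in the tensor product of \<open>d\<close> factors need not be a pure
  tensor, so the factors cannot be treated independently. Freezing all words of a tuple except one,
  however, leaves a \<open>U(k)\<close>-invariant function of the remaining word, and comparing
  tuples by the sum of the ranks of their words makes every word of a leading tuple leading for its
  own function. That a leading word \<open>w\<close> is ballot comes from one matrix, the identity
  plus the elementary matrix at \<open>(c, c + 1)\<close>. If a prefix of \<open>w\<close> had more
  letters \<open>c + 1\<close> than \<open>c\<close>, invariance would annihilate the sums of
  coefficients over words that raise letters \<open>c\<close> to \<open>c + 1\<close> in this
  prefix, the rest of \<open>w\<close> being frozen by maximality, and inclusion-exclusion would
  annihilate the coefficient at \<open>w\<close>. Only prefixes may vary, which is why the order is
  colexicographic. Alternation is imposed last, as equivariance under permuting positions.\<close>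

interpretation cpair: vector_space_pair
  "cscale :: complex \<Rightarrow> ('i \<Rightarrow> complex) \<Rightarrow> 'i \<Rightarrow> complex"
  "cscale :: complex \<Rightarrow> ('j \<Rightarrow> complex) \<Rightarrow> 'j \<Rightarrow> complex"
  by unfold_locales

lemma sum_fun_apply: "(\<Sum>i\<in>I. f i) x = (\<Sum>i\<in>I. f i x)" for f :: "'a \<Rightarrow> 'b \<Rightarrow> 'c::comm_monoid_add"
  by (induction I rule: infinite_finite_induct) auto

definition supported_on :: "'i set \<Rightarrow> ('i \<Rightarrow> complex) set" where
  "supported_on X = {f. \<forall>x. f x \<noteq> 0 \<longrightarrow> x \<in> X}"

lemma supported_onD: "f \<in> supported_on X \<Longrightarrow> x \<notin> X \<Longrightarrow> f x = 0"
  by (auto simp: supported_on_def)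

lemma subspace_supported_on: "cfun.subspace (supported_on X)"
  unfolding cfun.subspace_def supported_on_def cscale_def
  by (auto, metis add.right_neutral)

lemma supported_on_finite_dim:
  assumes "finite X"
  shows "supported_on X \<subseteq> cfun.span ((\<lambda>x y. of_bool (y = x)) ` X)"
proof
  fix f assume f: "f \<in> supported_on X"
  have "f = (\<Sum>x\<in>X. cscale (f x) (\<lambda>y. of_bool (y = x)))"
  proof
    fix y
    have "(\<Sum>x\<in>X. cscale (f x) (\<lambda>y. of_bool (y = x)) y) = (\<Sum>x\<in>X. if y = x then f x else 0)"
      by (intro sum.cong) (auto simp: cscale_def)
    also have "\<dots> = f y"
      using assms f by (auto simp: supported_on_def)
    finally show "f y = (\<Sum>x\<in>X. cscale (f x) (\<lambda>y. of_bool (y = x))) y"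
      by (simp add: sum_fun_apply)
  qed
  also have "\<dots> \<in> cfun.span ((\<lambda>x y. of_bool (y = x)) ` X)"
    by (intro cfun.span_sum cfun.span_scale cfun.span_base) auto
  finally show "f \<in> cfun.span ((\<lambda>x y. of_bool (y = x)) ` X)" .
qed

lemma finite_independent:
  assumes "finite X" "cfun.independent B" "B \<subseteq> supported_on X"
  shows "finite B"
  using cfun.independent_span_bound[of "(\<lambda>x y. of_bool (y = x)) ` X" B] assms
    supported_on_finite_dim[of X] by blast

text \<open>\<open>cfun.dim\<close> is the cardinality of a basis, and an infinite basis would count
  as 0; the finite set \<open>X\<close> excludes this for \<open>V\<close>.\<close>

lemma independent_card_le_dim:
  assumes "finite X" "B \<subseteq> V" "cfun.independent B" "V \<subseteq> supported_on X"
  shows "card B \<le> cfun.dim V"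
proof -
  obtain C where C: "C \<subseteq> V" "cfun.independent C" "V \<subseteq> cfun.span C" "card C = cfun.dim V"
    using cfun.basis_exists by metis
  have "finite C"
    using finite_independent[OF assms(1) C(2)] C(1) assms(4) by auto
  then have "card B \<le> card C"
    using cfun.independent_span_bound[of C B] assms C by auto
  then show ?thesis using C by simp
qed

lemma dim_le_of_inj:
  assumes f: "Vector_Spaces.linear cscale cscale f" and U: "cfun.subspace U"
    and sub: "f ` U \<subseteq> V" and inj: "inj_on f U" and V: "V \<subseteq> supported_on X" "finite X"
  shows "cfun.dim U \<le> cfun.dim V"
proof -
  obtain B where B: "B \<subseteq> U" "cfun.independent B" "U \<subseteq> cfun.span B" "card B = cfun.dim U"
    using cfun.basis_exists by metis
  have "cfun.span B \<subseteq> U"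
    using B(1) U by (rule cfun.span_minimal)
  then have inj': "inj_on f (cfun.span B)" using inj inj_on_subset by blast
  have "cfun.independent (f ` B)"
    by (rule cpair.linear_independent_injective_image[OF f B(2) inj'])
  then have "card (f ` B) \<le> cfun.dim V"
    using V sub B(1) by (intro independent_card_le_dim[OF V(2)]) auto
  moreover have "card (f ` B) = card B"
    using inj B(1) by (intro card_image) (auto intro: inj_on_subset)
  ultimately show ?thesis using B by simp
qed

lemma dim_le_of_surj:
  assumes f: "Vector_Spaces.linear cscale cscale f"
    and sub: "f ` U = V" and U: "U \<subseteq> supported_on X" "finite X"
  shows "cfun.dim V \<le> cfun.dim U"
proof -
  obtain B where B: "B \<subseteq> U" "cfun.independent B" "U \<subseteq> cfun.span B" "card B = cfun.dim U"
    using cfun.basis_exists by metis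
  have fin: "finite B"
    using U B(1,2) by (intro finite_independent[OF U(2) B(2)]) auto
  have "V \<subseteq> cfun.span (f ` B)"
    using sub B(3) cpair.linear_span_image[OF f, of B] by blast
  then have "cfun.dim V \<le> card (f ` B)"
    using fin by (intro cfun.dim_le_card) auto
  also have "\<dots> \<le> card B" using fin by (rule card_image_le)
  finally show ?thesis using B by simp
qed

lemma dim_eq_of_bij:
  assumes "Vector_Spaces.linear cscale cscale f" "cfun.subspace U" "bij_betw f U V"
    "U \<subseteq> supported_on X" "finite X" "V \<subseteq> supported_on Y" "finite Y"
  shows "cfun.dim U = cfun.dim V"
proof (rule antisym)
  show "cfun.dim U \<le> cfun.dim V"
    using assms by (intro dim_le_of_inj[of f U V Y]) (auto simp: bij_betw_def)
  show "cfun.dim V \<le> cfun.dim U"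
    using assms by (intro dim_le_of_surj[of f U V X]) (auto simp: bij_betw_def)
qed

section \<open>Hermitian inner product and orthogonal complements\<close>

definition inner_on :: "'i set \<Rightarrow> ('i \<Rightarrow> complex) \<Rightarrow> ('i \<Rightarrow> complex) \<Rightarrow> complex" where
  "inner_on X f g = (\<Sum>x\<in>X. f x * cnj (g x))"

lemma inner_on_add_left: "inner_on X (f + g) h = inner_on X f h + inner_on X g h"
  by (simp add: inner_on_def algebra_simps sum.distrib)

lemma inner_on_scale_left: "inner_on X (cscale c f) h = c * inner_on X f h"
  by (simp add: inner_on_def cscale_def algebra_simps sum_distrib_left)

lemma inner_on_add_right: "inner_on X h (f + g) = inner_on X h f + inner_on X h g"
  by (simp add: inner_on_def algebra_simps sum.distrib)

lemma inner_on_scale_right: "inner_on X h (cscale c f) = cnj c * inner_on X h f"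
  by (simp add: inner_on_def cscale_def algebra_simps sum_distrib_left)

lemma inner_on_self_eq_0:
  assumes "finite X" "f \<in> supported_on X" "inner_on X f f = 0"
  shows "f = 0"
proof -
  have "(\<Sum>x\<in>X. (cmod (f x))\<^sup>2) = Re (inner_on X f f)"
    by (simp add: inner_on_def cmod_power2 flip: power2_eq_square)
  then have "(\<Sum>x\<in>X. (cmod (f x))\<^sup>2) = 0" using assms by simp
  then have "\<forall>x\<in>X. f x = 0"
    using assms(1) by (subst (asm) sum_nonneg_eq_0_iff) auto
  then show ?thesis
    using supported_onD[OF assms(2)] by (force simp: fun_eq_iff)
qed

definition orthogonal_to :: "'i set \<Rightarrow> ('i \<Rightarrow> complex) set \<Rightarrow> ('i \<Rightarrow> complex) set" where
  "orthogonal_to X U = {f. \<forall>u\<in>U. inner_on X f u = 0}"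

lemma subspace_orthogonal_to: "cfun.subspace (orthogonal_to X U)"
  by (auto simp: cfun.subspace_def orthogonal_to_def inner_on_add_left inner_on_scale_left)
     (simp add: inner_on_def)

lemma orthogonal_to_span: "orthogonal_to X (cfun.span B) = orthogonal_to X B"
proof -
  have "inner_on X f u = 0" if f: "f \<in> orthogonal_to X B" and u: "u \<in> cfun.span B" for f u
    using u
  proof (induction rule: cfun.span_induct_alt)
    case base
    then show ?case by (simp add: inner_on_def)
  next
    case (step c x y)
    then show ?case using f
      unfolding inner_on_add_right inner_on_scale_right by (simp add: orthogonal_to_def)
  qed
  then show ?thesis
    by (auto simp: orthogonal_to_def cfun.span_base)
qed

text \<open>Gram-Schmidt: the new vector \<open>b\<close> is replaced by its component
  \<open>b'\<close> orthogonal to the earlier ones.\<close>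

lemma orthogonal_decomposition_finite:
  assumes "finite X" "finite B" "B \<subseteq> supported_on X"
  shows "\<exists>u\<in>cfun.span B. f - u \<in> orthogonal_to X B"
  using assms(2,3)
proof (induction B arbitrary: f)
  case empty
  then show ?case by (auto simp: orthogonal_to_def)
next
  case (insert b B)
  obtain v where v: "v \<in> cfun.span B" "b - v \<in> orthogonal_to X B"
    using insert.IH[of b] insert.prems by blast
  obtain u where u: "u \<in> cfun.span B" "f - u \<in> orthogonal_to X B"
    using insert.IH[of f] insert.prems by blast
  define b' where "b' = b - v"
  have mono: "cfun.span B \<subseteq> cfun.span (insert b B)"
    by (intro cfun.span_mono) auto
  have b'span: "b' \<in> cfun.span (insert b B)"
    unfolding b'_def using mono v by (intro cfun.span_diff) (auto intro: cfun.span_base)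
  have "v \<in> supported_on X"
    using v(1) insert.prems cfun.span_minimal[OF _ subspace_supported_on, of B X] by auto
  then have b'supp: "b' \<in> supported_on X"
    unfolding b'_def using insert.prems by (intro cfun.subspace_diff[OF subspace_supported_on]) auto
  have bsplit: "b = b' + v" by (simp add: b'_def)
  \<comment> \<open>If \<open>b\<close> already lies in the span of \<open>B\<close>, then
    \<open>b' = 0\<close> and this quotient is 0 by the convention for division, so
    \<open>w = u\<close>.\<close>
  define c where "c = inner_on X (f - u) b' / inner_on X b' b'"
  define w where "w = u + cscale c b'"
  have orthB: "f - w \<in> orthogonal_to X B"
  proof -
    have "f - w = (f - u) + cscale (- c) b'"
      by (auto simp: w_def cscale_def fun_eq_iff)
    then show ?thesis
      using u(2) v(2) unfolding b'_def[symmetric]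
      by (metis cfun.subspace_add cfun.subspace_scale subspace_orthogonal_to)
  qed
  have orthb': "inner_on X (f - w) b' = 0"
  proof (cases "b' = 0")
    case True
    then show ?thesis by (simp add: inner_on_def)
  next
    case False
    then have ne: "inner_on X b' b' \<noteq> 0"
      using inner_on_self_eq_0[OF assms(1) b'supp] by auto
    have "f - w = (f - u) + cscale (- c) b'"
      by (auto simp: w_def cscale_def fun_eq_iff)
    then have "inner_on X (f - w) b' = inner_on X (f - u) b' - c * inner_on X b' b'"
      unfolding \<open>f - w = _\<close> inner_on_add_left inner_on_scale_left by simp
    then show ?thesis
      using ne by (simp add: c_def)
  qed
  have "inner_on X (f - w) v = 0"
    using orthB v(1) orthogonal_to_span[of X B] by (auto simp: orthogonal_to_def)
  then have "inner_on X (f - w) b = 0"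
    unfolding bsplit using orthb' by (simp add: inner_on_add_right)
  then have "f - w \<in> orthogonal_to X (insert b B)"
    using orthB by (simp add: orthogonal_to_def)
  moreover have "w \<in> cfun.span (insert b B)"
    unfolding w_def using u(1) mono b'span by (intro cfun.span_add cfun.span_scale) auto
  ultimately show ?case by blast
qed

lemma orthogonal_decomposition:
  assumes "finite X" "cfun.subspace U" "U \<subseteq> supported_on X"
  obtains u where "u \<in> U" "f - u \<in> orthogonal_to X U"
proof -
  obtain B where B: "B \<subseteq> U" "cfun.independent B" "U \<subseteq> cfun.span B"
    using cfun.basis_exists by metis
  have "finite B" using finite_independent[of X B] assms B by auto
  moreover have "cfun.span B = U" using B assms(2) by (meson cfun.span_minimal subset_antisym)
  ultimately show ?thesis
    using orthogonal_decomposition_finite[of X B f] assms B orthogonal_to_span[of X B] that by auto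
qed

lemma orthogonal_to_disjoint:
  assumes "finite X" "U \<subseteq> supported_on X" "u \<in> U" "u \<in> orthogonal_to X U"
  shows "u = 0"
  using inner_on_self_eq_0[of X u] assms by (auto simp: orthogonal_to_def)

text \<open>
  Since the kernel is real, the row space and the column space of \<open>K\<close> are the images of a linear
  map and of its adjoint, and the map restricts to an isomorphism between them.
\<close>

definition kernel_map :: "'x set \<Rightarrow> ('x \<Rightarrow> 'y \<Rightarrow> complex) \<Rightarrow> ('x \<Rightarrow> complex) \<Rightarrow> 'y \<Rightarrow> complex" where
  "kernel_map X K G = (\<lambda>y. \<Sum>x\<in>X. K x y * G x)"

lemma linear_kernel_map: "Vector_Spaces.linear cscale cscale (kernel_map X K)"
  unfolding Vector_Spaces.linear_iff
  by (auto simp: kernel_map_def cscale_def fun_eq_iff algebra_simps sum.distrib sum_distrib_left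
      intro: cfun.vector_space_axioms)

lemma bij_betw_kernel_map:
  fixes K :: "'x \<Rightarrow> 'y \<Rightarrow> complex"
  assumes fin: "finite X"
    and real: "\<And>x y. cnj (K x y) = K x y"
    and supp: "\<And>x y. K x y \<noteq> 0 \<Longrightarrow> x \<in> X \<and> y \<in> Y"
  shows "bij_betw (kernel_map X K)
           (cfun.span ((\<lambda>y x. K x y) ` Y)) (cfun.span (K ` X))"
proof -
  define W where "W = cfun.span ((\<lambda>y x. K x y) ` Y)"
  have subW: "cfun.subspace W" by (simp add: W_def)
  have suppW: "W \<subseteq> supported_on X"
    unfolding W_def using supp
    by (intro cfun.span_minimal subspace_supported_on) (auto simp: supported_on_def)
  \<comment> \<open>Since \<open>K\<close> is real, the value at \<open>y\<close> is the inner
    product with a column of \<open>K\<close>. Hence the null space is the orthogonal complement of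
    the column space.\<close>
  have zero_iff: "kernel_map X K G = 0 \<longleftrightarrow> G \<in> orthogonal_to X W" for G
  proof -
    have "kernel_map X K G y = inner_on X G (\<lambda>x. K x y)" for y
      by (simp add: kernel_map_def inner_on_def real mult.commute)
    moreover have "inner_on X G (\<lambda>x. K x y) = 0" if "y \<notin> Y" for y
    proof -
      have "K x y = 0" for x using supp that by blast
      then show ?thesis by (simp add: inner_on_def)
    qed
    ultimately have "kernel_map X K G = 0 \<longleftrightarrow> G \<in> orthogonal_to X ((\<lambda>y x. K x y) ` Y)"
      by (fastforce simp: fun_eq_iff orthogonal_to_def)
    then show ?thesis by (simp add: W_def orthogonal_to_span)
  qed
  have inj: "inj_on (kernel_map X K) W"
  proof (subst cpair.linear_inj_on_iff_eq_0[OF linear_kernel_map subW], intro ballI impI)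
    fix G assume "G \<in> W" "kernel_map X K G = 0"
    then show "G = 0" using zero_iff orthogonal_to_disjoint[OF fin suppW] by blast
  qed
  have "kernel_map X K G \<in> cfun.span (K ` X)" for G
  proof -
    have "kernel_map X K G = (\<Sum>x\<in>X. cscale (G x) (K x))"
      by (auto simp: kernel_map_def fun_eq_iff cscale_def sum_fun_apply mult.commute)
    also have "\<dots> \<in> cfun.span (K ` X)"
      by (intro cfun.span_sum cfun.span_scale cfun.span_base) auto
    finally show ?thesis .
  qed
  moreover have "K x \<in> kernel_map X K ` W" if x: "x \<in> X" for x
  proof -
    \<comment> \<open>The row \<open>K x\<close> is the image of the point mass at \<open>x\<close>.
      Discarding the part of the point mass that is orthogonal to \<open>W\<close> does not change
      the image.\<close>
    define \<delta> :: "'x \<Rightarrow> complex" where "\<delta> = (\<lambda>y. of_bool (y = x))"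
    obtain u where u: "u \<in> W" "\<delta> - u \<in> orthogonal_to X W"
      using orthogonal_decomposition[OF fin subW suppW] by blast
    have "kernel_map X K \<delta> - kernel_map X K u = 0"
      using zero_iff u(2) by (simp flip: cpair.linear_diff[OF linear_kernel_map])
    moreover have "kernel_map X K \<delta> = K x"
    proof
      fix y
      have "(\<Sum>z\<in>X. K z y * \<delta> z) = (\<Sum>z\<in>X. if z = x then K z y else 0)"
        by (intro sum.cong) (auto simp: \<delta>_def)
      then show "kernel_map X K \<delta> y = K x y"
        using fin x by (simp add: kernel_map_def)
    qed
    ultimately have "K x = kernel_map X K u" by simp
    then show ?thesis using u(1) by blast
  qed
  then have "cfun.span (K ` X) \<subseteq> kernel_map X K ` W"
    by (intro cfun.span_minimal cpair.linear_subspace_image[OF linear_kernel_map subW]) blast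
  ultimately show ?thesis
    using inj by (auto simp: bij_betw_def W_def)
qed

section \<open>Multiplicity of the trivial representation\<close>

lemma dim_strict_mono:
  assumes "finite X" "V \<subseteq> supported_on X" "cfun.subspace U" "U \<subseteq> V" "x \<in> V" "x \<notin> U"
  shows "cfun.dim U < cfun.dim V"
proof -
  obtain B where B: "B \<subseteq> U" "cfun.independent B" "U \<subseteq> cfun.span B" "card B = cfun.dim U"
    using cfun.basis_exists by metis
  have "cfun.span B \<subseteq> U" using B(1) assms(3) by (rule cfun.span_minimal)
  then have "x \<notin> cfun.span B" using assms(6) by auto
  then have ind: "cfun.independent (insert x B)"
    using B(2) by (rule cfun.independent_insertI)
  have "finite B" using finite_independent[of X B] B assms by auto
  moreover have "x \<notin> B" using B(1) assms(6) by auto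
  moreover have "card (insert x B) \<le> cfun.dim V"
    using assms B by (intro independent_card_le_dim[OF assms(1) _ ind]) auto
  ultimately show ?thesis using B(4) by simp
qed

definition invariants ::
  "nat \<Rightarrow> ((nat \<Rightarrow> nat) \<Rightarrow> ('i \<Rightarrow> complex) \<Rightarrow> 'i \<Rightarrow> complex) \<Rightarrow> ('i \<Rightarrow> complex) set
    \<Rightarrow> ('i \<Rightarrow> complex) set" where
  "invariants N act W = {w \<in> W. \<forall>\<sigma>. \<sigma> permutes {..<N} \<longrightarrow> act \<sigma> w = w}"

text \<open>The inner product sees only values on \<open>X\<close>, so isometry and invertibility
  are asked of functions supported there. The last clause allows \<open>act \<sigma>\<close> to be
  moved to the other side of the inner product.\<close>

definition unitary_act ::
  "nat \<Rightarrow> 'i set \<Rightarrow> ((nat \<Rightarrow> nat) \<Rightarrow> ('i \<Rightarrow> complex) \<Rightarrow> 'i \<Rightarrow> complex) \<Rightarrow> bool" where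
  "unitary_act N X act \<longleftrightarrow> (\<forall>\<sigma>. \<sigma> permutes {..<N} \<longrightarrow>
     Vector_Spaces.linear cscale cscale (act \<sigma>) \<and>
     (\<forall>f\<in>supported_on X. \<forall>g\<in>supported_on X. inner_on X (act \<sigma> f) (act \<sigma> g) = inner_on X f g) \<and>
     (\<forall>f\<in>supported_on X. act \<sigma> (act (inv_into UNIV \<sigma>) f) = f))"

lemma subrep_orthogonal_complement:
  assumes act: "unitary_act N X act" and W: "subrep N act W" and U: "subrep N act U"
    and "U \<subseteq> W" "W \<subseteq> supported_on X"
  shows "subrep N act (W \<inter> orthogonal_to X U)"
  unfolding subrep_def
proof (intro conjI allI impI)
  show "cfun.subspace (W \<inter> orthogonal_to X U)"
    using W by (intro cfun.subspace_inter subspace_orthogonal_to) (simp add: subrep_def)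
  fix \<sigma> assume \<sigma>: "\<sigma> permutes {..<N}"
  show "act \<sigma> ` (W \<inter> orthogonal_to X U) \<subseteq> W \<inter> orthogonal_to X U"
  proof clarify
    fix w assume w: "w \<in> W" "w \<in> orthogonal_to X U"
    have "inner_on X (act \<sigma> w) u = 0" if u: "u \<in> U" for u
    proof -
      have "act (inv_into UNIV \<sigma>) u \<in> U"
        using U u permutes_inv[OF \<sigma>] by (auto simp: subrep_def)
      moreover have "inner_on X (act \<sigma> w) (act \<sigma> (act (inv_into UNIV \<sigma>) u)) = inner_on X w (act (inv_into UNIV \<sigma>) u)"
        using act \<sigma> w(1) \<open>act (inv_into UNIV \<sigma>) u \<in> U\<close> assms(4,5) unfolding unitary_act_def by blast
      moreover have "act \<sigma> (act (inv_into UNIV \<sigma>) u) = u"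
        using act \<sigma> u assms(4,5) unfolding unitary_act_def by blast
      ultimately show ?thesis using w(2) by (simp add: orthogonal_to_def)
    qed
    moreover have "act \<sigma> w \<in> W" using W \<sigma> w(1) by (auto simp: subrep_def)
    ultimately show "act \<sigma> w \<in> W \<inter> orthogonal_to X U" by (simp add: orthogonal_to_def)
  qed
qed

text \<open>A tuple for the longer list is a tuple for \<open>Us\<close> with one more entry, so the
  sum map factors through the two given bijections.\<close>

lemma irreducible_decomposition_snoc:
  assumes dec: "irreducible_decomposition N act U' Us" and U: "irreducible_rep N act U"
    and bij: "bij_betw (\<lambda>(x, y). x + y) (U' \<times> U) W"
  shows "irreducible_decomposition N act W (Us @ [U])"
proof -
  let ?n = "length Us"
  let ?P = "\<Pi>\<^sub>E i\<in>{..<?n}. Us ! i"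
  let ?P' = "\<Pi>\<^sub>E i\<in>{..<Suc ?n}. (Us @ [U]) ! i"
  let ?S = "\<lambda>u. \<Sum>i<?n. u i"
  have b1: "bij_betw ?S ?P U'" using dec by (simp add: irreducible_decomposition_def)
  have P': "?P' = (\<lambda>(y, g). g(?n := y)) ` (U \<times> ?P)"
  proof -
    have "?P' = Pi\<^sub>E (insert ?n {..<?n}) ((!) (Us @ [U]))" by (simp add: lessThan_Suc)
    also have "\<dots> = (\<lambda>(y, g). g(?n := y)) ` ((Us @ [U]) ! ?n \<times> Pi\<^sub>E {..<?n} ((!) (Us @ [U])))"
      by (rule PiE_insert_eq)
    also have "Pi\<^sub>E {..<?n} ((!) (Us @ [U])) = ?P"
      by (intro PiE_cong) (simp add: nth_append)
    finally show ?thesis by (simp only: nth_append_length)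
  qed
  have sum_upd: "(\<Sum>i<Suc ?n. (g(?n := y)) i) = ?S g + y" for g :: "nat \<Rightarrow> 'a \<Rightarrow> complex" and y
    by simp
  have "bij_betw (\<lambda>u. \<Sum>i<Suc ?n. u i) ?P' W"
    unfolding bij_betw_def
  proof
    show "inj_on (\<lambda>u. \<Sum>i<Suc ?n. u i) ?P'"
    proof (rule inj_onI)
      fix u v assume "u \<in> ?P'" "v \<in> ?P'" and eq: "(\<Sum>i<Suc ?n. u i) = (\<Sum>i<Suc ?n. v i)"
      then obtain y g z h where u: "u = g(?n := y)" "y \<in> U" "g \<in> ?P"
        and v: "v = h(?n := z)" "z \<in> U" "h \<in> ?P"
        unfolding P' by auto
      have mem: "(?S g, y) \<in> U' \<times> U" "(?S h, z) \<in> U' \<times> U"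
        using b1 u v by (auto simp: bij_betw_def)
      have "?S g + y = ?S h + z"
        using eq unfolding u(1) v(1) sum_upd .
      then have "(?S g, y) = (?S h, z)"
        using bij mem by (intro inj_onD[of "\<lambda>(x, y). x + y" "U' \<times> U"]) (auto simp: bij_betw_def)
      moreover from this have "g = h"
        using b1 u v by (intro inj_onD[of ?S ?P]) (auto simp: bij_betw_def)
      ultimately show "u = v" using u v by simp
    qed
    have "(\<lambda>u. \<Sum>i<Suc ?n. u i) ` ?P' = (\<lambda>(y, g). ?S g + y) ` (U \<times> ?P)"
      unfolding P' image_image
    proof (rule image_cong[OF refl])
      fix x assume "x \<in> U \<times> ?P"
      obtain y g where "x = (y, g)" by (cases x)
      then show "(\<Sum>i<Suc ?n. (case x of (y, g) \<Rightarrow> g(?n := y)) i) = (case x of (y, g) \<Rightarrow> ?S g + y)"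
        by (simp only: prod.case sum_upd)
    qed
    also have "\<dots> = (\<lambda>(x, y). x + y) ` (?S ` ?P \<times> U)"
      by force
    also have "\<dots> = W" using b1 bij by (simp add: bij_betw_def)
    finally show "(\<lambda>u. \<Sum>i<Suc ?n. u i) ` ?P' = W" .
  qed
  then show ?thesis
    using dec U by (auto simp: irreducible_decomposition_def)
qed

lemma bij_betw_plus_orthogonal:
  assumes "finite X" "cfun.subspace U" "cfun.subspace W" "U \<subseteq> W" "W \<subseteq> supported_on X"
  shows "bij_betw (\<lambda>(x, y). x + y) ((W \<inter> orthogonal_to X U) \<times> U) W"
  unfolding bij_betw_def
proof
  show "inj_on (\<lambda>(x, y). x + y) ((W \<inter> orthogonal_to X U) \<times> U)"
  proof (rule inj_onI, clarify)
    fix a b x y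
    assume *: "a \<in> orthogonal_to X U" "x \<in> orthogonal_to X U" "b \<in> U" "y \<in> U" "a + b = x + y"
    have e: "a - x = y - b" using *(5) by (simp add: algebra_simps)
    have "a - x \<in> orthogonal_to X U"
      using * by (intro cfun.subspace_diff[OF subspace_orthogonal_to])
    moreover have "a - x \<in> U"
      unfolding e using * assms(2) by (intro cfun.subspace_diff)
    ultimately have "a - x = 0"
      using orthogonal_to_disjoint[of X U] assms by blast
    then show "a = x \<and> b = y" using e by simp
  qed
  show "(\<lambda>(x, y). x + y) ` ((W \<inter> orthogonal_to X U) \<times> U) = W"
  proof
    show "(\<lambda>(x, y). x + y) ` ((W \<inter> orthogonal_to X U) \<times> U) \<subseteq> W"
      using assms(4) cfun.subspace_add[OF assms(3)] by auto
    show "W \<subseteq> (\<lambda>(x, y). x + y) ` ((W \<inter> orthogonal_to X U) \<times> U)"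
    proof
      fix w assume w: "w \<in> W"
      obtain u where u: "u \<in> U" "w - u \<in> orthogonal_to X U"
        using orthogonal_decomposition[of X U w] assms by blast
      have "w - u \<in> W" using u w assms by (intro cfun.subspace_diff) auto
      then have "(w - u, u) \<in> (W \<inter> orthogonal_to X U) \<times> U" using u by blast
      moreover have "w = (\<lambda>(x, y). x + y) (w - u, u)" by simp
      ultimately show "w \<in> (\<lambda>(x, y). x + y) ` ((W \<inter> orthogonal_to X U) \<times> U)"
        by (rule rev_image_eqI)
    qed
  qed
qed

text \<open>Maschke's theorem in its unitary form: a nonzero subrepresentation of least dimension is
  irreducible, and its orthogonal complement has smaller dimension than \<open>W\<close>.\<close>

lemma irreducible_decomposition_exists:
  assumes fin: "finite X" and act: "unitary_act N X act"
  shows "subrep N act W \<Longrightarrow> W \<subseteq> supported_on X \<Longrightarrow> \<exists>Us. irreducible_decomposition N act W Us"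
proof (induction "cfun.dim W" arbitrary: W rule: less_induct)
  case (less W)
  have subW: "cfun.subspace W" using less.prems by (simp add: subrep_def)
  show ?case
  proof (cases "W = {0}")
    case True
    then have "irreducible_decomposition N act W []"
      by (simp add: irreducible_decomposition_def bij_betw_def)
    then show ?thesis ..
  next
    case False
    define P where "P = (\<lambda>U. subrep N act U \<and> U \<subseteq> W \<and> U \<noteq> {0})"
    have "P W" using False less.prems by (simp add: P_def)
    then obtain U where U: "P U" and min: "\<And>U'. P U' \<Longrightarrow> cfun.dim U \<le> cfun.dim U'"
      using ex_has_least_nat[of P W cfun.dim] by blast
    have subU: "cfun.subspace U" "U \<subseteq> W" "subrep N act U"
      using U by (auto simp: P_def subrep_def)
    have "irreducible_rep N act U"
      unfolding irreducible_rep_def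
    proof (intro conjI allI impI)
      show "subrep N act U" "U \<noteq> {0}" using U by (auto simp: P_def)
      fix V assume V: "V \<subseteq> U" "subrep N act V"
      show "V = {0} \<or> V = U"
      proof (rule ccontr)
        assume "\<not> (V = {0} \<or> V = U)"
        then obtain x where x: "x \<in> U" "x \<notin> V" and "P V"
          using V subU(2) by (auto simp: P_def)
        have "cfun.dim V < cfun.dim U"
          using V subU(2) less.prems(2) by (intro dim_strict_mono[OF fin _ _ V(1) x]) (auto simp: subrep_def)
        then show False using min[OF \<open>P V\<close>] by simp
      qed
    qed
    moreover obtain Us where "irreducible_decomposition N act (W \<inter> orthogonal_to X U) Us"
    proof -
      obtain u where u: "u \<in> U" "u \<noteq> 0"
        using U cfun.subspace_0[OF subU(1)] by (auto simp: P_def)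
      have "u \<notin> W \<inter> orthogonal_to X U"
        using u orthogonal_to_disjoint[OF fin, of U u] subU less.prems(2) by auto
      moreover have comp: "subrep N act (W \<inter> orthogonal_to X U)"
        using subrep_orthogonal_complement[OF act less.prems(1) subU(3,2) less.prems(2)] .
      ultimately have "cfun.dim (W \<inter> orthogonal_to X U) < cfun.dim W"
        using u(1) subU(2) less.prems(2)
        by (intro dim_strict_mono[OF fin, where x = u]) (auto simp: subrep_def)
      then show ?thesis using less.hyps comp less.prems(2) that by blast
    qed
    ultimately show ?thesis
      using irreducible_decomposition_snoc bij_betw_plus_orthogonal[OF fin subU(1) subW subU(2) less.prems(2)]
      by blast
  qed
qed

text \<open>The line through an invariant vector is a subrepresentation, hence all of
  \<open>U\<close>.\<close>

lemma irreducible_rep_invariant: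
  assumes irr: "irreducible_rep N act U" and lin: "\<And>\<sigma>. \<sigma> permutes {..<N} \<Longrightarrow> Vector_Spaces.linear cscale cscale (act \<sigma>)"
    and u: "u \<in> invariants N act U" "u \<noteq> 0"
  shows "U = range (\<lambda>c. cscale c u)"
proof -
  let ?L = "range (\<lambda>c. cscale c u)"
  have L: "?L = cfun.span {u}" by (auto simp: cfun.span_singleton)
  have "act \<sigma> (cscale c u) = cscale c u" if "\<sigma> permutes {..<N}" for \<sigma> c
    using that u cpair.linear_scale[OF lin[OF that]] by (simp add: invariants_def)
  then have "subrep N act ?L"
    by (auto simp: subrep_def) (simp add: L)
  moreover have "?L \<subseteq> U"
    unfolding L using irr u
    by (intro cfun.span_minimal) (auto simp: irreducible_rep_def subrep_def invariants_def)
  moreover have "?L \<noteq> {0}" using u(2) cfun.scale_one[of u] by (metis rangeI singletonD)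
  ultimately show ?thesis using irr unfolding irreducible_rep_def by blast
qed

text \<open>An isomorphism pulls the constant 1 back to an invariant vector. Conversely, a nonzero
  invariant vector spans \<open>U\<close>, and the coordinate with respect to it is an
  isomorphism.\<close>

lemma isomorphic_trivial_iff:
  assumes irr: "irreducible_rep N act U" and lin: "\<And>\<sigma>. \<sigma> permutes {..<N} \<Longrightarrow> Vector_Spaces.linear cscale cscale (act \<sigma>)"
    and fin: "finite X" and U: "U \<subseteq> supported_on X"
  shows "isomorphic_rep N act U trivial_act trivial_space \<longleftrightarrow> (\<exists>u\<in>invariants N act U. u \<noteq> 0)"
proof
  assume "isomorphic_rep N act U trivial_act trivial_space"
  then obtain T :: "('a \<Rightarrow> complex) \<Rightarrow> unit \<Rightarrow> complex"
    where T: "Vector_Spaces.linear cscale cscale T" "bij_betw T U UNIV"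
      "\<And>\<sigma> w. \<sigma> permutes {..<N} \<Longrightarrow> w \<in> U \<Longrightarrow> T (act \<sigma> w) = T w"
    by (auto simp: isomorphic_rep_def trivial_act_def trivial_space_def)
  obtain u where u: "u \<in> U" "T u = (\<lambda>_. 1)"
    using T(2) by (metis UNIV_I bij_betw_imp_surj_on imageE)
  have "act \<sigma> u = u" if \<sigma>: "\<sigma> permutes {..<N}" for \<sigma>
  proof -
    have "act \<sigma> u \<in> U" using irr \<sigma> u by (auto simp: irreducible_rep_def subrep_def)
    then show ?thesis using T(2) T(3)[OF \<sigma> u(1)] u(1) by (auto simp: bij_betw_def dest: inj_onD)
  qed
  moreover have "u \<noteq> 0"
  proof
    assume "u = 0"
    then have "T u = 0" using cpair.linear_0[OF T(1)] by simp
    then show False using u(2) by (simp add: fun_eq_iff)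
  qed
  ultimately show "\<exists>u\<in>invariants N act U. u \<noteq> 0" using u(1) by (auto simp: invariants_def)
next
  assume "\<exists>u\<in>invariants N act U. u \<noteq> 0"
  then obtain u where u: "u \<in> invariants N act U" "u \<noteq> 0" by blast
  have range: "U = range (\<lambda>c. cscale c u)"
    using irreducible_rep_invariant[OF irr lin u] .
  have uU: "u \<in> U" using u by (simp add: invariants_def)
  have ne: "inner_on X u u \<noteq> 0" using inner_on_self_eq_0[OF fin, of u] u(2) U uU by auto
  define T :: "('a \<Rightarrow> complex) \<Rightarrow> unit \<Rightarrow> complex" where "T = (\<lambda>f _. inner_on X f u / inner_on X u u)"
  have Tu: "T (cscale c u) = (\<lambda>_. c)" for c
    using ne by (simp add: T_def inner_on_scale_left)
  have "Vector_Spaces.linear cscale cscale T"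
    unfolding Vector_Spaces.linear_iff
    by (intro conjI allI cfun.vector_space_axioms)
      (auto simp: T_def fun_eq_iff inner_on_add_left inner_on_scale_left cscale_def[of _ "\<lambda>_. _ / _"] add_divide_distrib)
  moreover have "bij_betw T U UNIV"
    unfolding bij_betw_def
  proof
    show "inj_on T U"
    proof (rule inj_onI)
      fix x y assume xy: "x \<in> U" "y \<in> U" "T x = T y"
      obtain c where "x = cscale c u" using xy(1) range by blast
      moreover obtain c' where "y = cscale c' u" using xy(2) range by blast
      ultimately show "x = y" using xy(3) by (metis Tu)
    qed
    show "T ` U = UNIV"
    proof (rule sym, rule UNIV_eq_I)
      fix g :: "unit \<Rightarrow> complex"
      have "cscale (g ()) u \<in> U" using range by blast
      moreover have "g = T (cscale (g ()) u)" by (simp add: Tu fun_eq_iff)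
      ultimately show "g \<in> T ` U" by (intro image_eqI[where f = T and x = "cscale (g ()) u"])
    qed
  qed
  moreover have "T (act \<sigma> w) = T w" if "\<sigma> permutes {..<N}" "w \<in> U" for \<sigma> w
    using that u cpair.linear_scale[OF lin[OF that(1)]] unfolding range by (auto simp: invariants_def)
  ultimately show "isomorphic_rep N act U trivial_act trivial_space"
    unfolding isomorphic_rep_def trivial_act_def trivial_space_def by auto
qed

lemma irreducible_decomposition_unique:
  assumes "irreducible_decomposition N act W Us"
    and "\<And>i. i < length Us \<Longrightarrow> u i \<in> Us ! i" "\<And>i. i < length Us \<Longrightarrow> v i \<in> Us ! i"
    and "(\<Sum>i<length Us. u i) = (\<Sum>i<length Us. v i)" and "i < length Us"
  shows "u i = v i"
proof -
  \<comment> \<open>The bijection of the decomposition concerns extensional functions, so both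
    families are cut off outside the index range before injectivity applies.\<close>
  let ?r = "\<lambda>u. restrict u {..<length Us}"
  have "?r u = ?r v"
    using assms by (intro inj_onD[of "\<lambda>u. \<Sum>i<length Us. u i" "\<Pi>\<^sub>E i\<in>{..<length Us}. Us ! i"])
      (auto simp: irreducible_decomposition_def bij_betw_def)
  then show ?thesis using assms(5) by (metis lessThan_iff restrict_apply)
qed

lemma irreducible_decomposition_component:
  assumes dec: "irreducible_decomposition N act W Us" and i: "i < length Us"
  shows "Us ! i \<subseteq> W"
proof
  fix x assume x: "x \<in> Us ! i"
  have zero: "0 \<in> Us ! j" if "j < length Us" for j
    using dec that cfun.subspace_0[of "Us ! j"]
    by (auto simp: irreducible_decomposition_def irreducible_rep_def subrep_def)
  let ?u = "\<lambda>j\<in>{..<length Us}. if j = i then x else 0"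
  have "?u \<in> (\<Pi>\<^sub>E j\<in>{..<length Us}. Us ! j)" using x zero by auto
  then have "(\<Sum>j<length Us. ?u j) \<in> W"
    using dec bij_betwE unfolding irreducible_decomposition_def by blast
  moreover have "(\<Sum>j<length Us. ?u j) = (\<Sum>j<length Us. if j = i then x else 0)"
    by (intro sum.cong) auto
  then have "(\<Sum>j<length Us. ?u j) = x" using i by simp
  ultimately show "x \<in> W" by simp
qed

text \<open>The count is the same for every decomposition, which makes the definite description in
  \<open>rep_multiplicity\<close> meaningful. Each summand isomorphic to the trivial representation
  contributes one basis vector of the invariants.\<close>

lemma trivial_multiplicity:
  assumes fin: "finite X" and act: "unitary_act N X act" and W: "W \<subseteq> supported_on X"
    and dec: "irreducible_decomposition N act W Us"
  shows "card {i. i < length Us \<and> isomorphic_rep N act (Us ! i) trivial_act trivial_space} =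
    cfun.dim (invariants N act W)"
proof -
  let ?n = "length Us"
  define I where "I = {i. i < ?n \<and> isomorphic_rep N act (Us ! i) trivial_act trivial_space}"
  have lin: "Vector_Spaces.linear cscale cscale (act \<sigma>)" if "\<sigma> permutes {..<N}" for \<sigma>
    using act that by (simp add: unitary_act_def)
  have irr: "irreducible_rep N act (Us ! i)" if "i < ?n" for i
    using dec that by (auto simp: irreducible_decomposition_def)
  have zero: "0 \<in> Us ! j" if "j < ?n" for j
    using irr[OF that] cfun.subspace_0[of "Us ! j"] by (auto simp: irreducible_rep_def subrep_def)
  have UW: "Us ! i \<subseteq> W" if "i < ?n" for i
    using irreducible_decomposition_component[OF dec that] .
  have iso_iff: "i \<in> I \<longleftrightarrow> (\<exists>u\<in>invariants N act (Us ! i). u \<noteq> 0)" if "i < ?n" for i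
    using isomorphic_trivial_iff[OF irr[OF that] lin fin] UW[OF that] W that by (auto simp: I_def)
  obtain b where b: "\<And>i. i \<in> I \<Longrightarrow> b i \<in> invariants N act (Us ! i) \<and> b i \<noteq> 0"
    using iso_iff by (metis (lifting) I_def mem_Collect_eq)
  have I: "I \<subseteq> {..<?n}" by (auto simp: I_def)
  have finI: "finite I" using I finite_subset by blast
  have sumI: "(\<Sum>i\<in>I. f i) = (\<Sum>i<?n. if i \<in> I then f i else 0)" for f :: "nat \<Rightarrow> 'a \<Rightarrow> complex"
    using I by (simp add: sum.If_cases Int_absorb1)
  have scal0: "c i = 0" if "(\<Sum>i\<in>I. cscale (c i) (b i)) = 0" "i \<in> I" for c i
  proof -
    let ?u = "\<lambda>i. if i \<in> I then cscale (c i) (b i) else 0"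
    have "?u i = 0"
    proof (rule irreducible_decomposition_unique[OF dec, where v = "\<lambda>_. 0"])
      show "?u j \<in> Us ! j" if "j < ?n" for j
        using b[of j] zero[OF that] irr[OF that]
        by (auto simp: irreducible_rep_def subrep_def invariants_def intro!: cfun.subspace_scale)
      show "(\<Sum>i<?n. ?u i) = (\<Sum>i<?n. 0)" using that(1) by (simp add: sumI)
    qed (use zero that I in auto)
    then show ?thesis using that(2) b by auto
  qed
  have inj: "inj_on b I"
  proof (rule inj_onI, rule ccontr)
    fix i j assume ij: "i \<in> I" "j \<in> I" "b i = b j" "i \<noteq> j"
    let ?c = "\<lambda>l. if l = i then 1 else if l = j then -1 else 0 :: complex"
    have "(\<Sum>l\<in>I. cscale (?c l) (b l)) = (\<Sum>l\<in>{i, j}. cscale (?c l) (b l))"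
      using ij finI by (intro sum.mono_neutral_right) (auto simp: cscale_def fun_eq_iff)
    also have "\<dots> = 0" using ij by (auto simp: cscale_def fun_eq_iff)
    finally have "?c i = 0" by (rule scal0) fact
    then show False by simp
  qed
  have "cfun.independent (b ` I)"
  proof (rule cfun.independent_if_scalars_zero)
    fix f x assume f: "(\<Sum>x\<in>b ` I. cscale (f x) x) = 0" and x: "x \<in> b ` I"
    then have "(\<Sum>i\<in>I. cscale (f (b i)) (b i)) = 0" by (simp add: sum.reindex[OF inj])
    then show "f x = 0" using scal0[of "\<lambda>i. f (b i)"] x by blast
  qed (use finI in auto)
  moreover have "b ` I \<subseteq> invariants N act W"
    using b I UW by (fastforce simp: invariants_def)
  moreover have "invariants N act W \<subseteq> cfun.span (b ` I)"
  proof
    fix w assume w: "w \<in> invariants N act W"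
    then have "w \<in> (\<lambda>u. \<Sum>i<?n. u i) ` (\<Pi>\<^sub>E i\<in>{..<?n}. Us ! i)"
      using dec by (simp add: irreducible_decomposition_def bij_betw_def invariants_def)
    then obtain u where u: "u \<in> (\<Pi>\<^sub>E i\<in>{..<?n}. Us ! i)" and wu: "w = (\<Sum>i<?n. u i)"
      by blast
    have "u i \<in> cfun.span (b ` I)" if i: "i < ?n" for i
    proof (cases "u i = 0")
      case False
      \<comment> \<open>\<open>act \<sigma>\<close> preserves every summand, so it carries the
        components of \<open>w\<close> to those of \<open>act \<sigma> w = w\<close>; uniqueness of
        components does the rest.\<close>
      have "act \<sigma> (u i) = u i" if \<sigma>: "\<sigma> permutes {..<N}" for \<sigma>
      proof (rule irreducible_decomposition_unique[OF dec])
        show "act \<sigma> (u i) \<in> Us ! i" if "i < ?n" for i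
        proof -
          have "u i \<in> Us ! i" using u that by auto
          moreover have "act \<sigma> ` (Us ! i) \<subseteq> Us ! i"
            using irr[OF that] \<sigma> by (simp add: irreducible_rep_def subrep_def)
          ultimately show ?thesis by blast
        qed
        have "(\<Sum>i<?n. act \<sigma> (u i)) = act \<sigma> w"
          unfolding wu by (rule cpair.linear_sum[OF lin[OF \<sigma>], symmetric])
        also have "\<dots> = w" using w \<sigma> by (simp add: invariants_def)
        finally show "(\<Sum>i<?n. act \<sigma> (u i)) = (\<Sum>i<?n. u i)" using wu by simp
      qed (use u i in auto)
      then have ui: "u i \<in> invariants N act (Us ! i)"
        using u i by (auto simp: invariants_def)
      then have iI: "i \<in> I" using iso_iff[OF i] False by blast
      then have "Us ! i = range (\<lambda>c. cscale c (b i))"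
        using irreducible_rep_invariant[OF irr[OF i] lin] b by blast
      moreover have "u i \<in> Us ! i" using u i by auto
      ultimately obtain c where "u i = cscale c (b i)" by auto
      then show ?thesis using iI by (auto intro: cfun.span_scale cfun.span_base)
    qed (simp add: cfun.span_zero)
    then show "w \<in> cfun.span (b ` I)" unfolding wu by (intro cfun.span_sum) auto
  qed
  ultimately have "card (b ` I) = cfun.dim (invariants N act W)"
    by (intro cfun.basis_card_eq_dim)
  then show ?thesis using card_image[OF inj] by (simp add: I_def)
qed

lemma rep_multiplicity_trivial:
  assumes "finite X" "unitary_act N X act" "W \<subseteq> supported_on X" "subrep N act W"
  shows "rep_multiplicity N trivial_act trivial_space act W = cfun.dim (invariants N act W)"
proof -
  obtain Us where "irreducible_decomposition N act W Us"
    using irreducible_decomposition_exists[OF assms(1,2,4,3)] by blast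
  then show ?thesis
    unfolding rep_multiplicity_def using trivial_multiplicity[OF assms(1-3)]
    by (intro the_equality exI[of _ Us]) auto
qed

section \<open>Signed tableaux and Specht modules\<close>

lemma sign_compose_permutes:
  assumes "finite S" "p permutes S" "q permutes S"
  shows "sign (p \<circ> q) = sign p * sign q"
  using assms by (intro sign_compose) (auto intro: permutes_imp_permutation)

lemma sign_inv_permutes:
  assumes "finite S" "p permutes S"
  shows "sign (inv_into UNIV p) = sign p"
  using assms by (intro sign_inverse) (auto intro: permutes_imp_permutation)

lemma diagram_eq: "diagram l = Sigma {..<length l} (\<lambda>i. {..<l ! i})"
  by (auto simp: diagram_def)

lemma finite_diagram [simp]: "finite (diagram l)"
  by (simp add: diagram_eq)

lemma card_diagram: "card (diagram l) = sum_list l"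
  by (simp add: diagram_eq sum_list_sum_nth atLeast0LessThan)

text \<open>An arbitrary numbering of the cells; another choice changes \<open>tab_kernel\<close> by
  one global sign.\<close>

definition cell :: "nat list \<Rightarrow> nat \<Rightarrow> nat \<times> nat" where
  "cell l = (SOME c. bij_betw c {..<sum_list l} (diagram l))"

lemma bij_betw_cell: "bij_betw (cell l) {..<sum_list l} (diagram l)"
proof -
  have "\<exists>c. bij_betw c {..<sum_list l} (diagram l)"
    using ex_bij_betw_nat_finite[OF finite_diagram, of l] by (simp add: card_diagram atLeast0LessThan)
  then show ?thesis unfolding cell_def by (rule someI_ex)
qed

definition filling :: "nat list \<Rightarrow> nat list \<Rightarrow> nat list \<Rightarrow> bool" where
  "filling l r w \<longleftrightarrow> length r = sum_list l \<and> length w = sum_list l \<and>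
     bij_betw (\<lambda>x. (r ! x, w ! x)) {..<sum_list l} (diagram l)"

text \<open>
  The matrix entry at \<open>(r, w)\<close> is the sign of the tableau with the entry \<open>x\<close> in row \<open>r ! x\<close> and
  column \<open>w ! x\<close>, relative to the reference tableau \<open>cell l\<close>. Its columns are, up to sign, the
  polytabloids of shape \<open>l\<close>; its rows are those of the conjugate shape.
\<close>

definition tab_kernel :: "nat list \<Rightarrow> nat list \<Rightarrow> nat list \<Rightarrow> complex" where
  "tab_kernel l r w = (\<Sum>\<sigma> | \<sigma> permutes {..<sum_list l}. of_int (sign \<sigma>) *
     of_bool (r = map (\<lambda>x. fst (cell l (\<sigma> x))) [0..<sum_list l] \<and>
              w = map (\<lambda>x. snd (cell l (\<sigma> x))) [0..<sum_list l]))"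

lemma tab_kernel_eq_sign:
  assumes \<sigma>: "\<sigma> permutes {..<sum_list l}" and len: "length r = sum_list l" "length w = sum_list l"
    and cell: "\<And>x. x < sum_list l \<Longrightarrow> cell l (\<sigma> x) = (r ! x, w ! x)"
  shows "tab_kernel l r w = of_int (sign \<sigma>)"
proof -
  let ?N = "sum_list l"
  have "\<tau> = \<sigma>" if \<tau>: "\<tau> permutes {..<?N}" and "r = map (\<lambda>x. fst (cell l (\<tau> x))) [0..<?N]"
    "w = map (\<lambda>x. snd (cell l (\<tau> x))) [0..<?N]" for \<tau>
  proof
    fix x
    show "\<tau> x = \<sigma> x"
    proof (cases "x < ?N")
      case True
      have "r ! x = fst (cell l (\<tau> x))" "w ! x = snd (cell l (\<tau> x))"
        using that(2,3) True by auto
      then have "cell l (\<tau> x) = cell l (\<sigma> x)" using cell[OF True] by (simp add: prod_eq_iff)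
      moreover have "\<tau> x < ?N" "\<sigma> x < ?N"
        using True permutes_in_image[OF \<tau>, of x] permutes_in_image[OF \<sigma>, of x] by auto
      ultimately show ?thesis
        using bij_betw_cell[of l] by (intro inj_onD[of "cell l" "{..<?N}"]) (auto simp: bij_betw_def)
    next
      case False
      then show ?thesis using \<tau> \<sigma> by (simp add: permutes_def)
    qed
  qed
  moreover have "r = map (\<lambda>x. fst (cell l (\<sigma> x))) [0..<?N]" "w = map (\<lambda>x. snd (cell l (\<sigma> x))) [0..<?N]"
    using len cell by (auto intro!: nth_equalityI)
  ultimately have "tab_kernel l r w =
      (\<Sum>\<tau> | \<tau> permutes {..<?N}. if \<tau> = \<sigma> then of_int (sign \<sigma>) else 0)"
    unfolding tab_kernel_def by (intro sum.cong) auto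
  also have "\<dots> = of_int (sign \<sigma>)"
    using \<sigma> by (simp add: finite_permutations)
  finally show ?thesis .
qed

lemma filling_permutation:
  assumes "filling l r w"
  obtains \<sigma> where "\<sigma> permutes {..<sum_list l}"
    "\<And>x. x < sum_list l \<Longrightarrow> cell l (\<sigma> x) = (r ! x, w ! x)"
proof -
  let ?N = "sum_list l"
  let ?f = "\<lambda>x. inv_into {..<?N} (cell l) (r ! x, w ! x)"
  let ?\<sigma> = "\<lambda>x. if x \<in> {..<?N} then ?f x else x"
  have b: "bij_betw (\<lambda>x. (r ! x, w ! x)) {..<?N} (diagram l)"
    using assms by (simp add: filling_def)
  have "bij_betw (inv_into {..<?N} (cell l) \<circ> (\<lambda>x. (r ! x, w ! x))) {..<?N} {..<?N}"
    using bij_betw_trans[OF b bij_betw_inv_into[OF bij_betw_cell]] .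
  then have "bij_betw ?\<sigma> {..<?N} {..<?N}"
    by (subst bij_betw_cong[of _ _ "inv_into {..<?N} (cell l) \<circ> (\<lambda>x. (r ! x, w ! x))"]) auto
  then have "?\<sigma> permutes {..<?N}"
    by (intro bij_imp_permutes) auto
  moreover have "cell l (?\<sigma> x) = (r ! x, w ! x)" if x: "x < ?N" for x
  proof -
    have "(r ! x, w ! x) \<in> cell l ` {..<?N}"
      using x bij_betwE[OF b] bij_betw_imp_surj_on[OF bij_betw_cell[of l]] by auto
    then show ?thesis using x by (simp add: f_inv_into_f)
  qed
  ultimately show ?thesis using that by blast
qed

lemma tab_kernel_nonzero_iff: "tab_kernel l r w \<noteq> 0 \<longleftrightarrow> filling l r w"
proof
  let ?N = "sum_list l"
  assume "tab_kernel l r w \<noteq> 0"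
  then obtain \<sigma> where \<sigma>: "\<sigma> permutes {..<?N}"
    and r: "r = map (\<lambda>x. fst (cell l (\<sigma> x))) [0..<?N]"
    and w: "w = map (\<lambda>x. snd (cell l (\<sigma> x))) [0..<?N]"
    unfolding tab_kernel_def by (auto elim!: sum.not_neutral_contains_not_neutral)
  have "bij_betw (cell l \<circ> \<sigma>) {..<?N} (diagram l)"
    using bij_betw_trans[OF permutes_imp_bij[OF \<sigma>] bij_betw_cell] .
  moreover have "(r ! x, w ! x) = (cell l \<circ> \<sigma>) x" if "x \<in> {..<?N}" for x
    using that r w by simp
  ultimately have "bij_betw (\<lambda>x. (r ! x, w ! x)) {..<?N} (diagram l)"
    using bij_betw_cong[of "{..<?N}" "\<lambda>x. (r ! x, w ! x)" "cell l \<circ> \<sigma>"] by blast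
  then show "filling l r w" using r w by (simp add: filling_def)
next
  assume "filling l r w"
  then obtain \<sigma> where \<sigma>: "\<sigma> permutes {..<sum_list l}"
    "\<And>x. x < sum_list l \<Longrightarrow> cell l (\<sigma> x) = (r ! x, w ! x)"
    by (rule filling_permutation) blast
  then have "tab_kernel l r w = of_int (sign \<sigma>)"
    using \<open>filling l r w\<close> by (intro tab_kernel_eq_sign) (auto simp: filling_def)
  then show "tab_kernel l r w \<noteq> 0" by simp
qed

lemma cnj_tab_kernel: "cnj (tab_kernel l r w) = tab_kernel l r w"
  by (auto simp: tab_kernel_def of_bool_def intro!: sum.cong)

lemma filling_permute_list:
  assumes "filling l r w" "\<tau> permutes {..<sum_list l}"
  shows "filling l (permute_list \<tau> r) (permute_list \<tau> w)"
proof -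
  let ?N = "sum_list l"
  have len: "length r = ?N" "length w = ?N" using assms by (auto simp: filling_def)
  have "bij_betw ((\<lambda>x. (r ! x, w ! x)) \<circ> \<tau>) {..<?N} (diagram l)"
    using assms by (intro bij_betw_trans[OF permutes_imp_bij]) (auto simp: filling_def)
  moreover have "(permute_list \<tau> r ! x, permute_list \<tau> w ! x) = ((\<lambda>x. (r ! x, w ! x)) \<circ> \<tau>) x"
    if "x \<in> {..<?N}" for x
    using that assms(2) len by (simp add: permute_list_nth)
  ultimately have "bij_betw (\<lambda>x. (permute_list \<tau> r ! x, permute_list \<tau> w ! x)) {..<?N} (diagram l)"
    by (subst bij_betw_cong) assumption
  then show ?thesis using len by (simp add: filling_def)
qed

lemma permute_list_inverse:
  assumes "\<tau> permutes {..<length xs}"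
  shows "permute_list (inv_into UNIV \<tau>) (permute_list \<tau> xs) = xs"
    "permute_list \<tau> (permute_list (inv_into UNIV \<tau>) xs) = xs"
proof -
  note inv = permutes_inv[OF assms]
  show "permute_list (inv_into UNIV \<tau>) (permute_list \<tau> xs) = xs"
    using permute_list_compose[OF inv, of \<tau>] permutes_inv_o(1)[OF assms] by simp
  show "permute_list \<tau> (permute_list (inv_into UNIV \<tau>) xs) = xs"
    using permute_list_compose[OF assms, of "inv_into UNIV \<tau>"] permutes_inv_o(2)[OF assms] by simp
qed

text \<open>Permuting the positions of both words composes the permutation behind the filling with
  \<open>\<tau>\<close>, and a pair that is no filling stays none.\<close>

lemma tab_kernel_permute_list:
  assumes \<tau>: "\<tau> permutes {..<sum_list l}" and len: "length r = sum_list l" "length w = sum_list l"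
  shows "tab_kernel l (permute_list \<tau> r) (permute_list \<tau> w) = of_int (sign \<tau>) * tab_kernel l r w"
proof (cases "filling l r w")
  case True
  then obtain \<sigma> where \<sigma>: "\<sigma> permutes {..<sum_list l}"
    "\<And>x. x < sum_list l \<Longrightarrow> cell l (\<sigma> x) = (r ! x, w ! x)"
    by (rule filling_permutation) blast
  have "tab_kernel l r w = of_int (sign \<sigma>)"
    using \<sigma> len by (intro tab_kernel_eq_sign)
  moreover have "tab_kernel l (permute_list \<tau> r) (permute_list \<tau> w) = of_int (sign (\<sigma> \<circ> \<tau>))"
    using \<sigma> \<tau> len permutes_in_image[OF \<tau>]
    by (intro tab_kernel_eq_sign permutes_compose) (auto simp: permute_list_nth)
  ultimately show ?thesis by (simp add: sign_compose_permutes[OF finite_lessThan \<sigma>(1) \<tau>])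
next
  case False
  have "\<not> filling l (permute_list \<tau> r) (permute_list \<tau> w)"
  proof
    assume "filling l (permute_list \<tau> r) (permute_list \<tau> w)"
    from filling_permute_list[OF this permutes_inv[OF \<tau>]] show False
      using False \<tau> len by (simp add: permute_list_inverse)
  qed
  then show ?thesis using False tab_kernel_nonzero_iff by (metis mult_zero_right)
qed

text \<open>The tableau \<open>t\<close> differs from the reference tableau by a permutation
  \<open>\<tau>\<close>, whose sign is the constant. In the sum defining \<open>tab_kernel\<close>,
  substitute \<open>\<tau> \<circ> inv \<pi>\<close> for the summation variable: the condition on
  the column word then says that \<open>\<pi>\<close> stabilizes the columns of \<open>t\<close>,
  and the condition on the row word names the tabloid of \<open>\<pi> \<circ> t\<close>.\<close>

lemma polytabloid_eq_tab_kernel: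
  assumes t: "tableau l t"
  shows "\<exists>c\<noteq>0. polytabloid l t =
    cscale c (\<lambda>s. tab_kernel l s (map (\<lambda>x. snd (inv_into (diagram l) t x)) [0..<sum_list l]))"
proof -
  let ?N = "sum_list l" and ?D = "diagram l"
  have bt: "bij_betw t ?D {..<?N}" using t by (simp add: tableau_def)
  let ?w = "map (\<lambda>x. snd (inv_into ?D t x)) [0..<?N]"
  let ?r = "map (\<lambda>x. fst (inv_into ?D t x)) [0..<?N]"
  have "bij_betw (inv_into ?D t) {..<?N} ?D" using bt by (rule bij_betw_inv_into)
  then have "filling l ?r ?w"
    unfolding filling_def by (subst bij_betw_cong[of _ _ "inv_into ?D t"]) auto
  then obtain \<tau> where \<tau>: "\<tau> permutes {..<?N}"
    and "\<And>x. x < ?N \<Longrightarrow> cell l (\<tau> x) = (?r ! x, ?w ! x)"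
    by (rule filling_permutation) blast
  then have cell\<tau>: "cell l (\<tau> x) = inv_into ?D t x" if "x < ?N" for x
    using that by simp
  have sgn: "sign (\<tau> \<circ> inv_into UNIV \<pi>) = sign \<tau> * sign \<pi>" if "\<pi> permutes {..<?N}" for \<pi>
    using that \<tau> permutes_inv[OF that]
    by (simp add: sign_compose_permutes[OF finite_lessThan] sign_inv_permutes[OF finite_lessThan])
  have stab: "\<pi> \<in> column_stabilizer l t \<longleftrightarrow>
      ?w = map (\<lambda>x. snd (cell l ((\<tau> \<circ> inv_into UNIV \<pi>) x))) [0..<?N]" if \<pi>: "\<pi> permutes {..<?N}" for \<pi>
  proof -
    have lt: "\<pi> x < ?N \<longleftrightarrow> x < ?N" "inv_into UNIV \<pi> x < ?N \<longleftrightarrow> x < ?N" for x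
      using permutes_in_image[OF \<pi>] permutes_in_image[OF permutes_inv[OF \<pi>]] by auto
    have "\<pi> \<in> column_stabilizer l t \<longleftrightarrow> (\<forall>c\<in>?D. snd (inv_into ?D t (\<pi> (t c))) = snd c)"
      using \<pi> by (simp add: column_stabilizer_def)
    also have "\<dots> \<longleftrightarrow> (\<forall>x\<in>t ` ?D. snd (inv_into ?D t (\<pi> x)) = snd (inv_into ?D t x))"
      using bij_betw_imp_inj_on[OF bt] by simp
    also have "\<dots> \<longleftrightarrow> (\<forall>x<?N. snd (inv_into ?D t (\<pi> x)) = snd (inv_into ?D t x))"
      using bt by (simp add: bij_betw_def lessThan_def)
    also have "\<dots> \<longleftrightarrow> (\<forall>x<?N. snd (inv_into ?D t x) = snd (inv_into ?D t (inv_into UNIV \<pi> x)))"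
    proof safe
      fix x assume "\<forall>x<?N. snd (inv_into ?D t (\<pi> x)) = snd (inv_into ?D t x)" "x < ?N"
      then have "snd (inv_into ?D t (\<pi> (inv_into UNIV \<pi> x))) = snd (inv_into ?D t (inv_into UNIV \<pi> x))"
        using lt by blast
      then show "snd (inv_into ?D t x) = snd (inv_into ?D t (inv_into UNIV \<pi> x))"
        by (simp add: permutes_inverses(1)[OF \<pi>])
    next
      fix x assume "\<forall>x<?N. snd (inv_into ?D t x) = snd (inv_into ?D t (inv_into UNIV \<pi> x))" "x < ?N"
      then have "snd (inv_into ?D t (\<pi> x)) = snd (inv_into ?D t (inv_into UNIV \<pi> (\<pi> x)))"
        using lt by blast
      then show "snd (inv_into ?D t (\<pi> x)) = snd (inv_into ?D t x)"
        by (simp add: permutes_inverses(2)[OF \<pi>])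
    qed
    also have "\<dots> \<longleftrightarrow> ?w = map (\<lambda>x. snd (cell l ((\<tau> \<circ> inv_into UNIV \<pi>) x))) [0..<?N]"
      using cell\<tau> lt by (auto simp: list_eq_iff_nth_eq)
    finally show ?thesis .
  qed
  have tab: "tabloid l (\<pi> \<circ> t) = map (\<lambda>x. fst (cell l ((\<tau> \<circ> inv_into UNIV \<pi>) x))) [0..<?N]"
    if \<pi>: "\<pi> permutes {..<?N}" for \<pi>
  proof -
    have "inv_into ?D (\<pi> \<circ> t) x = cell l (\<tau> (inv_into UNIV \<pi> x))" if x: "x < ?N" for x
    proof -
      let ?c = "inv_into ?D t (inv_into UNIV \<pi> x)"
      have y: "inv_into UNIV \<pi> x < ?N"
        using x permutes_in_image[OF permutes_inv[OF \<pi>], of x] by auto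
      then have "inv_into UNIV \<pi> x \<in> t ` ?D" using bt by (auto simp: bij_betw_def)
      then have "?c \<in> ?D" "t ?c = inv_into UNIV \<pi> x"
        by (auto simp: inv_into_into f_inv_into_f)
      moreover from this have "(\<pi> \<circ> t) ?c = x" by (simp add: permutes_inverses(1)[OF \<pi>])
      moreover have "inj_on (\<pi> \<circ> t) ?D"
        using bt permutes_inj[OF \<pi>] by (intro comp_inj_on) (auto simp: bij_betw_def intro: inj_on_subset)
      ultimately have "inv_into ?D (\<pi> \<circ> t) x = ?c" by (intro inv_into_f_eq) auto
      then show ?thesis using cell\<tau>[OF y] by simp
    qed
    then show ?thesis by (simp add: tabloid_def)
  qed
  have fin: "finite {\<pi>. \<pi> permutes {..<?N}}" by (simp add: finite_permutations)
  have "polytabloid l t s = of_int (sign \<tau>) * tab_kernel l s ?w" for s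
  proof -
    define g where "g = (\<lambda>\<sigma>. of_int (sign \<sigma>) *
      of_bool (s = map (\<lambda>x. fst (cell l (\<sigma> x))) [0..<?N] \<and>
              ?w = map (\<lambda>x. snd (cell l (\<sigma> x))) [0..<?N]) :: complex)"
    have "tab_kernel l s ?w = (\<Sum>\<sigma> | \<sigma> permutes {..<?N}. g \<sigma>)"
      by (simp add: tab_kernel_def g_def)
    also have "\<dots> = (\<Sum>\<pi> | \<pi> permutes {..<?N}. g (\<tau> \<circ> \<pi>))"
      by (rule setum_permutations_compose_left[OF \<tau>])
    also have "\<dots> = (\<Sum>\<pi> | \<pi> permutes {..<?N}. g (\<tau> \<circ> inv_into UNIV \<pi>))"
      by (rule sum_permutations_inverse)
    also have "\<dots> = (\<Sum>\<pi> | \<pi> permutes {..<?N}. of_int (sign \<tau>) *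
        (if \<pi> \<in> column_stabilizer l t then of_int (sign \<pi>) * of_bool (s = tabloid l (\<pi> \<circ> t)) else 0))"
    proof (intro sum.cong refl)
      fix \<pi> assume "\<pi> \<in> {\<pi>. \<pi> permutes {..<?N}}"
      then have \<pi>: "\<pi> permutes {..<?N}" by simp
      show "g (\<tau> \<circ> inv_into UNIV \<pi>) = of_int (sign \<tau>) *
        (if \<pi> \<in> column_stabilizer l t then of_int (sign \<pi>) * of_bool (s = tabloid l (\<pi> \<circ> t)) else 0)"
        unfolding g_def stab[OF \<pi>] tab[OF \<pi>] sgn[OF \<pi>] by auto
    qed
    also have "\<dots> = of_int (sign \<tau>) * polytabloid l t s"
    proof -
      have "{\<pi>. \<pi> permutes {..<?N}} \<inter> column_stabilizer l t = column_stabilizer l t"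
        by (auto simp: column_stabilizer_def)
      then show ?thesis
        by (simp add: polytabloid_def sum_distrib_left sum.If_cases[OF fin] flip: sum_distrib_left)
    qed
    finally show ?thesis
      by (simp flip: mult.assoc of_int_mult)
  qed
  then have "polytabloid l t = cscale (of_int (sign \<tau>)) (\<lambda>s. tab_kernel l s ?w)"
    by (simp add: cscale_def fun_eq_iff)
  then show ?thesis by (metis of_int_0_eq_iff sign_nz)
qed

text \<open>\<open>Y\<close> is left open so that one finite set of words can serve all factors of a
  tensor product. Words without a filling add only the zero function; the others give nonzero
  multiples of polytabloids.\<close>

lemma specht_eq_span:
  assumes "{w. \<exists>r. filling l r w} \<subseteq> Y"
  shows "specht l = cfun.span ((\<lambda>w s. tab_kernel l s w) ` Y)"
proof
  let ?N = "sum_list l" and ?D = "diagram l"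
  show "specht l \<subseteq> cfun.span ((\<lambda>w s. tab_kernel l s w) ` Y)"
    unfolding specht_def
  proof (rule cfun.span_minimal)
    show "polytabloid l ` {t. tableau l t} \<subseteq> cfun.span ((\<lambda>w s. tab_kernel l s w) ` Y)"
    proof clarify
      fix t assume t: "tableau l t"
      let ?w = "map (\<lambda>x. snd (inv_into ?D t x)) [0..<?N]"
      let ?r = "map (\<lambda>x. fst (inv_into ?D t x)) [0..<?N]"
      have "bij_betw (inv_into ?D t) {..<?N} ?D"
        using t by (auto simp: tableau_def intro: bij_betw_inv_into)
      then have "filling l ?r ?w"
        unfolding filling_def by (subst bij_betw_cong[of _ _ "inv_into ?D t"]) auto
      then have "?w \<in> Y" using assms by blast
      moreover obtain c where "polytabloid l t = cscale c (\<lambda>s. tab_kernel l s ?w)"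
        using polytabloid_eq_tab_kernel[OF t] by blast
      ultimately show "polytabloid l t \<in> cfun.span ((\<lambda>w s. tab_kernel l s w) ` Y)"
        using cfun.span_scale[OF cfun.span_base[OF imageI]] by metis
    qed
  qed simp
  have "(\<lambda>s. tab_kernel l s w) \<in> specht l" for w
  proof (cases "\<exists>r. filling l r w")
    case False
    then have "(\<lambda>s. tab_kernel l s w) = 0"
      using tab_kernel_nonzero_iff by (fastforce simp: fun_eq_iff)
    then show ?thesis by (simp add: specht_def cfun.span_zero)
  next
    case True
    then obtain r where f: "filling l r w" ..
    let ?p = "\<lambda>x. (r ! x, w ! x)"
    define t where "t = inv_into {..<?N} ?p"
    have bp: "bij_betw ?p {..<?N} ?D" using f by (simp add: filling_def)
    have t: "tableau l t"
      unfolding tableau_def t_def using bp by (rule bij_betw_inv_into)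
    have "inv_into ?D t x = ?p x" if "x < ?N" for x
      unfolding t_def using that bp by (intro inv_into_inv_into_eq[OF bp]) auto
    then have "map (\<lambda>x. snd (inv_into ?D t x)) [0..<?N] = w"
      using f by (auto simp: filling_def intro!: nth_equalityI)
    then obtain c where c: "c \<noteq> 0" "polytabloid l t = cscale c (\<lambda>s. tab_kernel l s w)"
      using polytabloid_eq_tab_kernel[OF t] by auto
    then have "(\<lambda>s. tab_kernel l s w) = cscale (inverse c) (polytabloid l t)"
      by (simp add: cscale_def flip: mult.assoc)
    also have "\<dots> \<in> specht l"
      unfolding specht_def using t by (intro cfun.span_scale cfun.span_base) auto
    finally show ?thesis .
  qed
  then show "cfun.span ((\<lambda>w s. tab_kernel l s w) ` Y) \<subseteq> specht l"
    by (intro cfun.span_minimal) (auto simp: specht_def)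
qed

section \<open>Alphabets and contents of row and column words\<close>

lemma filling_entries:
  assumes "filling l r w" "x < sum_list l"
  shows "r ! x < length l" "w ! x < l ! (r ! x)"
  using assms by (auto simp: filling_def diagram_def bij_betw_def)

lemma filling_row_word:
  assumes "filling l r w"
  shows "r \<in> basis_index (sum_list l) (length l)"
  using assms filling_entries[OF assms] by (auto simp: basis_index_def filling_def in_set_conv_nth)

lemma filling_column_word:
  assumes "filling l r w" "\<forall>p\<in>set l. p \<le> k"
  shows "w \<in> basis_index (sum_list l) k"
proof -
  have "w ! x < k" if "x < sum_list l" for x
    using filling_entries[OF assms(1) that] assms(2) by (meson nth_mem less_le_trans)
  then show ?thesis using assms(1) by (auto simp: basis_index_def filling_def in_set_conv_nth)
qed

lemma count_list_eq_card: "count_list xs c = card {x. x < length xs \<and> xs ! x = c}"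
proof -
  have "count_list xs c = length (filter ((=) c) xs)" by (rule count_list_eq_length_filter)
  also have "\<dots> = card {x. x < length xs \<and> c = xs ! x}" by (rule length_filter_conv_card)
  finally show ?thesis by (simp add: eq_commute)
qed

text \<open>The positions of the letter \<open>c\<close> correspond to the cells of column
  \<open>c\<close>. This is where the conjugate partition enters as a weight.\<close>

lemma filling_content:
  assumes "filling l r w"
  shows "count_list w c = card {j. j < length l \<and> c < l ! j}"
proof -
  let ?p = "\<lambda>x. (r ! x, w ! x)" and ?N = "sum_list l"
  have bp: "bij_betw ?p {..<?N} (diagram l)" and len: "length w = ?N"
    using assms by (auto simp: filling_def)
  have "bij_betw ?p {x. x < ?N \<and> w ! x = c} {q \<in> diagram l. snd q = c}"
  proof (rule bij_betw_subset[OF bp])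
    show "{x. x < ?N \<and> w ! x = c} \<subseteq> {..<?N}" by auto
    show "?p ` {x. x < ?N \<and> w ! x = c} = {q \<in> diagram l. snd q = c}"
      unfolding bij_betw_imp_surj_on[OF bp, symmetric] by auto
  qed
  moreover have "bij_betw fst {q \<in> diagram l. snd q = c} {j. j < length l \<and> c < l ! j}"
    by (rule bij_betw_byWitness[where f' = "\<lambda>j. (j, c)"]) (auto simp: diagram_def)
  ultimately show ?thesis
    unfolding count_list_eq_card len using bij_betw_same_card bij_betw_trans by blast
qed

lemma finite_basis_index [simp]: "finite (basis_index N k)"
proof -
  have "basis_index N k = {w. set w \<subseteq> {..<k} \<and> length w = N}" by (auto simp: basis_index_def)
  then show ?thesis using finite_lists_length_eq[of "{..<k}" N] by simp
qed

section \<open>Unitriangular invariance and leading words\<close>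

text \<open>The action on a single tensor factor of the transposed picture: the \<open>N\<close>-th
  tensor power of \<open>A\<close>.\<close>

definition word_act :: "nat \<Rightarrow> nat \<Rightarrow> complex mat \<Rightarrow> (nat list \<Rightarrow> complex) \<Rightarrow> nat list \<Rightarrow> complex" where
  "word_act N k A f w = (\<Sum>u\<in>basis_index N k. (\<Prod>p<N. A $$ (w ! p, u ! p)) * f u)"

lemma basis_index_nth: "w \<in> basis_index N k \<Longrightarrow> p < N \<Longrightarrow> w ! p < k"
  using nth_mem[of p w] unfolding basis_index_def by blast

lemma basis_index_length: "w \<in> basis_index N k \<Longrightarrow> length w = N"
  by (simp add: basis_index_def)

lemma basis_indexI: "length w = N \<Longrightarrow> (\<And>p. p < N \<Longrightarrow> w ! p < k) \<Longrightarrow> w \<in> basis_index N k"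
  by (auto simp: basis_index_def in_set_conv_nth)

text \<open>Induction on the letter of \<open>v\<close>. If \<open>w ! q < v ! q\<close>, then the
  cell in the row of \<open>q\<close> and column \<open>w ! q\<close> is filled under
  \<open>v\<close> by some \<open>y\<close>. There \<open>w\<close> and \<open>v\<close> agree by
  induction, so \<open>q\<close> and \<open>y\<close> share a row and a letter of \<open>w\<close>,
  against injectivity.\<close>

lemma filling_dominated:
  assumes f: "filling l r v" and len: "length w = sum_list l"
    and inj: "\<And>x y. x < sum_list l \<Longrightarrow> y < sum_list l \<Longrightarrow> r ! x = r ! y \<Longrightarrow> w ! x = w ! y \<Longrightarrow> x = y"
    and le: "\<And>x. x < sum_list l \<Longrightarrow> w ! x \<le> v ! x"
  shows "w = v"
proof -
  let ?N = "sum_list l"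
  have b: "bij_betw (\<lambda>x. (r ! x, v ! x)) {..<?N} (diagram l)" using f by (simp add: filling_def)
  have "w ! q = v ! q" if "q < ?N" for q
    using that
  proof (induction "v ! q" arbitrary: q rule: less_induct)
    case (less q)
    show ?case
    proof (rule ccontr)
      assume "w ! q \<noteq> v ! q"
      then have lt: "w ! q < v ! q" using le[OF less.prems] by simp
      have "(r ! q, w ! q) \<in> diagram l"
        using filling_entries[OF f less.prems] lt by (simp add: diagram_def)
      then obtain y where y: "y < ?N" "r ! y = r ! q" "v ! y = w ! q"
        unfolding bij_betw_imp_surj_on[OF b, symmetric] by auto
      then have "w ! y = w ! q" using less.hyps[of y] lt by simp
      then have "y = q" using inj[OF y(1) less.prems y(2)] by simp
      then show False using y lt by simp
    qed
  qed
  then show ?thesis using len f by (auto simp: filling_def intro!: nth_equalityI)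
qed

text \<open>Row \<open>i\<close> of the diagram contributes the wedge of the first
  \<open>l ! i\<close> basis vectors, and an upper unitriangular matrix fixes each such
  wedge.\<close>

lemma word_act_tab_kernel:
  assumes A: "A \<in> unitriangular k" and l: "\<forall>p\<in>set l. p \<le> k" and w: "w \<in> basis_index (sum_list l) k"
  shows "word_act (sum_list l) k A (tab_kernel l r) w = tab_kernel l r w"
proof -
  let ?N = "sum_list l"
  let ?S = "{\<sigma>. \<sigma> permutes {..<?N}}"
  let ?R = "\<lambda>\<sigma>. map (\<lambda>x. fst (cell l (\<sigma> x))) [0..<?N]"
  let ?C = "\<lambda>\<sigma>. map (\<lambda>x. snd (cell l (\<sigma> x))) [0..<?N]"
  define t :: "(nat \<Rightarrow> nat) \<Rightarrow> complex"
    where "t = (\<lambda>\<sigma>. of_int (sign \<sigma>) * of_bool (r = ?R \<sigma>))"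
  have fill: "filling l (?R \<sigma>) (?C \<sigma>)" if \<sigma>: "\<sigma> permutes {..<?N}" for \<sigma>
  proof -
    have "bij_betw (\<lambda>x. (?R \<sigma> ! x, ?C \<sigma> ! x)) {..<?N} (diagram l)"
      by (subst bij_betw_cong[where g = "cell l \<circ> \<sigma>"])
        (use bij_betw_trans[OF permutes_imp_bij[OF \<sigma>] bij_betw_cell] in auto)
    then show ?thesis by (simp add: filling_def)
  qed
  have C: "?C \<sigma> \<in> basis_index ?N k" if "\<sigma> \<in> ?S" for \<sigma>
    using filling_column_word[OF fill l] that by blast
  have kernel: "tab_kernel l r u = (\<Sum>\<sigma>\<in>?S. t \<sigma> * of_bool (u = ?C \<sigma>))" for u
    unfolding tab_kernel_def t_def by (intro sum.cong) auto
  have "word_act ?N k A (tab_kernel l r) w =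
      (\<Sum>\<sigma>\<in>?S. \<Sum>u\<in>basis_index ?N k. (\<Prod>p<?N. A $$ (w ! p, u ! p)) * (t \<sigma> * of_bool (u = ?C \<sigma>)))"
    unfolding word_act_def kernel sum_distrib_left by (rule sum.swap)
  also have "\<dots> = (\<Sum>\<sigma>\<in>?S. t \<sigma> * (\<Prod>p<?N. A $$ (w ! p, ?C \<sigma> ! p)))"
  proof (intro sum.cong refl)
    fix \<sigma> assume \<sigma>: "\<sigma> \<in> ?S"
    have "(\<Sum>u\<in>basis_index ?N k. (\<Prod>p<?N. A $$ (w ! p, u ! p)) * (t \<sigma> * of_bool (u = ?C \<sigma>))) =
      (\<Sum>u\<in>basis_index ?N k. if u = ?C \<sigma> then t \<sigma> * (\<Prod>p<?N. A $$ (w ! p, ?C \<sigma> ! p)) else 0)"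
      by (intro sum.cong refl) (simp add: mult.commute)
    also have "\<dots> = t \<sigma> * (\<Prod>p<?N. A $$ (w ! p, ?C \<sigma> ! p))"
      by (subst sum.delta) (use C[OF \<sigma>] in auto)
    finally show "(\<Sum>u\<in>basis_index ?N k. (\<Prod>p<?N. A $$ (w ! p, u ! p)) * (t \<sigma> * of_bool (u = ?C \<sigma>))) =
      t \<sigma> * (\<Prod>p<?N. A $$ (w ! p, ?C \<sigma> ! p))" .
  qed
  also have "\<dots> = (\<Sum>\<sigma>\<in>?S. t \<sigma> * (\<Prod>p<?N. A $$ (w ! p, snd (cell l (\<sigma> p)))))"
    by simp
  finally have eq: "word_act ?N k A (tab_kernel l r) w =
    (\<Sum>\<sigma>\<in>?S. t \<sigma> * (\<Prod>p<?N. A $$ (w ! p, snd (cell l (\<sigma> p)))))" .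
  show ?thesis
  \<comment> \<open>If no two positions share both row and letter of \<open>w\<close>, triangularity
    keeps only column words that dominate \<open>w\<close> entrywise. By
    \<open>filling_dominated\<close> such a word is \<open>w\<close> itself, and its coefficient is
    a product of diagonal entries 1.\<close>
  proof (cases "\<forall>x<?N. \<forall>y<?N. r ! x = r ! y \<longrightarrow> w ! x = w ! y \<longrightarrow> x = y")
    case True
    have "t \<sigma> * (\<Prod>p<?N. A $$ (w ! p, snd (cell l (\<sigma> p)))) = t \<sigma> * of_bool (w = ?C \<sigma>)"
      if \<sigma>: "\<sigma> \<in> ?S" for \<sigma>
    proof (cases "r = ?R \<sigma>")
      case r: True
      show ?thesis
      proof (cases "w = ?C \<sigma>")
        case True
        have "A $$ (w ! p, snd (cell l (\<sigma> p))) = 1" if p: "p < ?N" for p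
          using A basis_index_nth[OF w p] p True by (auto simp: unitriangular_def)
        then show ?thesis using True by simp
      next
        case False
        have f: "filling l r (?C \<sigma>)" using fill \<sigma> unfolding r by blast
        have "\<exists>p<?N. \<not> w ! p \<le> ?C \<sigma> ! p"
          using filling_dominated[OF f basis_index_length[OF w]] \<open>\<forall>x<?N. \<forall>y<?N. _ x y\<close> False by blast
        then obtain p where p: "p < ?N" "snd (cell l (\<sigma> p)) < w ! p" by auto
        have "A $$ (w ! p, snd (cell l (\<sigma> p))) = 0"
          using A p basis_index_nth[OF w p(1)] by (auto simp: unitriangular_def intro!: upper_triangularD)
        then have "(\<Prod>p<?N. A $$ (w ! p, snd (cell l (\<sigma> p)))) = 0" using p(1) by auto
        then show ?thesis using False by simp
      qed
    qed (simp add: t_def)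
    then show ?thesis unfolding eq kernel by (intro sum.cong) auto
  next
    case False
    then obtain x y where xy: "x < ?N" "y < ?N" "r ! x = r ! y" "w ! x = w ! y" "x \<noteq> y" by blast
    have nf: "tab_kernel l r w = 0"
    proof (rule ccontr)
      assume "tab_kernel l r w \<noteq> 0"
      then have "inj_on (\<lambda>x. (r ! x, w ! x)) {..<?N}"
        using tab_kernel_nonzero_iff by (auto simp: filling_def bij_betw_def)
      then show False using xy by (auto dest: inj_onD)
    qed
    \<comment> \<open>Two positions with equal row and equal letter: exchanging them reverses the
      sign of every term, so the sum cancels.\<close>
    let ?\<tau> = "transpose x y"
    have \<tau>: "?\<tau> permutes {..<?N}" using xy by (intro permutes_swap_id) auto
    define F where "F = (\<lambda>\<sigma>. t \<sigma> * (\<Prod>p<?N. A $$ (w ! p, snd (cell l (\<sigma> p)))))"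
    have "F (\<sigma> \<circ> ?\<tau>) = - F \<sigma>" if \<sigma>: "\<sigma> \<in> ?S" for \<sigma>
    proof -
      have w\<tau>: "w ! (?\<tau> p) = w ! p" and r\<tau>: "r ! (?\<tau> p) = r ! p" for p
        using xy by (auto simp: transpose_def)
      have "sign (\<sigma> \<circ> ?\<tau>) = - sign \<sigma>"
        using \<sigma> sign_compose_permutes[OF finite_lessThan _ \<tau>, of \<sigma>] xy by (simp add: sign_swap_id)
      moreover have "(r = ?R (\<sigma> \<circ> ?\<tau>)) = (r = ?R \<sigma>)"
      proof -
        have lt: "?\<tau> p < ?N \<longleftrightarrow> p < ?N" for p using permutes_in_image[OF \<tau>, of p] by simp
        have "(\<forall>p<?N. r ! p = fst (cell l (\<sigma> (?\<tau> p)))) = (\<forall>p<?N. r ! p = fst (cell l (\<sigma> p)))"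
          (is "?a = ?b")
        proof
          assume ?a
          then have "r ! (?\<tau> p) = fst (cell l (\<sigma> (?\<tau> (?\<tau> p))))" if "p < ?N" for p
            using that lt by blast
          then show ?b by (simp add: r\<tau>)
        next
          assume ?b
          then have "r ! (?\<tau> p) = fst (cell l (\<sigma> (?\<tau> p)))" if "p < ?N" for p
            using that lt by blast
          then show ?a by (simp add: r\<tau>)
        qed
        then show ?thesis by (auto simp: list_eq_iff_nth_eq)
      qed
      ultimately have "t (\<sigma> \<circ> ?\<tau>) = - t \<sigma>" by (simp add: t_def)
      moreover have "(\<Prod>p<?N. A $$ (w ! p, snd (cell l ((\<sigma> \<circ> ?\<tau>) p)))) =
          (\<Prod>p<?N. A $$ (w ! p, snd (cell l (\<sigma> p))))"
        using prod.permute[OF \<tau>, of "\<lambda>p. A $$ (w ! p, snd (cell l (\<sigma> p)))"]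
        by (simp add: o_def w\<tau>)
      ultimately show ?thesis by (simp add: F_def)
    qed
    then have "(\<Sum>\<sigma>\<in>?S. F (\<sigma> \<circ> ?\<tau>)) = - (\<Sum>\<sigma>\<in>?S. F \<sigma>)"
      by (simp add: sum_negf)
    moreover have "(\<Sum>\<sigma>\<in>?S. F \<sigma>) = (\<Sum>\<sigma>\<in>?S. F (\<sigma> \<circ> ?\<tau>))"
      by (rule sum_permutations_compose_right[OF \<tau>])
    ultimately have "(\<Sum>\<sigma>\<in>?S. F \<sigma>) = 0" by simp
    then show ?thesis using eq nf by (simp add: F_def)
  qed
qed

text \<open>The last difference decides. Raising a late letter enlarges a word whatever happens
  before it, so maximality freezes a suffix while the prefix varies.\<close>

definition colex_less :: "nat list \<Rightarrow> nat list \<Rightarrow> bool" where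
  "colex_less v w \<longleftrightarrow> (\<exists>x<length w. v ! x < w ! x \<and> (\<forall>y. x < y \<and> y < length w \<longrightarrow> v ! y = w ! y))"

text \<open>The word read in base \<open>k\<close> with later letters more significant. Unlike the
  order itself, these numbers can be added over the words of a tuple.\<close>

definition word_code :: "nat \<Rightarrow> nat list \<Rightarrow> nat" where
  "word_code k w = (\<Sum>p<length w. w ! p * k ^ p)"

lemma word_code_bound:
  assumes "\<And>p. p < n \<Longrightarrow> f p < (k::nat)"
  shows "(\<Sum>p<n. f p * k ^ p) < k ^ n"
  using assms
proof (induction n)
  case (Suc n)
  have "f n * k ^ n + k ^ n \<le> k * k ^ n"
    using Suc.prems[of n] by (metis Suc_leI add.commute lessI mult_Suc mult_le_mono1)
  then show ?case using Suc by force
qed simp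

lemma word_code_mono:
  assumes "colex_less v w" "v \<in> basis_index N k" "w \<in> basis_index N k"
  shows "word_code k v < word_code k w"
proof -
  have len: "length v = N" "length w = N" using assms by (auto simp: basis_index_def)
  obtain x where x: "x < N" "v ! x < w ! x" and eq: "\<And>y. x < y \<Longrightarrow> y < N \<Longrightarrow> v ! y = w ! y"
    using assms(1) len by (auto simp: colex_less_def)
  have split: "word_code k u = (\<Sum>p<x. u ! p * k ^ p) + u ! x * k ^ x + (\<Sum>p\<in>{x<..<N}. u ! p * k ^ p)"
    if "length u = N" for u
  proof -
    have "{..<N} = {..<x} \<union> {x} \<union> {x<..<N}" using x(1) by auto
    then have "word_code k u = (\<Sum>p\<in>{..<x} \<union> {x} \<union> {x<..<N}. u ! p * k ^ p)"
      using that by (simp add: word_code_def)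
    also have "\<dots> = (\<Sum>p<x. u ! p * k ^ p) + u ! x * k ^ x + (\<Sum>p\<in>{x<..<N}. u ! p * k ^ p)"
      by (subst sum.union_disjoint; auto)+
    finally show ?thesis .
  qed
  have "(\<Sum>p<x. v ! p * k ^ p) < k ^ x"
    using assms(2) x(1) by (intro word_code_bound) (auto intro: basis_index_nth)
  moreover have "v ! x * k ^ x + k ^ x \<le> w ! x * k ^ x"
    using x(2) by (metis Suc_leI add.commute mult_Suc mult_le_mono1)
  moreover have "(\<Sum>p\<in>{x<..<N}. v ! p * k ^ p) = (\<Sum>p\<in>{x<..<N}. w ! p * k ^ p)"
    by (intro sum.cong) (auto simp: eq)
  ultimately show ?thesis unfolding split[OF len(1)] split[OF len(2)] by simp
qed

text \<open>Also known as lattice or Yamanouchi words. Recording the column of each entry turns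
  standard tableaux into such words.\<close>

definition ballot :: "nat list \<Rightarrow> bool" where
  "ballot w \<longleftrightarrow> (\<forall>n c. count_list (take n w) (Suc c) \<le> count_list (take n w) c)"

lemma ballotD:
  assumes "ballot w" "c \<le> c'"
  shows "count_list (take n w) c' \<le> count_list (take n w) c"
  using assms(2)
proof (induction c' rule: dec_induct)
  case (step m)
  then show ?case using assms(1) unfolding ballot_def by (meson le_trans)
qed simp

lemma count_list_take: "n \<le> length w \<Longrightarrow> count_list (take n w) c = card {y. y < n \<and> w ! y = c}"
  unfolding count_list_eq_card by (intro arg_cong[of _ _ card]) auto

text \<open>The parts decrease weakly, so the rows that reach column \<open>c\<close> form an
  initial segment.\<close>

lemma column_height_iff:
  assumes "sorted_wrt (\<ge>) (l :: nat list)"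
  shows "j < length l \<and> c < l ! j \<longleftrightarrow> j < card {j. j < length l \<and> c < l ! j}"
proof -
  let ?J = "{j. j < length l \<and> c < l ! j}"
  have down: "i \<in> ?J" if "j \<in> ?J" "i \<le> j" for i j
  proof (cases "i = j")
    case False
    then have "l ! j \<le> l ! i" using that assms by (auto simp: sorted_wrt_iff_nth_less)
    then show ?thesis using that by auto
  qed (use that in auto)
  have fin: "finite ?J" by simp
  have "?J = {..<card ?J}"
  proof (rule card_subset_eq[symmetric, OF fin])
    show "{..<card ?J} \<subseteq> ?J"
    proof
      fix i assume "i \<in> {..<card ?J}"
      show "i \<in> ?J"
      proof (rule ccontr)
        assume "i \<notin> ?J"
        then have "?J \<subseteq> {..<i}" using down by (metis (no_types, lifting) lessThan_iff not_le subsetI)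
        then have "card ?J \<le> i" using card_mono[of "{..<i}" ?J] by simp
        then show False using \<open>i \<in> {..<card ?J}\<close> by simp
      qed
    qed
  qed simp
  then show ?thesis by blast
qed

text \<open>
  The row word of the standard tableau whose entry \<open>x\<close> is placed at the bottom of column \<open>w ! x\<close>.
\<close>

definition ballot_rows :: "nat list \<Rightarrow> nat list" where
  "ballot_rows w = map (\<lambda>x. card {y. y < x \<and> w ! y = w ! x}) [0..<length w]"

text \<open>Each letter fills its column from top to bottom, so the cells are distinct, and the
  content keeps them inside the diagram. Counting cells gives surjectivity.\<close>

lemma filling_ballot_rows:
  assumes sorted: "sorted_wrt (\<ge>) l" and len: "length w = sum_list l"
    and content: "\<And>c. count_list w c = card {j. j < length l \<and> c < l ! j}"
  shows "filling l (ballot_rows w) w"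
proof -
  let ?N = "sum_list l" and ?p = "\<lambda>x. (ballot_rows w ! x, w ! x)"
  have row: "ballot_rows w ! x = card {y. y < x \<and> w ! y = w ! x}" if "x < ?N" for x
    using that len by (simp add: ballot_rows_def)
  have strict: "card {y. y < x \<and> w ! y = w ! x} < card {y. y < z \<and> w ! y = w ! z}"
    if "x < z" "w ! x = w ! z" for x z
    using that by (intro psubset_card_mono) auto
  have inj: "inj_on ?p {..<?N}"
  proof (rule inj_onI)
    fix x z assume "x \<in> {..<?N}" "z \<in> {..<?N}" "?p x = ?p z"
    then have "x < ?N" "z < ?N" "ballot_rows w ! x = ballot_rows w ! z" "w ! x = w ! z" by auto
    then show "x = z"
      using row[of x] row[of z] strict[of x z] strict[of z x] by (cases x z rule: linorder_cases) simp_all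
  qed
  have "?p ` {..<?N} \<subseteq> diagram l"
  proof clarify
    fix x assume x: "x < ?N"
    have "card {y. y < x \<and> w ! y = w ! x} < card {y. y < length w \<and> w ! y = w ! x}"
      using x len by (intro psubset_card_mono) auto
    then have "ballot_rows w ! x < card {j. j < length l \<and> w ! x < l ! j}"
      using row[OF x] content by (simp add: count_list_eq_card)
    then show "?p x \<in> diagram l"
      using column_height_iff[OF sorted, of "ballot_rows w ! x" "w ! x", THEN iffD2]
      unfolding diagram_def by blast
  qed
  then have "?p ` {..<?N} = diagram l"
    using card_image[OF inj] by (intro card_subset_eq) (auto simp: card_diagram)
  then show ?thesis
    using inj len by (simp add: filling_def bij_betw_def ballot_rows_def)
qed

text \<open>At the last difference \<open>x\<close>, suppose \<open>v\<close> had the larger letter.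
  The cell that \<open>v\<close> gives to \<open>x\<close> is given by \<open>w\<close> to some
  \<open>y\<close>. The ballot condition excludes \<open>y < x\<close>, and for \<open>y > x\<close>
  the words agree at \<open>y\<close>, so \<open>v\<close> would use that cell twice.\<close>

lemma filling_ballot_rows_leading:
  assumes ballot: "ballot w" and f: "filling l (ballot_rows w) w"
    and v: "filling l (ballot_rows w) v" "v \<noteq> w"
  shows "colex_less v w"
proof -
  let ?N = "sum_list l"
  let ?r = "ballot_rows w"
  have len: "length w = ?N" "length v = ?N" using f v by (auto simp: filling_def)
  have row: "?r ! x = card {y. y < x \<and> w ! y = w ! x}" if "x < ?N" for x
    using that len by (simp add: ballot_rows_def)
  let ?D = "{x. x < ?N \<and> v ! x \<noteq> w ! x}"
  have "?D \<noteq> {}" using v(2) len by (auto simp: list_eq_iff_nth_eq)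
  define x where "x = Max ?D"
  have "x \<in> ?D" unfolding x_def using \<open>?D \<noteq> {}\<close> by (intro Max_in) auto
  then have x: "x < ?N" "v ! x \<noteq> w ! x" by auto
  have after: "v ! y = w ! y" if "x < y" "y < ?N" for y
  proof (rule ccontr)
    assume "v ! y \<noteq> w ! y"
    then have "y \<le> x" unfolding x_def using that by (intro Max_ge) auto
    then show False using that by simp
  qed
  have "\<not> w ! x < v ! x"
  proof
    assume gt: "w ! x < v ! x"
    have "(?r ! x, v ! x) \<in> diagram l"
      using filling_entries[OF v(1) x(1)] by (simp add: diagram_def)
    then obtain y where y: "y < ?N" "?r ! y = ?r ! x" "w ! y = v ! x"
      unfolding bij_betw_imp_surj_on[OF f[unfolded filling_def, THEN conjunct2, THEN conjunct2], symmetric]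
      by auto
    have "x < y"
    proof (rule ccontr)
      assume "\<not> x < y"
      then have yx: "y < x" using y gt by (metis less_irrefl linorder_neqE_nat)
      \<comment> \<open>The prefix ends with \<open>y\<close>: in \<open>w\<close>, column
        \<open>v ! x\<close> then holds one entry more than the row index of \<open>y\<close>, while
        column \<open>w ! x\<close> holds at most the row index of \<open>x\<close>, which is the
        same number.\<close>
      let ?n = "Suc y"
      have "count_list (take ?n w) (v ! x) \<le> count_list (take ?n w) (w ! x)"
        using ballotD[OF ballot] gt by simp
      moreover have "count_list (take ?n w) (v ! x) = Suc (?r ! y)"
      proof -
        have "{z. z < Suc y \<and> w ! z = v ! x} = insert y {z. z < y \<and> w ! z = w ! y}"
          using y by (auto simp: less_Suc_eq)
        then show ?thesis using row[OF y(1)] y(1) len by (simp add: count_list_take)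
      qed
      moreover have "count_list (take ?n w) (w ! x) \<le> ?r ! x"
        unfolding row[OF x(1)] using y(1) len yx
        by (subst count_list_take) (auto intro!: card_mono)
      ultimately show False using y(2) by simp
    qed
    then have "(?r ! y, v ! y) = (?r ! x, v ! x)" using after y by simp
    then have "y = x"
      using v(1) x(1) y(1) inj_onD[of "\<lambda>x. (?r ! x, v ! x)" "{..<?N}" y x]
      by (auto simp: filling_def bij_betw_def)
    then show False using \<open>x < y\<close> by simp
  qed
  then have "v ! x < w ! x" using x(2) by simp
  then show ?thesis using x(1) after len unfolding colex_less_def by auto
qed

section \<open>Leading words of invariants are ballot\<close>

lemma sum_Pow_alternating:
  assumes "finite A"
  shows "(\<Sum>T\<in>Pow A. (-1) ^ card T) = (of_bool (A = {}) :: complex)"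
proof -
  have "(\<Sum>T\<in>Pow A. (-1) ^ card T) = (\<Prod>x\<in>A. (-1) + (1 :: complex))"
    by (subst prod_add[OF assms]) simp
  then show ?thesis using assms by auto
qed

text \<open>
  The coefficient at \<open>S\<^sub>0\<close> is recovered from the sums over supersets by inclusion-exclusion over the
  complement of \<open>S\<^sub>0\<close>, whose subsets are all smaller than \<open>S\<^sub>0\<close>.
\<close>

lemma superset_sums_zero:
  fixes g :: "'a set \<Rightarrow> complex"
  assumes fin: "finite P" and S0: "S0 \<subseteq> P" "card (P - S0) < card S0"
    and zero: "\<And>T. T \<subseteq> P \<Longrightarrow> card T < card S0 \<Longrightarrow> (\<Sum>S | T \<subseteq> S \<and> S \<subseteq> P. g S) = 0"
    and hom: "\<And>S. S \<subseteq> P \<Longrightarrow> g S \<noteq> 0 \<Longrightarrow> card S = card S0"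
  shows "g S0 = 0"
proof -
  let ?Q = "P - S0"
  have finQ: "finite ?Q" using fin by simp
  have "0 = (\<Sum>T\<in>Pow ?Q. (-1) ^ card T * (\<Sum>S | T \<subseteq> S \<and> S \<subseteq> P. g S))"
  proof (rule sum.neutral[symmetric], rule ballI)
    fix T assume T: "T \<in> Pow ?Q"
    then have "card T < card S0" using card_mono[OF finQ, of T] S0(2) by auto
    then show "(-1) ^ card T * (\<Sum>S | T \<subseteq> S \<and> S \<subseteq> P. g S) = 0"
      using zero[of T] T by auto
  qed
  also have "\<dots> = (\<Sum>T\<in>Pow ?Q. \<Sum>S\<in>Pow P. if T \<subseteq> S then (-1) ^ card T * g S else 0)"
  proof (intro sum.cong refl)
    fix T assume "T \<in> Pow ?Q"
    have "{S. T \<subseteq> S \<and> S \<subseteq> P} = {S \<in> Pow P. T \<subseteq> S}" by auto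
    then show "(-1) ^ card T * (\<Sum>S | T \<subseteq> S \<and> S \<subseteq> P. g S) =
        (\<Sum>S\<in>Pow P. if T \<subseteq> S then (-1) ^ card T * g S else 0)"
      using fin by (simp only: sum_distrib_left sum.inter_filter finite_Pow_iff)
        (auto intro!: sum.cong)
  qed
  also have "\<dots> = (\<Sum>S\<in>Pow P. \<Sum>T\<in>Pow ?Q. if T \<subseteq> S then (-1) ^ card T * g S else 0)"
    by (rule sum.swap)
  also have "\<dots> = (\<Sum>S\<in>Pow P. if S = S0 then g S else 0)"
  proof (intro sum.cong refl)
    fix S assume S: "S \<in> Pow P"
    have "(\<Sum>T\<in>Pow ?Q. if T \<subseteq> S then (-1) ^ card T * g S else 0) =
        (\<Sum>T\<in>{T \<in> Pow ?Q. T \<subseteq> S}. (-1) ^ card T * g S)"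
      using finQ by (simp only: sum.inter_filter finite_Pow_iff)
    also have "{T \<in> Pow ?Q. T \<subseteq> S} = Pow (?Q \<inter> S)" by auto
    also have "(\<Sum>T\<in>Pow (?Q \<inter> S). (-1) ^ card T * g S) = of_bool (?Q \<inter> S = {}) * g S"
      by (simp only: sum_Pow_alternating[OF finite_Int[OF disjI1[OF finQ]]] flip: sum_distrib_right)
    also have "\<dots> = (if S = S0 then g S else 0)"
    proof (cases "?Q \<inter> S = {} \<and> g S \<noteq> 0")
      case True
      then have "S \<subseteq> S0" "card S = card S0" using S hom by auto
      then have "S = S0"
        using S0(1) fin by (metis card_subset_eq finite_subset)
      then show ?thesis using True by simp
    next
      case False
      moreover have "?Q \<inter> S0 = {}" by blast
      ultimately show ?thesis by (cases "S = S0") auto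
    qed
    finally show "(\<Sum>T\<in>Pow ?Q. if T \<subseteq> S then (-1) ^ card T * g S else 0) = (if S = S0 then g S else 0)" .
  qed
  also have "\<dots> = g S0" using fin S0(1) by simp
  finally show ?thesis by simp
qed

lemma card_Collect_split:
  assumes "n \<le> (N::nat)"
  shows "card {p. p < N \<and> Q p} = card {p. p < n \<and> Q p} + card {p. n \<le> p \<and> p < N \<and> Q p}"
proof -
  have "{p. p < N \<and> Q p} = {p. p < n \<and> Q p} \<union> {p. n \<le> p \<and> p < N \<and> Q p}" using assms by auto
  also have "card \<dots> = card {p. p < n \<and> Q p} + card {p. n \<le> p \<and> p < N \<and> Q p}"
    by (rule card_Un_disjoint) auto
  finally show ?thesis .
qed

lemma ballot_leading_word:
  fixes f :: "nat list \<Rightarrow> complex"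
  assumes supp: "\<And>v. f v \<noteq> 0 \<Longrightarrow> v \<in> basis_index N k \<and> (\<forall>i<k. count_list v i = \<mu> i)"
    and inv: "\<And>A v. A \<in> unitriangular k \<Longrightarrow> v \<in> basis_index N k \<Longrightarrow> word_act N k A f v = f v"
    and w: "f w \<noteq> 0" and max: "\<And>v. f v \<noteq> 0 \<Longrightarrow> \<not> colex_less w v"
  shows "ballot w"
proof (rule ccontr)
  assume "\<not> ballot w"
  then obtain n0 c where n0: "count_list (take n0 w) c < count_list (take n0 w) (Suc c)"
    by (auto simp: ballot_def not_le)
  have wB: "w \<in> basis_index N k" and len: "length w = N"
    using supp[OF w] by (auto simp: basis_index_def)
  \<comment> \<open>A prefix longer than the word is the word itself, so the cut-off keeps both
    counts and makes \<open>n\<close> a bound for positions.\<close>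
  define n where "n = min n0 N"
  have n: "n \<le> N" and cnt: "count_list (take n w) c < count_list (take n w) (Suc c)"
    using n0 len by (auto simp: n_def min_def split: if_splits)
  have "Suc c \<in> set (take n w)" using cnt count_list_0_iff[of "take n w" "Suc c"] by auto
  then have ck: "Suc c < k" using wB by (auto simp: basis_index_def dest!: in_set_takeD)
  \<comment> \<open>The positions of the prefix that carry \<open>c\<close> or \<open>c + 1\<close>.
    A subset \<open>S\<close> selects those that receive \<open>c + 1\<close>, and \<open>S0\<close>
    is the choice that gives back \<open>w\<close>.\<close>
  define P where "P = {p. p < n \<and> (w ! p = c \<or> w ! p = Suc c)}"
  define S0 where "S0 = {p. p < n \<and> w ! p = Suc c}"
  have finP: "finite P" by (simp add: P_def)
  define fil where "fil = (\<lambda>S. map (\<lambda>p. if p \<in> P then (if p \<in> S then Suc c else c) else w ! p) [0..<N])"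
  have fil_nth: "fil S ! p = (if p \<in> P then (if p \<in> S then Suc c else c) else w ! p)" if "p < N" for S p
    using that by (simp add: fil_def)
  have fil_len: "length (fil S) = N" for S by (simp add: fil_def)
  have fil_S0: "fil S0 = w"
    using len by (auto simp: fil_def P_def S0_def intro!: nth_equalityI)
  have fil_B: "fil S \<in> basis_index N k" for S
    using ck basis_index_nth[OF wB] by (intro basis_indexI) (auto simp: fil_len fil_nth)
  have PN: "p < N" if "p \<in> P" for p using that n by (simp add: P_def)
  have S0P: "S0 \<subseteq> P" by (auto simp: S0_def P_def)
  have cardS: "count_list (fil S) (Suc c) = card S + card {p. n \<le> p \<and> p < N \<and> w ! p = Suc c}"
    if S: "S \<subseteq> P" for S
  proof -
    have "count_list (fil S) (Suc c) = card {p. p < N \<and> fil S ! p = Suc c}"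
      by (simp add: count_list_eq_card fil_len)
    also have "\<dots> = card {p. p < n \<and> fil S ! p = Suc c} + card {p. n \<le> p \<and> p < N \<and> fil S ! p = Suc c}"
      by (rule card_Collect_split[OF n])
    also have "{p. p < n \<and> fil S ! p = Suc c} = S"
      using S n by (auto simp: fil_nth P_def split: if_splits)
    also have "{p. n \<le> p \<and> p < N \<and> fil S ! p = Suc c} = {p. n \<le> p \<and> p < N \<and> w ! p = Suc c}"
      by (auto simp: fil_nth P_def)
    finally show ?thesis .
  qed
  have hom: "card S = card S0" if "S \<subseteq> P" "f (fil S) \<noteq> 0" for S
  proof -
    have "count_list (fil S) (Suc c) = count_list (fil S0) (Suc c)"
      using supp[OF that(2)] supp[of "fil S0"] w ck by (simp add: fil_S0)
    then show ?thesis using cardS[OF that(1)] cardS[OF S0P] by simp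
  qed
  \<comment> \<open>At a word, the action of this matrix sums \<open>f\<close> over all words
    obtained by raising some letters \<open>c\<close> to \<open>c + 1\<close>, each with coefficient
    1.\<close>
  define A :: "complex mat" where
    "A = Matrix.mat k k (\<lambda>(i, j). if i = j \<or> i = c \<and> j = Suc c then 1 else 0)"
  have A: "A \<in> unitriangular k"
    by (auto simp: A_def unitriangular_def upper_triangular_def)
  have A_ne: "A $$ (i, j) = (if i = j \<or> i = c \<and> j = Suc c then 1 else 0)" if "i < k" "j < k" for i j
    using that by (simp add: A_def)
  have zero: "(\<Sum>S | T \<subseteq> S \<and> S \<subseteq> P. f (fil S)) = 0" if T: "T \<subseteq> P" "card T < card S0" for T
  proof -
    \<comment> \<open>With fewer raised positions than \<open>S0\<close>, the word has the wrong
      weight, so one side of the invariance equation vanishes.\<close>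
    have "f (fil T) = 0" using hom[OF T(1)] T(2) by force
    then have "0 = word_act N k A f (fil T)" using inv[OF A fil_B] by simp
    also have "\<dots> = (\<Sum>u\<in>fil ` {S. T \<subseteq> S \<and> S \<subseteq> P}. (\<Prod>p<N. A $$ (fil T ! p, u ! p)) * f u)"
      unfolding word_act_def
    proof (rule sum.mono_neutral_right)
      show "fil ` {S. T \<subseteq> S \<and> S \<subseteq> P} \<subseteq> basis_index N k" using fil_B by blast
      show "\<forall>u\<in>basis_index N k - fil ` {S. T \<subseteq> S \<and> S \<subseteq> P}.
          (\<Prod>p<N. A $$ (fil T ! p, u ! p)) * f u = 0"
      proof (rule ballI, rule ccontr)
        fix u assume u: "u \<in> basis_index N k - fil ` {S. T \<subseteq> S \<and> S \<subseteq> P}"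
          and ne: "(\<Prod>p<N. A $$ (fil T ! p, u ! p)) * f u \<noteq> 0"
        have uB: "u \<in> basis_index N k" using u by simp
        have step: "u ! p = fil T ! p \<or> fil T ! p = c \<and> u ! p = Suc c" if p: "p < N" for p
        proof -
          have "A $$ (fil T ! p, u ! p) \<noteq> 0" using ne p by auto
          then show ?thesis
            using A_ne[OF basis_index_nth[OF fil_B p] basis_index_nth[OF uB p]] by (auto split: if_splits)
        qed
        \<comment> \<open>Raising a letter beyond the prefix would give a word larger than
          \<open>w\<close>, where \<open>f\<close> vanishes. The surviving words are thus
          \<open>fil S\<close> with \<open>T \<subseteq> S\<close>.\<close>
        have suffix: "u ! p = w ! p" if p: "n \<le> p" "p < N" for p
        proof (rule ccontr)
          assume "u ! p \<noteq> w ! p"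
          let ?D = "{p. n \<le> p \<and> p < N \<and> u ! p \<noteq> w ! p}"
          define x where "x = Max ?D"
          have "?D \<noteq> {}" using p \<open>u ! p \<noteq> w ! p\<close> by blast
          then have "x \<in> ?D" unfolding x_def by (intro Max_in) auto
          then have x: "n \<le> x" "x < N" "u ! x \<noteq> w ! x" by auto
          have "fil T ! x = w ! x" using x by (simp add: fil_nth P_def)
          then have "w ! x < u ! x" using step[OF x(2)] x(3) by auto
          moreover have "w ! y = u ! y" if "x < y" "y < N" for y
          proof (rule ccontr)
            assume "w ! y \<noteq> u ! y"
            then have "y \<le> x" unfolding x_def using that x(1) by (intro Max_ge) auto
            then show False using that by simp
          qed
          ultimately have "colex_less w u"
            using x(2) basis_index_length[OF uB] by (auto simp: colex_less_def)
          then show False using max[of u] ne by simp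
        qed
        define S where "S = {p \<in> P. u ! p = Suc c}"
        have "T \<subseteq> S"
        proof
          fix p assume "p \<in> T"
          then show "p \<in> S" using T(1) step[of p] PN[of p] fil_nth[of p T] by (auto simp: S_def)
        qed
        moreover have "u = fil S"
        proof (rule nth_equalityI)
          show "length u = length (fil S)" using basis_index_length[OF uB] by (simp add: fil_len)
          fix p assume "p < length u"
          then have p: "p < N" using basis_index_length[OF uB] by simp
          show "u ! p = fil S ! p"
          proof (cases "p \<in> P")
            case True
            then show ?thesis using step[OF p] p by (auto simp: fil_nth S_def split: if_splits)
          next
            case False
            show ?thesis
            proof (cases "p < n")
              case True
              then have "w ! p \<noteq> c" using False by (auto simp: P_def)
              then show ?thesis using step[OF p] False p by (auto simp: fil_nth)
            next
              case nn: False
              then show ?thesis using suffix[of p] False p by (auto simp: fil_nth)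
            qed
          qed
        qed
        moreover have "S \<subseteq> P" by (simp add: S_def)
        ultimately show False using u by blast
      qed
    qed simp
    also have "\<dots> = (\<Sum>S | T \<subseteq> S \<and> S \<subseteq> P. (\<Prod>p<N. A $$ (fil T ! p, fil S ! p)) * f (fil S))"
    proof (subst sum.reindex)
      show "inj_on fil {S. T \<subseteq> S \<and> S \<subseteq> P}"
      proof (rule inj_onI)
        fix S S' assume S: "S \<in> {S. T \<subseteq> S \<and> S \<subseteq> P}" "S' \<in> {S. T \<subseteq> S \<and> S \<subseteq> P}" and eq: "fil S = fil S'"
        have "p \<in> S \<longleftrightarrow> p \<in> S'" if "p \<in> P" for p
          using fil_nth[OF PN[OF that], of S] fil_nth[OF PN[OF that], of S'] that
          unfolding eq by (simp split: if_splits)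
        then show "S = S'" using S by blast
      qed
    qed simp
    also have "\<dots> = (\<Sum>S | T \<subseteq> S \<and> S \<subseteq> P. f (fil S))"
    proof (intro sum.cong refl)
      fix S assume S: "S \<in> {S. T \<subseteq> S \<and> S \<subseteq> P}"
      have "A $$ (fil T ! p, fil S ! p) = 1" if p: "p < N" for p
        using A_ne[OF basis_index_nth[OF fil_B p] basis_index_nth[OF fil_B p], of T S] S p
        by (auto simp: fil_nth)
      then show "(\<Prod>p<N. A $$ (fil T ! p, fil S ! p)) * f (fil S) = f (fil S)" by simp
    qed
    finally show ?thesis by simp
  qed
  have "card (P - S0) < card S0"
  proof -
    have "P - S0 = {p. p < n \<and> w ! p = c}" by (auto simp: P_def S0_def)
    then show ?thesis using cnt n len by (simp add: count_list_take S0_def)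
  qed
  then have "f (fil S0) = 0"
    using zero hom by (intro superset_sums_zero[OF finP S0P, of "\<lambda>S. f (fil S)"])
  then show False using w by (simp add: fil_S0)
qed

section \<open>Tensor products of tableau kernels\<close>

definition index_lists :: "nat \<Rightarrow> nat \<Rightarrow> nat \<Rightarrow> nat list list set" where
  "index_lists N d k = {ws. length ws = N \<and> set ws \<subseteq> basis_index d k}"

definition column :: "nat \<Rightarrow> nat list list \<Rightarrow> nat list" where
  "column j ws = map (\<lambda>w. w ! j) ws"

text \<open>Transposition, with \<open>columns N\<close> as its inverse: it identifies the
  \<open>N\<close>-th tensor power of a \<open>d\<close>-fold tensor product with the
  \<open>d\<close>-fold tensor product of \<open>N\<close>-th tensor powers.\<close>

definition columns :: "nat \<Rightarrow> nat list list \<Rightarrow> nat list list" where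
  "columns d ws = map (\<lambda>j. column j ws) [0..<d]"

lemma finite_index_lists [simp]: "finite (index_lists N d k)"
proof -
  have "index_lists N d k = {ws. set ws \<subseteq> basis_index d k \<and> length ws = N}"
    by (auto simp: index_lists_def)
  then show ?thesis using finite_lists_length_eq[of "basis_index d k" N] by simp
qed

lemma length_column [simp]: "length (column j ws) = length ws"
  by (simp add: column_def)

lemma nth_column: "p < length ws \<Longrightarrow> column j ws ! p = ws ! p ! j"
  by (simp add: column_def)

lemma length_columns [simp]: "length (columns d ws) = d"
  by (simp add: columns_def)

lemma nth_columns: "j < d \<Longrightarrow> columns d ws ! j = column j ws"
  by (simp add: columns_def)

lemma index_lists_nth: "ws \<in> index_lists N d k \<Longrightarrow> p < N \<Longrightarrow> ws ! p \<in> basis_index d k"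
  unfolding index_lists_def using nth_mem[of p ws] by blast

lemma index_lists_length: "ws \<in> index_lists N d k \<Longrightarrow> length ws = N"
  by (simp add: index_lists_def)

lemma index_listsI:
  "length ws = N \<Longrightarrow> (\<And>p. p < N \<Longrightarrow> ws ! p \<in> basis_index d k) \<Longrightarrow> ws \<in> index_lists N d k"
  unfolding index_lists_def by (auto simp: in_set_conv_nth)

lemma column_basis_index:
  assumes "ws \<in> index_lists N d k" "j < d"
  shows "column j ws \<in> basis_index N k"
proof (rule basis_indexI)
  show "length (column j ws) = N" using assms by (simp add: index_lists_def)
  fix p assume "p < N"
  then show "column j ws ! p < k"
    using assms basis_index_nth[OF index_lists_nth[OF assms(1)]] by (simp add: nth_column index_lists_length)
qed

lemma columns_index_lists:
  assumes "ws \<in> index_lists N d k"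
  shows "columns d ws \<in> index_lists d N k"
  using column_basis_index[OF assms] by (intro index_listsI) (simp_all add: nth_columns)

lemma columns_columns:
  assumes "ws \<in> index_lists N d k"
  shows "columns N (columns d ws) = ws"
proof (rule nth_equalityI)
  show "length (columns N (columns d ws)) = length ws" using assms by (simp add: index_lists_length)
  fix p assume "p < length (columns N (columns d ws))"
  then have p: "p < N" by simp
  show "columns N (columns d ws) ! p = ws ! p"
  proof (rule nth_equalityI)
    show "length (columns N (columns d ws) ! p) = length (ws ! p)"
      using p index_lists_nth[OF assms p] by (simp add: nth_columns basis_index_def)
    fix j assume "j < length (columns N (columns d ws) ! p)"
    then have "j < d" using p by (simp add: nth_columns)
    then show "columns N (columns d ws) ! p ! j = ws ! p ! j"
      using p assms by (simp add: nth_columns nth_column index_lists_length)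
  qed
qed

lemma bij_betw_columns: "bij_betw (columns d) (index_lists N d k) (index_lists d N k)"
  by (rule bij_betw_byWitness[where f' = "columns N"]) (auto simp: columns_columns columns_index_lists)

lemma column_columns: "cs \<in> index_lists d N k \<Longrightarrow> j < d \<Longrightarrow> column j (columns N cs) = cs ! j"
  using columns_columns[of cs d N k] nth_columns[of j d "columns N cs"] by simp

lemma prod_sum_lists:
  fixes h :: "nat \<Rightarrow> 'a \<Rightarrow> complex"
  assumes "finite S"
  shows "(\<Sum>xs | length xs = d \<and> set xs \<subseteq> S. \<Prod>j<d. h j (xs ! j)) = (\<Prod>j<d. \<Sum>x\<in>S. h j x)"
proof -
  have "(\<Prod>j<d. \<Sum>x\<in>S. h j x) = (\<Sum>g\<in>PiE {..<d} (\<lambda>_. S). \<Prod>j<d. h j (g j))"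
    using assms by (intro prod_sum_PiE) auto
  also have "\<dots> = (\<Sum>xs | length xs = d \<and> set xs \<subseteq> S. \<Prod>j<d. h j (xs ! j))"
  proof (rule sum.reindex_bij_witness[where j = "\<lambda>g. map g [0..<d]" and i = "\<lambda>xs. \<lambda>j\<in>{..<d}. xs ! j"])
    fix g assume g: "g \<in> PiE {..<d} (\<lambda>_. S)"
    show "(\<lambda>j\<in>{..<d}. map g [0..<d] ! j) = g"
      using g by (auto simp: fun_eq_iff PiE_def extensional_def)
    have "g j \<in> S" if "j < d" for j using PiE_mem[OF g, of j] that by simp
    then show "map g [0..<d] \<in> {xs. length xs = d \<and> set xs \<subseteq> S}" by auto
    show "(\<Prod>j<d. h j (map g [0..<d] ! j)) = (\<Prod>j<d. h j (g j))" by simp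
  next
    fix xs assume xs: "xs \<in> {xs. length xs = d \<and> set xs \<subseteq> S}"
    show "map (\<lambda>j\<in>{..<d}. xs ! j) [0..<d] = xs" using xs by (auto intro!: nth_equalityI)
    show "(\<lambda>j\<in>{..<d}. xs ! j) \<in> PiE {..<d} (\<lambda>_. S)" 
    proof (rule restrict_PiE_iff[THEN iffD2], rule ballI)
      fix j assume "j \<in> {..<d}"
      then show "xs ! j \<in> S" using xs nth_mem[of j xs] by blast
    qed
  qed
  finally show ?thesis by simp
qed

lemma gl_act_index_lists:
  assumes "ws \<in> index_lists N d k"
  shows "gl_act d k As f ws =
    (\<Sum>us\<in>index_lists N d k. (\<Prod>j<d. \<Prod>r<N. As ! j $$ (column j ws ! r, column j us ! r)) * f us)"
proof -
  have ws: "length ws = N" "set ws \<subseteq> basis_index d k" using assms by (auto simp: index_lists_def)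
  have "gl_act d k As f ws = (\<Sum>us\<in>index_lists N d k.
      (\<Prod>r<N. \<Prod>j<d. As ! j $$ (ws ! r ! j, us ! r ! j)) * f us)"
    unfolding gl_act_def index_lists_def using ws by simp
  also have "\<dots> = (\<Sum>us\<in>index_lists N d k. (\<Prod>j<d. \<Prod>r<N. As ! j $$ (column j ws ! r, column j us ! r)) * f us)"
  proof (intro sum.cong refl)
    fix us assume "us \<in> index_lists N d k"
    then have "(\<Prod>r<N. \<Prod>j<d. As ! j $$ (ws ! r ! j, us ! r ! j)) =
        (\<Prod>r<N. \<Prod>j<d. As ! j $$ (column j ws ! r, column j us ! r))"
      using ws by (intro prod.cong refl) (simp add: nth_column index_lists_length)
    also have "\<dots> = (\<Prod>j<d. \<Prod>r<N. As ! j $$ (column j ws ! r, column j us ! r))"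
      by (rule prod.swap)
    finally show "(\<Prod>r<N. \<Prod>j<d. As ! j $$ (ws ! r ! j, us ! r ! j)) * f us =
        (\<Prod>j<d. \<Prod>r<N. As ! j $$ (column j ws ! r, column j us ! r)) * f us" by simp
  qed
  finally show ?thesis .
qed

lemma gl_act_columns:
  assumes "cs \<in> index_lists d N k"
  shows "gl_act d k As f (columns N cs) =
    (\<Sum>us\<in>index_lists d N k. (\<Prod>j<d. \<Prod>r<N. As ! j $$ (cs ! j ! r, us ! j ! r)) * f (columns N us))"
proof -
  have "gl_act d k As f (columns N cs) = (\<Sum>us\<in>index_lists N d k.
      (\<Prod>j<d. \<Prod>r<N. As ! j $$ (column j (columns N cs) ! r, column j us ! r)) * f us)"
    by (rule gl_act_index_lists) (rule columns_index_lists[OF assms])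
  also have "\<dots> = (\<Sum>us\<in>index_lists d N k.
      (\<Prod>j<d. \<Prod>r<N. As ! j $$ (column j (columns N cs) ! r, column j (columns N us) ! r)) * f (columns N us))"
    by (rule sum.reindex_bij_betw[OF bij_betw_columns, symmetric])
  also have "\<dots> = (\<Sum>us\<in>index_lists d N k.
      (\<Prod>j<d. \<Prod>r<N. As ! j $$ (cs ! j ! r, us ! j ! r)) * f (columns N us))"
    by (intro sum.cong refl arg_cong2[of _ _ _ _ "(*)"] prod.cong) (simp_all add: column_columns[OF assms] column_columns)
  finally show ?thesis .
qed

lemma gl_act_outside:
  assumes "\<not> set ws \<subseteq> basis_index d k"
  shows "gl_act d k As f ws = 0"
  using assms by (simp add: gl_act_def)

text \<open>After transposition the summand factors over \<open>j\<close>, so the sum over tuples of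
  words becomes a product of sums over words.\<close>

lemma gl_act_product:
  assumes ws: "ws \<in> index_lists N d k"
    and f: "\<And>us. us \<in> index_lists N d k \<Longrightarrow> f us = (\<Prod>j<d. g j (column j us))"
  shows "gl_act d k As f ws = (\<Prod>j<d. word_act N k (As ! j) (g j) (column j ws))"
proof -
  let ?h = "\<lambda>j u. (\<Prod>r<N. As ! j $$ (column j ws ! r, u ! r)) * g j u"
  have "gl_act d k As f ws = (\<Sum>us\<in>index_lists N d k. \<Prod>j<d. ?h j (columns d us ! j))"
    unfolding gl_act_index_lists[OF ws]
    by (intro sum.cong refl) (simp add: f nth_columns prod.distrib)
  also have "\<dots> = (\<Sum>cs\<in>index_lists d N k. \<Prod>j<d. ?h j (cs ! j))"
    by (rule sum.reindex_bij_betw[OF bij_betw_columns])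
  also have "\<dots> = (\<Prod>j<d. \<Sum>u\<in>basis_index N k. ?h j u)"
    unfolding index_lists_def by (rule prod_sum_lists) simp
  finally show ?thesis by (simp add: word_act_def)
qed

text \<open>The height of column \<open>i\<close>, that is, the corresponding part of the conjugate
  partition, extended by 0.\<close>

definition content :: "nat list \<Rightarrow> nat \<Rightarrow> nat" where
  "content l i = card {j. j < length l \<and> i < l ! j}"

definition shapes :: "nat \<Rightarrow> nat \<Rightarrow> nat \<Rightarrow> nat list list \<Rightarrow> bool" where
  "shapes d k N ls \<longleftrightarrow> d > 0 \<and> length ls = d \<and> (\<forall>l\<in>set ls. partition_of N l \<and> (\<forall>p\<in>set l. p \<le> k))"

lemma shapesD:
  assumes "shapes d k N ls" "j < d"
  shows "sorted_wrt (\<ge>) (ls ! j)" "sum_list (ls ! j) = N" "\<forall>p\<in>set (ls ! j). p \<le> k"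
  using assms nth_mem[of j ls] by (auto simp: shapes_def partition_of_def)

lemma nth_default_conjugate:
  assumes "sorted_wrt (\<ge>) l"
  shows "nth_default 0 (conjugate l) i = content l i"
proof (cases "i < nth_default 0 l 0")
  case True
  then show ?thesis by (simp add: conjugate_def nth_default_def content_def)
next
  case False
  have "\<not> i < l ! j" if "j < length l" for j
  proof -
    have "l ! j \<le> l ! 0"
      using assms that by (cases "j = 0") (auto simp: sorted_wrt_iff_nth_less)
    moreover have "nth_default 0 l 0 = l ! 0" using that by (intro nth_default_nth) auto
    ultimately show ?thesis using False by simp
  qed
  then have "content l i = 0" by (auto simp: content_def)
  then show ?thesis using False by (simp add: conjugate_def nth_default_def)
qed

lemma sum_content:
  assumes "\<forall>p\<in>set l. p \<le> k"
  shows "(\<Sum>i<k. content l i) = sum_list l"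
proof -
  have "(\<Sum>i<k. content l i) = (\<Sum>i<k. \<Sum>j<length l. of_bool (i < l ! j))"
  proof (intro sum.cong refl)
    fix i
    have "{j. j < length l \<and> i < l ! j} = {..<length l} \<inter> {j. i < l ! j}" by auto
    then show "content l i = (\<Sum>j<length l. of_bool (i < l ! j))"
      by (simp add: content_def sum_of_bool_eq)
  qed
  also have "\<dots> = (\<Sum>j<length l. \<Sum>i<k. of_bool (i < l ! j))" by (rule sum.swap)
  also have "\<dots> = (\<Sum>j<length l. l ! j)"
  proof (intro sum.cong refl)
    fix j assume "j \<in> {..<length l}"
    then have "l ! j \<le> k" using assms by auto
    then have "{..<k} \<inter> {i. i < l ! j} = {..<l ! j}" by auto
    then show "(\<Sum>i<k. of_bool (i < l ! j)) = l ! j" by (simp add: sum_of_bool_eq)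
  qed
  also have "\<dots> = sum_list l" by (simp add: sum_list_sum_nth atLeast0LessThan)
  finally show ?thesis .
qed

lemma sum_count_list:
  assumes "set w \<subseteq> {..<k::nat}"
  shows "(\<Sum>i<k. count_list w i) = length w"
  using sum_count_set[OF assms finite_lessThan] .

text \<open>The length of \<open>ws\<close> is controlled by the factors: a nonzero one forces it to
  be the size of its shape.\<close>

definition tensor_kernel :: "nat \<Rightarrow> nat \<Rightarrow> nat list list \<Rightarrow> nat list list \<Rightarrow> nat list list \<Rightarrow> complex" where
  "tensor_kernel d k ls ss ws = (if length ss = d \<and> set ws \<subseteq> basis_index d k
     then \<Prod>j<d. tab_kernel (ls ! j) (ss ! j) (column j ws) else 0)"

text \<open>One alphabet for the row words of all shapes: the total number of rows bounds every row
  index. The resulting set is stable under permuting positions.\<close>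

definition row_lists :: "nat \<Rightarrow> nat \<Rightarrow> nat list list \<Rightarrow> nat list list set" where
  "row_lists d N ls = index_lists d N (sum_list (map length ls))"

lemma finite_row_lists [simp]: "finite (row_lists d N ls)"
  by (simp add: row_lists_def)

lemma cnj_tensor_kernel: "cnj (tensor_kernel d k ls ss ws) = tensor_kernel d k ls ss ws"
  by (simp add: tensor_kernel_def cnj_tab_kernel)

lemma tensor_kernel_filling:
  assumes "tensor_kernel d k ls ss ws \<noteq> 0" "j < d"
  shows "filling (ls ! j) (ss ! j) (column j ws)"
  using assms by (auto simp: tensor_kernel_def tab_kernel_nonzero_iff[symmetric] split: if_splits)

lemma tensor_kernel_support:
  assumes sh: "shapes d k N ls" and ne: "tensor_kernel d k ls ss ws \<noteq> 0"
  shows "ss \<in> row_lists d N ls \<and> ws \<in> index_lists N d k"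
proof
  have len: "length ss = d" "set ws \<subseteq> basis_index d k"
    using ne by (auto simp: tensor_kernel_def split: if_splits)
  have "d > 0" using sh by (simp add: shapes_def)
  then have "length ws = N"
    using tensor_kernel_filling[OF ne, of 0] shapesD(2)[OF sh, of 0] by (simp add: filling_def)
  then show "ws \<in> index_lists N d k" using len by (simp add: index_lists_def)
  show "ss \<in> row_lists d N ls"
    unfolding row_lists_def
  proof (rule index_listsI[OF len(1)])
    fix j assume j: "j < d"
    have "ss ! j \<in> basis_index N (length (ls ! j))"
      using filling_row_word[OF tensor_kernel_filling[OF ne j]] shapesD(2)[OF sh j] by simp
    moreover have "length (ls ! j) \<le> sum_list (map length ls)"
      using sh j by (intro member_le_sum_list) (auto simp: shapes_def)
    ultimately show "ss ! j \<in> basis_index N (sum_list (map length ls))"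
      by (auto simp: basis_index_def)
  qed
qed

lemma gl_act_tensor_kernel:
  assumes sh: "shapes d k N ls" and As: "length As = d" "set As \<subseteq> unitriangular k"
  shows "gl_act d k As (tensor_kernel d k ls ss) = tensor_kernel d k ls ss"
proof
  fix ws
  show "gl_act d k As (tensor_kernel d k ls ss) ws = tensor_kernel d k ls ss ws"
  proof (cases "length ss = d \<and> set ws \<subseteq> basis_index d k")
    case False
    then consider "length ss \<noteq> d" | "\<not> set ws \<subseteq> basis_index d k" by blast
    then show ?thesis
    proof cases
      case 1
      then have "tensor_kernel d k ls ss us = 0" for us by (simp add: tensor_kernel_def)
      then show ?thesis by (simp add: gl_act_def)
    next
      case 2
      then show ?thesis by (simp add: gl_act_outside tensor_kernel_def)
    qed
  next
    case True
    show ?thesis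
    proof (cases "length ws = N")
      case False
      have "tensor_kernel d k ls ss us = 0" if "length us = length ws" for us
        using tensor_kernel_support[OF sh, of ss us] False that by (auto simp: index_lists_def)
      then show ?thesis by (simp add: gl_act_def)
    next
      case len: True
      then have ws: "ws \<in> index_lists N d k" using True by (simp add: index_lists_def)
      have "gl_act d k As (tensor_kernel d k ls ss) ws =
          (\<Prod>j<d. word_act N k (As ! j) (tab_kernel (ls ! j) (ss ! j)) (column j ws))"
        using True by (intro gl_act_product[OF ws]) (simp add: tensor_kernel_def index_lists_def)
      also have "\<dots> = (\<Prod>j<d. tab_kernel (ls ! j) (ss ! j) (column j ws))"
      proof (intro prod.cong refl)
        fix j assume "j \<in> {..<d}"
        then have j: "j < d" by simp
        have "As ! j \<in> unitriangular k" using As j by auto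
        then show "word_act N k (As ! j) (tab_kernel (ls ! j) (ss ! j)) (column j ws) =
            tab_kernel (ls ! j) (ss ! j) (column j ws)"
          using word_act_tab_kernel[of "As ! j" k "ls ! j" "column j ws" "ss ! j"]
            shapesD[OF sh j] column_basis_index[OF ws j] by simp
      qed
      finally show ?thesis using True by (simp add: tensor_kernel_def)
    qed
  qed
qed

text \<open>Splitting off the first factor turns the multilinearity of \<open>pure_tensor\<close>
  into an induction on the list.\<close>

definition tensor_cons :: "('x \<Rightarrow> complex) \<Rightarrow> ('x list \<Rightarrow> complex) \<Rightarrow> 'x list \<Rightarrow> complex" where
  "tensor_cons f g = (\<lambda>xs. case xs of [] \<Rightarrow> 0 | x # ys \<Rightarrow> f x * g ys)"

lemma pure_tensor_Cons: "pure_tensor (f # fs) = tensor_cons f (pure_tensor fs)"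
proof
  fix xs
  show "pure_tensor (f # fs) xs = tensor_cons f (pure_tensor fs) xs"
    by (cases xs) (auto simp: pure_tensor_def tensor_cons_def prod.lessThan_Suc_shift simp del: prod.lessThan_Suc)
qed

lemma tensor_cons_linear_left:
  "tensor_cons (f + f') g = tensor_cons f g + tensor_cons f' g"
  "tensor_cons (cscale c f) g = cscale c (tensor_cons f g)"
  "tensor_cons 0 g = 0"
  by (auto simp: tensor_cons_def fun_eq_iff cscale_def algebra_simps split: list.splits)

lemma tensor_cons_linear_right:
  "tensor_cons f (g + g') = tensor_cons f g + tensor_cons f g'"
  "tensor_cons f (cscale c g) = cscale c (tensor_cons f g)"
  "tensor_cons f 0 = 0"
  by (auto simp: tensor_cons_def fun_eq_iff cscale_def algebra_simps split: list.splits)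

lemma tensor_cons_span:
  assumes "f \<in> cfun.span B" "g \<in> cfun.span C"
    and mem: "\<And>b c. b \<in> B \<Longrightarrow> c \<in> C \<Longrightarrow> tensor_cons b c \<in> cfun.span D"
  shows "tensor_cons f g \<in> cfun.span D"
proof -
  have 1: "tensor_cons b g \<in> cfun.span D" if b: "b \<in> B" for b
    using assms(2)
  proof (induction rule: cfun.span_induct_alt)
    case base
    then show ?case unfolding tensor_cons_linear_right by (rule cfun.span_zero)
  next
    case (step c x y)
    then show ?case unfolding tensor_cons_linear_right
      using mem[OF b] by (intro cfun.span_add cfun.span_scale) auto
  qed
  show ?thesis using assms(1)
  proof (induction rule: cfun.span_induct_alt)
    case base
    then show ?case unfolding tensor_cons_linear_left by (rule cfun.span_zero)
  next
    case (step c x y)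
    then show ?case unfolding tensor_cons_linear_left
      using 1 by (intro cfun.span_add cfun.span_scale) auto
  qed
qed

lemma pure_tensor_span:
  assumes "list_all2 (\<lambda>f B. f \<in> cfun.span B) fs Bs"
  shows "pure_tensor fs \<in> cfun.span (pure_tensor ` {gs. list_all2 (\<in>) gs Bs})"
  using assms
proof (induction rule: list_all2_induct)
  case Nil
  then show ?case by (auto intro: cfun.span_base)
next
  case (Cons f fs B Bs)
  show ?case unfolding pure_tensor_Cons
  proof (rule tensor_cons_span[OF Cons.hyps(1) Cons.IH])
    fix b c assume b: "b \<in> B" and "c \<in> pure_tensor ` {gs. list_all2 (\<in>) gs Bs}"
    then obtain gs where gs: "list_all2 (\<in>) gs Bs" "c = pure_tensor gs" by blast
    have "tensor_cons b c = pure_tensor (b # gs)" by (simp add: gs(2) pure_tensor_Cons)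
    moreover have "list_all2 (\<in>) (b # gs) (B # Bs)" using b gs(1) by simp
    ultimately show "tensor_cons b c \<in> cfun.span (pure_tensor ` {gs. list_all2 (\<in>) gs (B # Bs)})"
      by (metis (mono_tags, lifting) cfun.span_base imageI mem_Collect_eq)
  qed
qed

text \<open>By multilinearity, tensors of generators span. Choosing one column word for each factor
  is, by transposition, choosing a single list \<open>ws\<close>.\<close>

lemma tensor_space_specht:
  assumes sh: "shapes d k N ls"
  shows "tensor_space (map specht ls) =
    cfun.span ((\<lambda>ws ss. tensor_kernel d k ls ss ws) ` index_lists N d k)"
proof -
  let ?Y = "basis_index N k"
  define B where "B = (\<lambda>l. (\<lambda>w s. tab_kernel l s w) ` ?Y)"
  let ?T = "(\<lambda>ws ss. tensor_kernel d k ls ss ws) ` index_lists N d k"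
  have len: "length ls = d" using sh by (simp add: shapes_def)
  have specht: "specht l = cfun.span (B l)" if "l \<in> set ls" for l
    unfolding B_def
    using that sh filling_column_word[of l _ _ k]
    by (intro specht_eq_span) (auto simp: shapes_def partition_of_def)
  have T: "pure_tensor ` {gs. list_all2 (\<in>) gs (map B ls)} = ?T"
  proof (intro equalityI subsetI)
    fix F assume "F \<in> pure_tensor ` {gs. list_all2 (\<in>) gs (map B ls)}"
    then obtain gs where gs: "length gs = d" "\<And>j. j < d \<Longrightarrow> gs ! j \<in> B (ls ! j)" "F = pure_tensor gs"
      using len by (auto simp: list_all2_conv_all_nth)
    then have "\<forall>j<d. \<exists>w\<in>?Y. gs ! j = (\<lambda>s. tab_kernel (ls ! j) s w)" by (auto simp: B_def)
    then obtain w where w: "\<And>j. j < d \<Longrightarrow> w j \<in> ?Y" "\<And>j. j < d \<Longrightarrow> gs ! j = (\<lambda>s. tab_kernel (ls ! j) s (w j))"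
      by metis
    let ?ws = "columns N (map w [0..<d])"
    have cs: "map w [0..<d] \<in> index_lists d N k" using w by (intro index_listsI) auto
    then have ws: "?ws \<in> index_lists N d k" by (rule columns_index_lists)
    have "F ss = tensor_kernel d k ls ss ?ws" for ss
      using ws gs w column_columns[OF cs] by (simp add: pure_tensor_def tensor_kernel_def index_lists_def)
    then have "F = (\<lambda>ss. tensor_kernel d k ls ss ?ws)" by blast
    then show "F \<in> ?T" using ws by (rule image_eqI)
  next
    fix F assume "F \<in> ?T"
    then obtain ws where ws: "ws \<in> index_lists N d k" "F = (\<lambda>ss. tensor_kernel d k ls ss ws)" by blast
    let ?gs = "map (\<lambda>j s. tab_kernel (ls ! j) s (column j ws)) [0..<d]"
    have "F = pure_tensor ?gs"
      using ws by (auto simp: pure_tensor_def tensor_kernel_def index_lists_def fun_eq_iff)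
    moreover have "list_all2 (\<in>) ?gs (map B ls)"
      using len column_basis_index[OF ws(1)] by (auto simp: list_all2_conv_all_nth B_def)
    ultimately show "F \<in> pure_tensor ` {gs. list_all2 (\<in>) gs (map B ls)}" by blast
  qed
  show ?thesis
    unfolding tensor_space_def
  proof
    show "cfun.span (pure_tensor ` {fs. list_all2 (\<in>) fs (map specht ls)}) \<subseteq> cfun.span ?T"
    proof (rule cfun.span_minimal)
      show "pure_tensor ` {fs. list_all2 (\<in>) fs (map specht ls)} \<subseteq> cfun.span ?T"
      proof clarify
        fix fs assume "list_all2 (\<in>) fs (map specht ls)"
        then have "list_all2 (\<lambda>f B. f \<in> cfun.span B) fs (map B ls)"
          using specht by (auto simp: list_all2_conv_all_nth)
        from pure_tensor_span[OF this] show "pure_tensor fs \<in> cfun.span ?T" by (simp only: T)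
      qed
    qed simp
    have "{gs. list_all2 (\<in>) gs (map B ls)} \<subseteq> {fs. list_all2 (\<in>) fs (map specht ls)}"
    proof clarify
      fix gs assume gs: "list_all2 (\<in>) gs (map B ls)"
      then have "gs ! j \<in> specht (ls ! j)" if "j < length ls" for j
        using specht[of "ls ! j"] that by (auto simp: list_all2_conv_all_nth intro!: cfun.span_base)
      then show "list_all2 (\<in>) gs (map specht ls)"
        using gs by (auto simp: list_all2_conv_all_nth)
    qed
    then show "cfun.span ?T \<subseteq> cfun.span (pure_tensor ` {fs. list_all2 (\<in>) fs (map specht ls)})"
      unfolding T[symmetric] by (intro cfun.span_mono image_mono)
  qed
qed

text \<open>The highest weight vectors of the conjugate weights, together with 0, in the full tensor
  algebra before alternation is imposed. Letter counts replace the action of diagonal matrices;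
  \<open>weight_vector_iff\<close> justifies this.\<close>

definition unipotent_invariants :: "nat \<Rightarrow> nat \<Rightarrow> nat list list \<Rightarrow> (nat list list \<Rightarrow> complex) set" where
  "unipotent_invariants d k ls = {F.
     (\<forall>ws. F ws \<noteq> 0 \<longrightarrow> set ws \<subseteq> basis_index d k \<and>
        (\<forall>j<d. \<forall>i<k. count_list (column j ws) i = content (ls ! j) i)) \<and>
     (\<forall>As. length As = d \<and> set As \<subseteq> unitriangular k \<longrightarrow> gl_act d k As F = F)}"

lemma gl_act_add: "gl_act d k As (f + g) = gl_act d k As f + gl_act d k As g"
  by (auto simp: gl_act_def fun_eq_iff algebra_simps sum.distrib)

lemma gl_act_scale: "gl_act d k As (cscale c f) = cscale c (gl_act d k As f)"
  by (auto simp: gl_act_def fun_eq_iff cscale_def sum_distrib_left algebra_simps)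

lemma subspace_unipotent_invariants: "cfun.subspace (unipotent_invariants d k ls)"
  unfolding cfun.subspace_def
proof (intro conjI ballI allI)
  show "0 \<in> unipotent_invariants d k ls"
    using gl_act_scale[of d k _ 0 0] by (simp add: unipotent_invariants_def)
next
  fix f g assume fg: "f \<in> unipotent_invariants d k ls" "g \<in> unipotent_invariants d k ls"
  have "f ws \<noteq> 0 \<or> g ws \<noteq> 0" if "(f + g) ws \<noteq> 0" for ws using that by auto
  then show "f + g \<in> unipotent_invariants d k ls"
    using fg unfolding unipotent_invariants_def by (simp add: gl_act_add) blast
next
  fix c f assume "f \<in> unipotent_invariants d k ls"
  then show "cscale c f \<in> unipotent_invariants d k ls"
    unfolding unipotent_invariants_def by (auto simp: gl_act_scale) (auto simp: cscale_def)
qed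

text \<open>The letter counts of a single factor already add up to the length, so the weight
  determines the degree.\<close>

lemma unipotent_invariants_support:
  assumes sh: "shapes d k N ls" and F: "F \<in> unipotent_invariants d k ls" and ne: "F ws \<noteq> 0"
  shows "ws \<in> index_lists N d k"
proof -
  have ws: "set ws \<subseteq> basis_index d k" and cnt: "\<And>j i. j < d \<Longrightarrow> i < k \<Longrightarrow> count_list (column j ws) i = content (ls ! j) i"
    using F ne by (auto simp: unipotent_invariants_def)
  have d: "0 < d" using sh by (simp add: shapes_def)
  have "ws \<in> index_lists (length ws) d k" using ws by (simp add: index_lists_def)
  then have "set (column 0 ws) \<subseteq> {..<k}" using column_basis_index d by (auto simp: basis_index_def)
  then have "length (column 0 ws) = (\<Sum>i<k. count_list (column 0 ws) i)" by (rule sum_count_list[symmetric])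
  also have "\<dots> = (\<Sum>i<k. content (ls ! 0) i)" using cnt d by (intro sum.cong) auto
  also have "\<dots> = N" using sum_content shapesD[OF sh d] by simp
  finally show ?thesis using ws by (simp add: index_lists_def)
qed

lemma tensor_kernel_unipotent:
  assumes sh: "shapes d k N ls"
  shows "tensor_kernel d k ls ss \<in> unipotent_invariants d k ls"
  unfolding unipotent_invariants_def
proof (intro CollectI conjI allI impI)
  fix ws assume ne: "tensor_kernel d k ls ss ws \<noteq> 0"
  show "set ws \<subseteq> basis_index d k"
    using tensor_kernel_support[OF sh ne] by (simp add: index_lists_def)
  show "count_list (column j ws) i = content (ls ! j) i" if "j < d" for j i
    using filling_content[OF tensor_kernel_filling[OF ne that]] by (simp add: content_def)
qed (use gl_act_tensor_kernel[OF sh] in auto)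

text \<open>Act by \<open>A\<close> on factor \<open>j\<close> and by identity matrices on the
  others: the matrix coefficients vanish unless the other words stay unchanged.\<close>

lemma unipotent_invariants_column:
  assumes sh: "shapes d k N ls" and F: "F \<in> unipotent_invariants d k ls"
    and ws: "ws \<in> index_lists N d k" and j: "j < d" and A: "A \<in> unitriangular k"
    and v: "v \<in> basis_index N k"
  shows "word_act N k A (\<lambda>u. F (columns N ((columns d ws)[j := u]))) v = F (columns N ((columns d ws)[j := v]))"
proof -
  let ?c = "columns d ws"
  have c: "?c \<in> index_lists d N k" by (rule columns_index_lists[OF ws])
  have upd: "?c[j := u] \<in> index_lists d N k" if "u \<in> basis_index N k" for u
    using c that j by (intro index_listsI) (auto simp: nth_list_update index_lists_nth)
  define As where "As = map (\<lambda>i. if i = j then A else 1\<^sub>m k) [0..<d]"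
  have one: "1\<^sub>m k \<in> unitriangular k"
    by (auto simp: unitriangular_def upper_triangular_def)
  have As: "length As = d" "set As \<subseteq> unitriangular k"
    using A one by (auto simp: As_def)
  have "F (columns N (?c[j := v])) = gl_act d k As F (columns N (?c[j := v]))"
    using F As by (simp add: unipotent_invariants_def)
  also have "\<dots> = (\<Sum>us\<in>index_lists d N k.
      (\<Prod>i<d. \<Prod>r<N. As ! i $$ (?c[j := v] ! i ! r, us ! i ! r)) * F (columns N us))"
    by (rule gl_act_columns[OF upd[OF v]])
  also have "\<dots> = (\<Sum>us\<in>(\<lambda>u. ?c[j := u]) ` basis_index N k.
      (\<Prod>i<d. \<Prod>r<N. As ! i $$ (?c[j := v] ! i ! r, us ! i ! r)) * F (columns N us))"
  proof (rule sum.mono_neutral_right)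
    show "(\<lambda>u. ?c[j := u]) ` basis_index N k \<subseteq> index_lists d N k" using upd by blast
    show "\<forall>us\<in>index_lists d N k - (\<lambda>u. ?c[j := u]) ` basis_index N k.
        (\<Prod>i<d. \<Prod>r<N. As ! i $$ (?c[j := v] ! i ! r, us ! i ! r)) * F (columns N us) = 0"
    proof (rule ballI, rule ccontr)
      fix us assume us: "us \<in> index_lists d N k - (\<lambda>u. ?c[j := u]) ` basis_index N k"
        and ne: "(\<Prod>i<d. \<Prod>r<N. As ! i $$ (?c[j := v] ! i ! r, us ! i ! r)) * F (columns N us) \<noteq> 0"
      have usB: "us ! i \<in> basis_index N k" if "i < d" for i
        using us that index_lists_nth by blast
      have "us ! i = ?c ! i" if i: "i < d" "i \<noteq> j" for i
      proof (rule nth_equalityI)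
        show "length (us ! i) = length (?c ! i)"
          using basis_index_length[OF usB[OF i(1)]] basis_index_length[OF index_lists_nth[OF c i(1)]] by simp
        fix r assume "r < length (us ! i)"
        then have r: "r < N" using basis_index_length[OF usB[OF i(1)]] by simp
        have "As ! i $$ (?c[j := v] ! i ! r, us ! i ! r) \<noteq> 0" using ne i(1) r by auto
        then show "us ! i ! r = ?c ! i ! r"
          using i basis_index_nth[OF usB[OF i(1)] r] basis_index_nth[OF index_lists_nth[OF c i(1)] r]
          by (auto simp: As_def split: if_splits)
      qed
      then have "us = ?c[j := us ! j]"
        using us j by (intro nth_equalityI) (auto simp: nth_list_update index_lists_length)
      then show False using us usB[OF j] by blast
    qed
  qed simp
  also have "\<dots> = (\<Sum>u\<in>basis_index N k.
      (\<Prod>i<d. \<Prod>r<N. As ! i $$ (?c[j := v] ! i ! r, ?c[j := u] ! i ! r)) * F (columns N (?c[j := u])))"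
  proof (subst sum.reindex)
    show "inj_on (\<lambda>u. ?c[j := u]) (basis_index N k)"
    proof (rule inj_onI)
      fix u u' assume "?c[j := u] = ?c[j := u']"
      then have "?c[j := u] ! j = ?c[j := u'] ! j" by simp
      then show "u = u'" using j by simp
    qed
  qed simp
  also have "\<dots> = word_act N k A (\<lambda>u. F (columns N (?c[j := u]))) v"
    unfolding word_act_def
  proof (intro sum.cong refl arg_cong2[of _ _ _ _ "(*)"])
    fix u assume u: "u \<in> basis_index N k"
    have "(\<Prod>i<d. \<Prod>r<N. As ! i $$ (?c[j := v] ! i ! r, ?c[j := u] ! i ! r)) =
        (\<Prod>i<d. if i = j then \<Prod>r<N. A $$ (v ! r, u ! r) else 1)"
    proof (intro prod.cong refl)
      fix i assume "i \<in> {..<d}"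
      then have i: "i < d" by simp
      show "(\<Prod>r<N. As ! i $$ (?c[j := v] ! i ! r, ?c[j := u] ! i ! r)) =
        (if i = j then \<Prod>r<N. A $$ (v ! r, u ! r) else 1)"
      proof (cases "i = j")
        case True
        then show ?thesis using j by (simp add: As_def)
      next
        case False
        then show ?thesis
          using i basis_index_nth[OF index_lists_nth[OF c i]] by (simp add: As_def)
      qed
    qed
    also have "\<dots> = (\<Prod>r<N. A $$ (v ! r, u ! r))" using j by simp
    finally show "(\<Prod>i<d. \<Prod>r<N. As ! i $$ (?c[j := v] ! i ! r, ?c[j := u] ! i ! r)) =
        (\<Prod>r<N. A $$ (v ! r, u ! r))" .
  qed
  finally show ?thesis by simp
qed

section \<open>Highest weight vectors of the exterior algebra\<close>

text \<open>A sum, so that replacing one word raises the code of the tuple exactly when it raises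
  the code of that word.\<close>

definition tuple_code :: "nat \<Rightarrow> nat \<Rightarrow> nat list list \<Rightarrow> nat" where
  "tuple_code d k ws = (\<Sum>j<d. word_code k (column j ws))"

lemma ballot_leading_tuple:
  assumes sh: "shapes d k N ls" and F: "F \<in> unipotent_invariants d k ls" and ne: "F ws \<noteq> 0"
    and max: "\<And>us. F us \<noteq> 0 \<Longrightarrow> tuple_code d k us \<le> tuple_code d k ws" and j: "j < d"
  shows "ballot (column j ws)"
proof -
  let ?c = "columns d ws"
  have ws: "ws \<in> index_lists N d k" by (rule unipotent_invariants_support[OF sh F ne])
  have c: "?c \<in> index_lists d N k" by (rule columns_index_lists[OF ws])
  \<comment> \<open>All words of \<open>ws\<close> except the \<open>j\<close>-th are frozen;
    \<open>f\<close> below cuts this function off outside the words of length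
    \<open>N\<close>.\<close>
  define G where "G = (\<lambda>u. F (columns N (?c[j := u])))"
  define f where "f = (\<lambda>u. if u \<in> basis_index N k then G u else 0)"
  have upd: "?c[j := u] \<in> index_lists d N k" if "u \<in> basis_index N k" for u
    using c that j by (intro index_listsI) (auto simp: nth_list_update index_lists_nth)
  have col_upd: "column i (columns N (?c[j := u])) = (if i = j then u else column i ws)"
    if "u \<in> basis_index N k" "i < d" for u i
    using column_columns[OF upd[OF that(1)] that(2)] that j by (simp add: nth_list_update nth_columns)
  have w: "column j ws \<in> basis_index N k" by (rule column_basis_index[OF ws j])
  have "?c[j := column j ws] = ?c" using j by (metis list_update_id nth_columns)
  then have Gw: "G (column j ws) = F ws" by (simp add: G_def columns_columns[OF ws])
  show ?thesis
  proof (rule ballot_leading_word)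
    fix v assume "f v \<noteq> 0"
    then have v: "v \<in> basis_index N k" and Fv: "F (columns N (?c[j := v])) \<noteq> 0"
      by (auto simp: f_def G_def split: if_splits)
    have "\<forall>i<k. count_list (column j (columns N (?c[j := v]))) i = content (ls ! j) i"
      using F Fv j by (auto simp: unipotent_invariants_def)
    then show "v \<in> basis_index N k \<and> (\<forall>i<k. count_list v i = content (ls ! j) i)"
      using v col_upd[OF v j] by simp
    show "\<not> colex_less (column j ws) v"
    proof
      assume "colex_less (column j ws) v"
      then have lt: "word_code k (column j ws) < word_code k v"
        using word_code_mono w v by blast
      have "tuple_code d k ws < tuple_code d k (columns N (?c[j := v]))"
        unfolding tuple_code_def
        by (rule sum_strict_mono_ex1) (use lt j col_upd[OF v] in auto)
      then show False using max[OF Fv] by simp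
    qed
  next
    fix A v assume A: "A \<in> unitriangular k" and v: "v \<in> basis_index N k"
    have "word_act N k A f v = word_act N k A G v"
      unfolding word_act_def by (intro sum.cong refl) (simp add: f_def)
    also have "\<dots> = G v"
      unfolding G_def by (rule unipotent_invariants_column[OF sh F ws j A v])
    finally show "word_act N k A f v = f v" using v by (simp add: f_def)
  next
    show "f (column j ws) \<noteq> 0" using w ne Gw by (simp add: f_def)
  qed
qed

definition leading_rows :: "nat \<Rightarrow> nat list list \<Rightarrow> nat list list" where
  "leading_rows d ws = map (\<lambda>j. ballot_rows (column j ws)) [0..<d]"

text \<open>In each factor the row word read off from a ballot word gives a row that leads at that
  word. A tuple in the support of the product row is therefore dominated factor by factor.\<close>

lemma tensor_kernel_leading:
  assumes sh: "shapes d k N ls" and F: "F \<in> unipotent_invariants d k ls" and ne: "F ws \<noteq> 0"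
    and max: "\<And>us. F us \<noteq> 0 \<Longrightarrow> tuple_code d k us \<le> tuple_code d k ws"
  shows "tensor_kernel d k ls (leading_rows d ws) ws \<noteq> 0"
    and "\<And>us. tensor_kernel d k ls (leading_rows d ws) us \<noteq> 0 \<Longrightarrow>
      us = ws \<or> tuple_code d k us < tuple_code d k ws"
proof -
  let ?r = "leading_rows d ws"
  have ws: "ws \<in> index_lists N d k" by (rule unipotent_invariants_support[OF sh F ne])
  have ballot: "ballot (column j ws)" if "j < d" for j
    using ballot_leading_tuple[OF sh F ne max that] .
  have r: "?r ! j = ballot_rows (column j ws)" if "j < d" for j
    using that by (simp add: leading_rows_def)
  have fil: "filling (ls ! j) (ballot_rows (column j ws)) (column j ws)" if j: "j < d" for j
  proof (rule filling_ballot_rows)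
    show "sorted_wrt (\<ge>) (ls ! j)" "length (column j ws) = sum_list (ls ! j)"
      using shapesD[OF sh j] ws by (auto simp: index_lists_length)
    fix c
    show "count_list (column j ws) c = card {i. i < length (ls ! j) \<and> c < ls ! j ! i}"
    proof (cases "c < k")
      case True
      then show ?thesis using F ne j by (simp add: unipotent_invariants_def content_def)
    next
      case False
      then have "c \<notin> set (column j ws)"
        using column_basis_index[OF ws j] by (auto simp: basis_index_def)
      moreover have "\<not> c < ls ! j ! i" if "i < length (ls ! j)" for i
        using shapesD(3)[OF sh j] nth_mem[OF that] False by fastforce
      then have "{i. i < length (ls ! j) \<and> c < ls ! j ! i} = {}" by auto
      ultimately show ?thesis by (simp add: count_list_0_iff)
    qed
  qed
  show "tensor_kernel d k ls ?r ws \<noteq> 0"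
    using ws fil r
    by (auto simp: tensor_kernel_def index_lists_def leading_rows_def tab_kernel_nonzero_iff)
  fix us assume us: "tensor_kernel d k ls ?r us \<noteq> 0"
  then have usY: "us \<in> index_lists N d k" using tensor_kernel_support[OF sh] by blast
  have cl: "column j us = column j ws \<or> word_code k (column j us) < word_code k (column j ws)"
    if j: "j < d" for j
  proof -
    have "filling (ls ! j) (ballot_rows (column j ws)) (column j us)"
      using tensor_kernel_filling[OF us j] r[OF j] by simp
    then show ?thesis
      using filling_ballot_rows_leading[OF ballot[OF j] fil[OF j]]
        word_code_mono[OF _ column_basis_index[OF usY j] column_basis_index[OF ws j]] by blast
  qed
  show "us = ws \<or> tuple_code d k us < tuple_code d k ws"
  proof (cases "\<forall>j<d. column j us = column j ws")
    case True
    then have "columns d us = columns d ws" by (simp add: columns_def)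
    then show ?thesis using columns_columns[OF usY] columns_columns[OF ws] by metis
  next
    case False
    then obtain j where j: "j < d" "column j us \<noteq> column j ws" by blast
    have le: "word_code k (column i us) \<le> word_code k (column i ws)" if "i < d" for i
      using cl[OF that] by auto
    have "tuple_code d k us < tuple_code d k ws"
      unfolding tuple_code_def
      by (rule sum_strict_mono_ex1) (use le cl[OF j(1)] j in auto)
    then show ?thesis ..
  qed
qed

text \<open>Gaussian elimination, by induction on a strict bound \<open>m\<close> for the codes in
  the support.\<close>

lemma unipotent_invariants_span:
  assumes sh: "shapes d k N ls" and F: "F \<in> unipotent_invariants d k ls"
  shows "F \<in> cfun.span (tensor_kernel d k ls ` row_lists d N ls)"
proof -
  let ?K = "tensor_kernel d k ls" and ?S = "cfun.span (tensor_kernel d k ls ` row_lists d N ls)"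
  have "\<forall>F. F \<in> unipotent_invariants d k ls \<longrightarrow> (\<forall>ws. F ws \<noteq> 0 \<longrightarrow> tuple_code d k ws < m) \<longrightarrow> F \<in> ?S" for m
  proof (induction m)
    case 0
    then show ?case by (auto intro!: cfun.span_zero simp flip: fun_eq_iff zero_fun_def)
  next
    case (Suc m)
    show ?case
    proof (intro allI impI)
      fix F assume F: "F \<in> unipotent_invariants d k ls" and bound: "\<forall>ws. F ws \<noteq> 0 \<longrightarrow> tuple_code d k ws < Suc m"
      define top where "top = {ws. F ws \<noteq> 0 \<and> tuple_code d k ws = m}"
      have "top \<subseteq> index_lists N d k"
        using unipotent_invariants_support[OF sh F] by (auto simp: top_def)
      then have fin: "finite top" by (rule finite_subset) simp
      have max: "tuple_code d k us \<le> tuple_code d k ws" if "ws \<in> top" "F us \<noteq> 0" for us ws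
        using bound that by (auto simp: top_def less_Suc_eq_le)
      have ne: "F ws \<noteq> 0" if "ws \<in> top" for ws using that by (simp add: top_def)
      note lead = tensor_kernel_leading[OF sh F ne max]
      \<comment> \<open>All coefficients of code \<open>m\<close> are cancelled at once. The row led
        by \<open>ws\<close> vanishes at every other tuple of code at least \<open>m\<close>, so the
        corrections do not interfere.\<close>
      define H where "H = (\<Sum>ws\<in>top. cscale (F ws / ?K (leading_rows d ws) ws) (?K (leading_rows d ws)))"
      have Hv: "H v = (\<Sum>ws\<in>top. F ws / ?K (leading_rows d ws) ws * ?K (leading_rows d ws) v)" for v
        by (simp add: H_def sum_fun_apply cscale_def)
      have HS: "H \<in> ?S"
        unfolding H_def
      proof (intro cfun.span_sum cfun.span_scale cfun.span_base imageI)
        fix ws assume "ws \<in> top"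
        then show "leading_rows d ws \<in> row_lists d N ls"
          using lead(1) tensor_kernel_support[OF sh] by blast
      qed
      have HU: "H \<in> unipotent_invariants d k ls"
        unfolding H_def
        by (intro cfun.subspace_sum[OF subspace_unipotent_invariants]
            cfun.subspace_scale[OF subspace_unipotent_invariants] tensor_kernel_unipotent[OF sh])
      have "F - H \<in> unipotent_invariants d k ls"
        by (rule cfun.subspace_diff[OF subspace_unipotent_invariants F HU])
      moreover have "tuple_code d k v < m" if v: "(F - H) v \<noteq> 0" for v
      proof (rule ccontr)
        assume "\<not> tuple_code d k v < m"
        then have ge: "m \<le> tuple_code d k v" by simp
        have zero: "?K (leading_rows d ws) v = 0" if "ws \<in> top" "v \<noteq> ws" for ws
          using lead(2)[OF that(1) that(1), of v] that ge by (auto simp: top_def)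
        have "F v = H v"
        proof (cases "v \<in> top")
          case True
          have "H v = (\<Sum>ws\<in>top. if ws = v then F v else 0)"
            unfolding Hv using zero lead(1) by (intro sum.cong) auto
          then show ?thesis using True fin by simp
        next
          case False
          have "H v = 0" unfolding Hv using zero False by (intro sum.neutral ballI) auto
          moreover have "F v = 0"
            using bound False ge by (auto simp: top_def less_Suc_eq_le)
          ultimately show ?thesis by simp
        qed
        then show False using v by (simp add: fun_diff_def)
      qed
      ultimately have "F - H \<in> ?S" using Suc.IH by blast
      then have "F - H + H \<in> ?S" using HS by (rule cfun.span_add)
      then show "F \<in> ?S" by simp
    qed
  qed
  moreover have "\<exists>m. \<forall>ws. F ws \<noteq> 0 \<longrightarrow> tuple_code d k ws < m"
  proof (intro exI allI impI)
    fix ws assume "F ws \<noteq> 0"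
    then have "ws \<in> index_lists N d k" by (rule unipotent_invariants_support[OF sh F])
    then show "tuple_code d k ws < Suc (Max (tuple_code d k ` index_lists N d k))"
      by (simp add: less_Suc_eq_le)
  qed
  ultimately show ?thesis using F by blast
qed

lemma unipotent_invariants_eq_span:
  assumes "shapes d k N ls"
  shows "unipotent_invariants d k ls = cfun.span (tensor_kernel d k ls ` row_lists d N ls)"
proof
  show "cfun.span (tensor_kernel d k ls ` row_lists d N ls) \<subseteq> unipotent_invariants d k ls"
    using tensor_kernel_unipotent[OF assms]
    by (intro cfun.span_minimal subspace_unipotent_invariants) auto
qed (use unipotent_invariants_span[OF assms] in blast)

section \<open>Weights as letter counts\<close>

lemma prod_nth_count_list:
  fixes g :: "nat \<Rightarrow> complex"
  assumes "set w \<subseteq> {..<k}"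
  shows "(\<Prod>r<length w. g (w ! r)) = (\<Prod>i<k. g i ^ count_list w i)"
  using assms
proof (induction w)
  case (Cons x w)
  have "(\<Prod>i<k. g i ^ count_list (x # w) i) = (\<Prod>i<k. (if i = x then g i else 1) * g i ^ count_list w i)"
    by (intro prod.cong) auto
  also have "\<dots> = g x * (\<Prod>i<k. g i ^ count_list w i)"
    using Cons.prems by (simp add: prod.distrib)
  also have "\<dots> = g x * (\<Prod>r<length w. g (w ! r))" using Cons by simp
  also have "\<dots> = (\<Prod>r<length (x # w). g ((x # w) ! r))"
    by (simp add: prod.lessThan_Suc_shift del: prod.lessThan_Suc)
  finally show ?case by simp
qed simp

lemma gl_act_diag:
  assumes ws: "set ws \<subseteq> basis_index d k"
  shows "gl_act d k (map (\<lambda>j. mat_diag k (a j)) [0..<d]) v ws =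
    (\<Prod>j<d. \<Prod>i<k. a j i ^ count_list (column j ws) i) * v ws"
proof -
  let ?N = "length ws"
  let ?As = "map (\<lambda>j. mat_diag k (a j)) [0..<d]"
  have wsY: "ws \<in> index_lists ?N d k" using ws by (simp add: index_lists_def)
  have "gl_act d k ?As v ws = (\<Sum>us\<in>index_lists ?N d k.
      (\<Prod>j<d. \<Prod>r<?N. ?As ! j $$ (column j ws ! r, column j us ! r)) * v us)"
    by (rule gl_act_index_lists[OF wsY])
  also have "\<dots> = (\<Sum>us\<in>index_lists ?N d k.
      if us = ws then (\<Prod>j<d. \<Prod>r<?N. a j (column j ws ! r)) * v ws else 0)"
  proof (intro sum.cong refl)
    fix us assume us: "us \<in> index_lists ?N d k"
    have entry: "?As ! j $$ (column j ws ! r, column j us ! r) =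
        (if column j ws ! r = column j us ! r then a j (column j us ! r) else 0)" if "j < d" "r < ?N" for j r
      using that basis_index_nth[OF column_basis_index[OF wsY that(1)] that(2)]
        basis_index_nth[OF column_basis_index[OF us that(1)] that(2)] by (simp add: mat_diag_def)
    show "(\<Prod>j<d. \<Prod>r<?N. ?As ! j $$ (column j ws ! r, column j us ! r)) * v us =
      (if us = ws then (\<Prod>j<d. \<Prod>r<?N. a j (column j ws ! r)) * v ws else 0)"
    proof (cases "us = ws")
      case True
      have "(\<Prod>j<d. \<Prod>r<?N. ?As ! j $$ (column j ws ! r, column j us ! r)) =
          (\<Prod>j<d. \<Prod>r<?N. a j (column j ws ! r))"
        using entry True by (intro prod.cong) auto
      then show ?thesis using True by simp
    next
      case False
      have "columns d us \<noteq> columns d ws" using False columns_columns[OF us] columns_columns[OF wsY] by metis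
      then obtain j where j: "j < d" "column j us \<noteq> column j ws" by (auto simp: columns_def)
      then obtain r where r: "r < ?N" "column j ws ! r \<noteq> column j us ! r"
        using index_lists_length[OF us] by (auto simp: list_eq_iff_nth_eq)
      have "(\<Prod>r<?N. ?As ! j $$ (column j ws ! r, column j us ! r)) = 0"
        using entry[OF j(1) r(1)] r by (intro prod_zero) auto
      then have "(\<Prod>j<d. \<Prod>r<?N. ?As ! j $$ (column j ws ! r, column j us ! r)) = 0"
        using j(1) by (intro prod_zero) auto
      then show ?thesis using False by simp
    qed
  qed
  also have "\<dots> = (\<Prod>j<d. \<Prod>r<?N. a j (column j ws ! r)) * v ws"
    using wsY by simp
  also have "(\<Prod>j<d. \<Prod>r<?N. a j (column j ws ! r)) =
      (\<Prod>j<d. \<Prod>i<k. a j i ^ count_list (column j ws) i)"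
  proof (rule prod.cong[OF refl])
    fix j assume "j \<in> {..<d}"
    then have "set (column j ws) \<subseteq> {..<k}"
      using column_basis_index[OF wsY] by (auto simp: basis_index_def)
    from prod_nth_count_list[OF this, of "a j"]
    show "(\<Prod>r<?N. a j (column j ws ! r)) = (\<Prod>i<k. a j i ^ count_list (column j ws) i)" by simp
  qed
  finally show ?thesis .
qed

lemma weight_vector_iff:
  "weight_vector d k \<mu> v \<longleftrightarrow> v \<in> ext_alg d k \<and>
    (\<forall>ws. v ws \<noteq> 0 \<longrightarrow> (\<forall>j<d. \<forall>i<k. int (count_list (column j ws) i) = \<mu> j i))"
proof (intro iffI conjI allI impI)
  assume w: "weight_vector d k \<mu> v"
  then show v: "v \<in> ext_alg d k" by (simp add: weight_vector_def)
  fix ws j i assume ne: "v ws \<noteq> 0" and j: "j < d" and i: "i < k"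
  \<comment> \<open>Diagonal matrices whose entries are 1 except for a single 2; powers of 2
    separate the exponents.\<close>
  define a :: "nat \<Rightarrow> nat \<Rightarrow> complex" where "a = (\<lambda>j' i'. if j' = j \<and> i' = i then 2 else 1)"
  have ws: "set ws \<subseteq> basis_index d k" using v ne by (auto simp: ext_alg_def)
  have single: "(\<Prod>j'<d. \<Prod>i'<k. if j' = j \<and> i' = i then c else 1) = c" for c :: complex
  proof -
    have "(\<Prod>j'<d. \<Prod>i'<k. if j' = j \<and> i' = i then c else 1) = (\<Prod>j'<d. if j' = j then c else 1)"
      using i by (intro prod.cong refl) auto
    then show ?thesis using j by simp
  qed
  have "gl_act d k (map (\<lambda>j. mat_diag k (a j)) [0..<d]) v = cscale (\<Prod>j<d. \<Prod>i<k. a j i powi \<mu> j i) v"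
    using w by (auto simp: weight_vector_def a_def)
  then have "(\<Prod>j<d. \<Prod>i<k. a j i ^ count_list (column j ws) i) * v ws =
      (\<Prod>j<d. \<Prod>i<k. a j i powi \<mu> j i) * v ws"
    unfolding gl_act_diag[OF ws, of a v, symmetric] by (simp only: cscale_def)
  then have "(\<Prod>j<d. \<Prod>i<k. a j i ^ count_list (column j ws) i) = (\<Prod>j<d. \<Prod>i<k. a j i powi \<mu> j i)"
    using ne by simp
  also have "(\<Prod>j<d. \<Prod>i<k. a j i ^ count_list (column j ws) i) =
      (\<Prod>j'<d. \<Prod>i'<k. if j' = j \<and> i' = i then 2 ^ count_list (column j ws) i else 1)"
    by (intro prod.cong refl) (auto simp: a_def)
  also have "\<dots> = 2 ^ count_list (column j ws) i" by (rule single)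
  also have "(\<Prod>j<d. \<Prod>i<k. a j i powi \<mu> j i) =
      (\<Prod>j'<d. \<Prod>i'<k. if j' = j \<and> i' = i then 2 powi \<mu> j i else 1)"
    by (intro prod.cong refl) (auto simp: a_def)
  also have "\<dots> = 2 powi \<mu> j i" by (rule single)
  finally have "(2::complex) powi int (count_list (column j ws) i) = 2 powi \<mu> j i"
    by (simp add: power_int_of_nat)
  \<comment> \<open>Absolute values lead to real powers of 2, which are strictly increasing in the
    exponent.\<close>
  then have "cmod (2 powi int (count_list (column j ws) i)) = cmod (2 powi \<mu> j i)" by simp
  then have "(2::real) powi int (count_list (column j ws) i) = 2 powi \<mu> j i"
    unfolding norm_power_int by simp
  then show "int (count_list (column j ws) i) = \<mu> j i"
    using power_int_strict_increasing[of _ _ "2::real"] by (metis less_irrefl linorder_neqE_linordered_idom one_less_numeral_iff semiring_norm(76))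
next
  assume v: "v \<in> ext_alg d k \<and>
    (\<forall>ws. v ws \<noteq> 0 \<longrightarrow> (\<forall>j<d. \<forall>i<k. int (count_list (column j ws) i) = \<mu> j i))"
  have "gl_act d k (map (\<lambda>j. mat_diag k (a j)) [0..<d]) v ws = (\<Prod>j<d. \<Prod>i<k. a j i powi \<mu> j i) * v ws"
    for a ws
  proof (cases "v ws = 0")
    case True
    then show ?thesis using gl_act_diag[of ws d k a v] by (cases "set ws \<subseteq> basis_index d k") (auto simp: gl_act_outside)
  next
    case False
    then have "set ws \<subseteq> basis_index d k" using v by (auto simp: ext_alg_def)
    moreover have "(\<Prod>j<d. \<Prod>i<k. a j i ^ count_list (column j ws) i) = (\<Prod>j<d. \<Prod>i<k. a j i powi \<mu> j i)"
      using v False by (intro prod.cong refl) (auto simp flip: power_int_of_nat)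
    ultimately show ?thesis by (simp add: gl_act_diag)
  qed
  then show "weight_vector d k \<mu> v"
    using v by (auto simp: weight_vector_def fun_eq_iff cscale_def)
qed

lemma HWV_eq:
  assumes sh: "shapes d k N ls"
  shows "HWV d k (padded_weight (map conjugate ls)) = unipotent_invariants d k ls \<inter> ext_alg d k"
proof -
  have wt: "padded_weight (map conjugate ls) j i = int (content (ls ! j) i)" if "j < d" for j i
    using that sh nth_default_conjugate[OF shapesD(1)[OF sh that]]
    by (simp add: padded_weight_def shapes_def)
  have zero: "0 \<in> unipotent_invariants d k ls \<inter> ext_alg d k"
    using cfun.subspace_0[OF subspace_unipotent_invariants] by (auto simp: ext_alg_def)
  have "highest_weight_vector d k (padded_weight (map conjugate ls)) v \<longleftrightarrow>
      v \<noteq> 0 \<and> v \<in> unipotent_invariants d k ls \<inter> ext_alg d k" for v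
    unfolding highest_weight_vector_def weight_vector_iff unipotent_invariants_def
    by (auto simp: wt ext_alg_def)
  then show ?thesis using zero unfolding HWV_def by auto
qed

section \<open>Kronecker coefficients as dimensions\<close>

lemma map_permute_list_index_lists:
  assumes \<sigma>: "\<sigma> permutes {..<N}"
  shows "map (permute_list \<sigma>) ss \<in> index_lists d N k \<longleftrightarrow> ss \<in> index_lists d N k"
proof -
  have "permute_list \<sigma> s \<in> basis_index N k \<longleftrightarrow> s \<in> basis_index N k" for s
    using \<sigma> set_permute_list[of \<sigma> s] by (auto simp: basis_index_def)
  then show ?thesis by (auto simp: index_lists_def)
qed

lemma map_permute_list_inverse:
  assumes \<sigma>: "\<sigma> permutes {..<N}" and ss: "ss \<in> index_lists d N k"
  shows "map (permute_list (inv_into UNIV \<sigma>)) (map (permute_list \<sigma>) ss) = ss"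
    "map (permute_list \<sigma>) (map (permute_list (inv_into UNIV \<sigma>)) ss) = ss"
proof -
  have "length s = N" if "s \<in> set ss" for s
    using ss that by (auto simp: index_lists_def basis_index_def)
  then show "map (permute_list (inv_into UNIV \<sigma>)) (map (permute_list \<sigma>) ss) = ss"
    "map (permute_list \<sigma>) (map (permute_list (inv_into UNIV \<sigma>)) ss) = ss"
    using \<sigma> by (auto intro!: map_idI simp: permute_list_inverse)
qed

lemma bij_betw_map_permute_list:
  assumes \<sigma>: "\<sigma> permutes {..<N}"
  shows "bij_betw (map (permute_list \<sigma>)) (index_lists d N k) (index_lists d N k)"
  using map_permute_list_index_lists[OF \<sigma>] map_permute_list_index_lists[OF permutes_inv[OF \<sigma>]]
    map_permute_list_inverse[OF \<sigma>]
  by (intro bij_betw_byWitness[where f' = "map (permute_list (inv_into UNIV \<sigma>))"]) auto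

lemma linear_diagonal_act: "Vector_Spaces.linear cscale cscale (diagonal_act \<sigma>)"
  unfolding Vector_Spaces.linear_iff
  by (auto simp: diagonal_act_def cscale_def fun_eq_iff intro: cfun.vector_space_axioms)

lemma unitary_diagonal_act: "unitary_act N (index_lists d N k) diagonal_act"
  unfolding unitary_act_def
proof (intro allI impI conjI ballI)
  fix \<sigma> assume \<sigma>: "\<sigma> permutes {..<N}"
  let ?X = "index_lists d N k"
  show "Vector_Spaces.linear cscale cscale (diagonal_act \<sigma>)" by (rule linear_diagonal_act)
  show "inner_on ?X (diagonal_act \<sigma> f) (diagonal_act \<sigma> g) = inner_on ?X f g" for f g
    unfolding inner_on_def diagonal_act_def
    by (rule sum.reindex_bij_betw[OF bij_betw_map_permute_list[OF \<sigma>], of "\<lambda>ss. f ss * cnj (g ss)"])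
  fix f assume f: "f \<in> supported_on ?X"
  show "diagonal_act \<sigma> (diagonal_act (inv_into UNIV \<sigma>) f) = f"
  proof
    fix ss
    show "diagonal_act \<sigma> (diagonal_act (inv_into UNIV \<sigma>) f) ss = f ss"
    proof (cases "ss \<in> ?X")
      case True
      then show ?thesis using map_permute_list_inverse(1)[OF \<sigma> True] by (simp add: diagonal_act_def)
    next
      case False
      then have "map (permute_list (inv_into UNIV \<sigma>)) (map (permute_list \<sigma>) ss) \<notin> ?X"
        using map_permute_list_index_lists[OF \<sigma>] map_permute_list_index_lists[OF permutes_inv[OF \<sigma>]] by blast
      then show ?thesis using False supported_onD[OF f] by (simp add: diagonal_act_def)
    qed
  qed
qed

lemma permute_list_index_lists:
  assumes "\<sigma> permutes {..<length ws}"
  shows "permute_list \<sigma> ws \<in> index_lists N d k \<longleftrightarrow> ws \<in> index_lists N d k"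
  using assms by (simp add: index_lists_def)

lemma column_permute_list:
  assumes "\<sigma> permutes {..<length ws}"
  shows "column j (permute_list \<sigma> ws) = permute_list \<sigma> (column j ws)"
  using assms by (simp add: column_def permute_list_map)

text \<open>Each of the \<open>d\<close> factors contributes the sign of \<open>\<sigma>\<close>, and \<open>d\<close> is odd.\<close>

lemma tensor_kernel_permute:
  assumes sh: "shapes d k N ls" and odd: "odd d" and \<sigma>: "\<sigma> permutes {..<N}"
    and ss: "ss \<in> row_lists d N ls" and ws: "ws \<in> index_lists N d k"
  shows "tensor_kernel d k ls (map (permute_list \<sigma>) ss) (permute_list \<sigma> ws) =
    of_int (sign \<sigma>) * tensor_kernel d k ls ss ws"
proof -
  have \<sigma>': "\<sigma> permutes {..<length ws}" using \<sigma> ws by (simp add: index_lists_length)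
  have len: "length ss = d" using ss by (simp add: row_lists_def index_lists_length)
  have "tab_kernel (ls ! j) (map (permute_list \<sigma>) ss ! j) (column j (permute_list \<sigma> ws)) =
      of_int (sign \<sigma>) * tab_kernel (ls ! j) (ss ! j) (column j ws)" if j: "j < d" for j
  proof -
    have "length (ss ! j) = N"
      using ss j index_lists_nth basis_index_length unfolding row_lists_def by blast
    then show ?thesis
      using j len \<sigma> shapesD(2)[OF sh j] ws
      by (simp add: column_permute_list[OF \<sigma>'] tab_kernel_permute_list index_lists_length)
  qed
  then have "(\<Prod>j<d. tab_kernel (ls ! j) (map (permute_list \<sigma>) ss ! j) (column j (permute_list \<sigma> ws))) =
      (of_int (sign \<sigma>)) ^ d * (\<Prod>j<d. tab_kernel (ls ! j) (ss ! j) (column j ws))"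
    by (simp add: prod.distrib)
  moreover have "(of_int (sign \<sigma>) :: complex) ^ d = of_int (sign \<sigma>)"
    using odd by (cases \<sigma> rule: sign_cases) auto
  ultimately show ?thesis
    using ws len set_permute_list[OF \<sigma>'] by (simp add: tensor_kernel_def index_lists_def)
qed

text \<open>Reindexing the sum by permuted row words moves the permutation from \<open>ws\<close> to
  \<open>G\<close> at the cost of its sign, so invariance of \<open>G\<close> becomes alternation of
  its image.\<close>

lemma kernel_map_permute:
  assumes sh: "shapes d k N ls" and odd: "odd d" and \<sigma>: "\<sigma> permutes {..<N}"
    and ws: "ws \<in> index_lists N d k"
  shows "kernel_map (row_lists d N ls) (tensor_kernel d k ls) G (permute_list \<sigma> ws) =
    of_int (sign \<sigma>) * kernel_map (row_lists d N ls) (tensor_kernel d k ls) (diagonal_act \<sigma> G) ws"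
proof -
  let ?X = "row_lists d N ls" and ?K = "tensor_kernel d k ls"
  have "kernel_map ?X ?K G (permute_list \<sigma> ws) =
      (\<Sum>ss\<in>?X. ?K (map (permute_list \<sigma>) ss) (permute_list \<sigma> ws) * G (map (permute_list \<sigma>) ss))"
    unfolding kernel_map_def row_lists_def
    by (rule sum.reindex_bij_betw[OF bij_betw_map_permute_list[OF \<sigma>], symmetric])
  also have "\<dots> = (\<Sum>ss\<in>?X. of_int (sign \<sigma>) * (?K ss ws * diagonal_act \<sigma> G ss))"
    using tensor_kernel_permute[OF sh odd \<sigma> _ ws] by (intro sum.cong refl) (simp add: diagonal_act_def)
  finally show ?thesis by (simp add: kernel_map_def sum_distrib_left)
qed

lemma subrep_tensor_space:
  assumes sh: "shapes d k N ls" and odd: "odd d"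
  shows "subrep N diagonal_act (tensor_space (map specht ls))"
  unfolding subrep_def
proof (intro conjI allI impI)
  let ?W = "tensor_space (map specht ls)" and ?K = "tensor_kernel d k ls"
  let ?T = "(\<lambda>ws ss. ?K ss ws) ` index_lists N d k"
  have W: "?W = cfun.span ?T" by (rule tensor_space_specht[OF sh])
  show "cfun.subspace ?W" unfolding W by simp
  fix \<sigma> assume \<sigma>: "\<sigma> permutes {..<N}"
  have gen: "diagonal_act \<sigma> f \<in> cfun.span ?T" if f: "f \<in> ?T" for f
  proof -
    obtain ws where ws: "ws \<in> index_lists N d k" and f: "f = (\<lambda>ss. ?K ss ws)" using f by blast
    \<comment> \<open>\<open>diagonal_act \<sigma>\<close> precomposes with
      \<open>permute_list \<sigma>\<close> on the row words. Pulling the same permutation out of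
      \<open>ws\<close> leaves the inverse one on the column index.\<close>
    let ?w = "permute_list (inv_into UNIV \<sigma>) ws"
    have len: "length ws = N" using ws by (rule index_lists_length)
    have w: "?w \<in> index_lists N d k"
      using permute_list_index_lists[of "inv_into UNIV \<sigma>" ws] permutes_inv[OF \<sigma>] ws len by simp
    have "permute_list \<sigma> ?w = ws" using \<sigma> len by (simp add: permute_list_inverse)
    have "diagonal_act \<sigma> f ss = of_int (sign \<sigma>) * ?K ss ?w" for ss
    proof (cases "ss \<in> row_lists d N ls")
      case True
      then show ?thesis
        using tensor_kernel_permute[OF sh odd \<sigma> True w] \<open>permute_list \<sigma> ?w = ws\<close>
        by (simp add: f diagonal_act_def)
    next
      case False
      then have "map (permute_list \<sigma>) ss \<notin> row_lists d N ls"
        unfolding row_lists_def using map_permute_list_index_lists[OF \<sigma>] by simp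
      then show ?thesis
        using False tensor_kernel_support[OF sh] unfolding f diagonal_act_def by (metis mult_zero_right)
    qed
    then have "diagonal_act \<sigma> f = cscale (of_int (sign \<sigma>)) (\<lambda>ss. ?K ss ?w)"
      by (simp add: cscale_def fun_eq_iff)
    moreover have "(\<lambda>ss. ?K ss ?w) \<in> ?T" using w by (rule imageI)
    ultimately show ?thesis by (simp add: cfun.span_scale cfun.span_base)
  qed
  have "diagonal_act \<sigma> ` cfun.span ?T = cfun.span (diagonal_act \<sigma> ` ?T)"
    by (rule cpair.linear_span_image[OF linear_diagonal_act, symmetric])
  also have "\<dots> \<subseteq> cfun.span ?T" using gen by (intro cfun.span_minimal) auto
  finally show "diagonal_act \<sigma> ` ?W \<subseteq> ?W" unfolding W .
qed

lemma tensor_space_support: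
  assumes sh: "shapes d k N ls"
  shows "tensor_space (map specht ls) \<subseteq> supported_on (row_lists d N ls)"
  unfolding tensor_space_specht[OF sh] using tensor_kernel_support[OF sh]
  by (intro cfun.span_minimal subspace_supported_on) (auto simp: supported_on_def)

text \<open>The isomorphism commutes with permutations up to sign. One direction reads this off
  directly; in the other, injectivity carries the alternation of \<open>F\<close> back to the
  invariance of its preimage.\<close>

lemma bij_betw_invariants_HWV:
  assumes sh: "shapes d k N ls" and odd: "odd d"
  shows "bij_betw (kernel_map (row_lists d N ls) (tensor_kernel d k ls))
    (invariants N diagonal_act (tensor_space (map specht ls)))
    (HWV d k (padded_weight (map conjugate ls)))"
proof -
  let ?X = "row_lists d N ls" and ?K = "tensor_kernel d k ls" and ?Y = "index_lists N d k"
  let ?\<Phi> = "kernel_map ?X ?K" and ?W = "tensor_space (map specht ls)"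
  let ?H = "HWV d k (padded_weight (map conjugate ls))"
  have bij: "bij_betw ?\<Phi> ?W (unipotent_invariants d k ls)"
    unfolding tensor_space_specht[OF sh] unipotent_invariants_eq_span[OF sh]
    using tensor_kernel_support[OF sh] by (intro bij_betw_kernel_map) (auto simp: cnj_tensor_kernel)
  have supp: "?\<Phi> G ws = 0" if "ws \<notin> ?Y" for G ws
  proof -
    have "?K ss ws = 0" for ss using tensor_kernel_support[OF sh] that by blast
    then show ?thesis by (simp add: kernel_map_def)
  qed
  have "?\<Phi> ` invariants N diagonal_act ?W = ?H"
  proof (intro equalityI subsetI)
    fix F assume "F \<in> ?\<Phi> ` invariants N diagonal_act ?W"
    then obtain G where G: "G \<in> invariants N diagonal_act ?W" and F: "F = ?\<Phi> G" by blast
    have "F \<in> ext_alg d k"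
      unfolding ext_alg_def
    proof (intro CollectI conjI allI impI)
      fix ws
      show "set ws \<subseteq> basis_index d k" if "F ws \<noteq> 0"
        using that supp[of ws G] F by (auto simp: index_lists_def)
      fix \<sigma> assume \<sigma>: "\<sigma> permutes {..<length ws}"
      show "F (permute_list \<sigma> ws) = of_int (sign \<sigma>) * F ws"
      proof (cases "ws \<in> ?Y")
        case True
        then have "\<sigma> permutes {..<N}" using \<sigma> by (simp add: index_lists_length)
        then show ?thesis
          using kernel_map_permute[OF sh odd _ True, of \<sigma> G] G F by (simp add: invariants_def)
      next
        case False
        then show ?thesis using supp F permute_list_index_lists[OF \<sigma>] by simp
      qed
    qed
    moreover have "F \<in> unipotent_invariants d k ls"
      using bij G F by (auto simp: bij_betw_def invariants_def)
    ultimately show "F \<in> ?H" by (simp add: HWV_eq[OF sh])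
  next
    fix F assume "F \<in> ?H"
    then have F: "F \<in> unipotent_invariants d k ls" "F \<in> ext_alg d k" by (auto simp: HWV_eq[OF sh])
    then obtain G where G: "G \<in> ?W" "F = ?\<Phi> G" using bij by (auto simp: bij_betw_def)
    have "diagonal_act \<sigma> G = G" if \<sigma>: "\<sigma> permutes {..<N}" for \<sigma>
    proof -
      have "?\<Phi> (diagonal_act \<sigma> G) ws = ?\<Phi> G ws" for ws
      proof (cases "ws \<in> ?Y")
        case True
        then have "F (permute_list \<sigma> ws) = of_int (sign \<sigma>) * F ws"
          using F(2) \<sigma> by (simp add: ext_alg_def index_lists_length)
        then have "of_int (sign \<sigma>) * ?\<Phi> (diagonal_act \<sigma> G) ws = of_int (sign \<sigma>) * ?\<Phi> G ws"
          using kernel_map_permute[OF sh odd \<sigma> True, of G] G(2) by simp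
        then show ?thesis by simp
      next
        case False
        then show ?thesis by (simp add: supp)
      qed
      then have eq: "?\<Phi> (diagonal_act \<sigma> G) = ?\<Phi> G" by blast
      have "diagonal_act \<sigma> G \<in> ?W"
        using subrep_tensor_space[OF sh odd] \<sigma> G(1) unfolding subrep_def by blast
      then show ?thesis
        using bij_betw_imp_inj_on[OF bij] eq G(1) unfolding inj_on_def by blast
    qed
    then have "G \<in> invariants N diagonal_act ?W" using G(1) by (simp add: invariants_def)
    then show "F \<in> ?\<Phi> ` invariants N diagonal_act ?W" using G(2) by blast
  qed
  moreover have "inj_on ?\<Phi> (invariants N diagonal_act ?W)"
    using bij_betw_imp_inj_on[OF bij] by (rule inj_on_subset) (auto simp: invariants_def)
  ultimately show ?thesis by (simp add: bij_betw_def)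
qed

lemma subspace_invariants:
  assumes "cfun.subspace W" "\<And>\<sigma>. \<sigma> permutes {..<N} \<Longrightarrow> Vector_Spaces.linear cscale cscale (act \<sigma>)"
  shows "cfun.subspace (invariants N act W)"
  unfolding cfun.subspace_def
proof (intro conjI ballI allI)
  show "0 \<in> invariants N act W"
    using cfun.subspace_0[OF assms(1)] cpair.linear_0[OF assms(2)] by (auto simp: invariants_def)
  show "x + y \<in> invariants N act W" if "x \<in> invariants N act W" "y \<in> invariants N act W" for x y
    using that cfun.subspace_add[OF assms(1)] cpair.linear_add[OF assms(2)]
    unfolding invariants_def by simp
  show "cscale c x \<in> invariants N act W" if "x \<in> invariants N act W" for c x
    using that cfun.subspace_scale[OF assms(1)] cpair.linear_scale[OF assms(2)]
    unfolding invariants_def by simp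
qed

lemma HWV_support:
  assumes "shapes d k N ls"
  shows "HWV d k (padded_weight (map conjugate ls)) \<subseteq> supported_on (index_lists N d k)"
  unfolding HWV_eq[OF assms] using unipotent_invariants_support[OF assms]
  by (auto simp: supported_on_def)

lemma subspace_ext_alg: "cfun.subspace (ext_alg d k)"
  unfolding cfun.subspace_def
proof (intro conjI ballI allI)
  show "0 \<in> ext_alg d k" by (simp add: ext_alg_def)
  show "f + g \<in> ext_alg d k" if "f \<in> ext_alg d k" "g \<in> ext_alg d k" for f g
  proof -
    have "f ws \<noteq> 0 \<or> g ws \<noteq> 0" if "(f + g) ws \<noteq> 0" for ws using that by auto
    then show ?thesis using that unfolding ext_alg_def by (simp add: algebra_simps) blast
  qed
  show "cscale c f \<in> ext_alg d k" if "f \<in> ext_alg d k" for c f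
    using that unfolding ext_alg_def by (auto simp: cscale_def)
qed

lemma subspace_HWV:
  assumes "shapes d k N ls"
  shows "cfun.subspace (HWV d k (padded_weight (map conjugate ls)))"
  unfolding HWV_eq[OF assms]
  by (intro cfun.subspace_inter subspace_unipotent_invariants subspace_ext_alg)

lemma kronecker_eq_dim_HWV:
  assumes sh: "shapes d k N ls" and odd: "odd d"
  shows "kronecker ls = cfun.dim (HWV d k (padded_weight (map conjugate ls)))"
proof -
  let ?W = "tensor_space (map specht ls)" and ?X = "row_lists d N ls"
  have N: "sum_list (hd ls) = N"
    using sh shapesD(2)[OF sh, of 0] hd_conv_nth[of ls] by (auto simp: shapes_def)
  have W: "?W \<subseteq> supported_on ?X" by (rule tensor_space_support[OF sh])
  have inv: "cfun.subspace (invariants N diagonal_act ?W)"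
    using subrep_tensor_space[OF sh odd]
    by (intro subspace_invariants linear_diagonal_act) (simp add: subrep_def)
  have "kronecker ls = cfun.dim (invariants N diagonal_act ?W)"
    unfolding kronecker_def N
    using unitary_diagonal_act[of N d "sum_list (map length ls)"] subrep_tensor_space[OF sh odd] W
    by (intro rep_multiplicity_trivial[where X = ?X]) (simp_all add: row_lists_def)
  also have "\<dots> = cfun.dim (HWV d k (padded_weight (map conjugate ls)))"
    using W by (intro dim_eq_of_bij[OF linear_kernel_map inv bij_betw_invariants_HWV[OF sh odd],
          where X = ?X and Y = "index_lists N d k"] HWV_support[OF sh]) (auto simp: invariants_def)
  finally show ?thesis .
qed

section \<open>Wedge products\<close>

lemma wedge_nonzero_set:
  assumes "wedge f g ws \<noteq> 0" and "\<And>us. f us \<noteq> 0 \<Longrightarrow> set us \<subseteq> B" "\<And>us. g us \<noteq> 0 \<Longrightarrow> set us \<subseteq> B"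
  shows "set ws \<subseteq> B"
proof (rule ccontr)
  assume not: "\<not> set ws \<subseteq> B"
  have "f (take p (permute_list \<sigma> ws)) * g (drop p (permute_list \<sigma> ws)) = 0"
    if "\<sigma> permutes {..<length ws}" for p \<sigma>
  proof (rule ccontr)
    assume "f (take p (permute_list \<sigma> ws)) * g (drop p (permute_list \<sigma> ws)) \<noteq> 0"
    then have "set (take p (permute_list \<sigma> ws)) \<union> set (drop p (permute_list \<sigma> ws)) \<subseteq> B"
      using assms(2,3) by simp
    then have "set (permute_list \<sigma> ws) \<subseteq> B" by (metis append_take_drop_id set_append)
    then show False using not set_permute_list[OF that] by simp
  qed
  then have "wedge f g ws = 0"
    unfolding wedge_def by (intro sum.neutral ballI) (auto simp: mult.assoc intro!: sum.neutral)
  then show False using assms(1) by simp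
qed

text \<open>This holds for arbitrary \<open>f\<close> and \<open>g\<close>, because the signed sum
  over all permutations in \<open>wedge\<close> antisymmetrises by itself.\<close>

lemma wedge_permute_list:
  assumes \<tau>: "\<tau> permutes {..<length ws}"
  shows "wedge f g (permute_list \<tau> ws) = of_int (sign \<tau>) * wedge f g ws"
proof -
  let ?S = "{\<sigma>. \<sigma> permutes {..<length ws}}"
  let ?h = "\<lambda>p \<sigma>. f (take p (permute_list \<sigma> ws)) * g (drop p (permute_list \<sigma> ws))"
  have "(\<Sum>\<sigma>\<in>?S. of_int (sign \<sigma>) * f (take p (permute_list \<sigma> (permute_list \<tau> ws))) *
      g (drop p (permute_list \<sigma> (permute_list \<tau> ws)))) =
    of_int (sign \<tau>) * (\<Sum>\<sigma>\<in>?S. of_int (sign \<sigma>) * f (take p (permute_list \<sigma> ws)) *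
      g (drop p (permute_list \<sigma> ws)))" for p
  proof -
    have "(\<Sum>\<sigma>\<in>?S. of_int (sign \<sigma>) * f (take p (permute_list \<sigma> (permute_list \<tau> ws))) *
        g (drop p (permute_list \<sigma> (permute_list \<tau> ws)))) =
      (\<Sum>\<sigma>\<in>?S. of_int (sign \<tau>) * (of_int (sign (\<tau> \<circ> \<sigma>)) * ?h p (\<tau> \<circ> \<sigma>)))"
    proof (intro sum.cong refl)
      fix \<sigma> assume "\<sigma> \<in> ?S"
      then have \<sigma>: "\<sigma> permutes {..<length ws}" by simp
      have "of_int (sign \<tau>) * (of_int (sign (\<tau> \<circ> \<sigma>)) :: complex) = of_int (sign \<sigma>)"
        by (simp add: sign_compose_permutes[OF finite_lessThan \<tau> \<sigma>] flip: of_int_mult mult.assoc)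
      then show "of_int (sign \<sigma>) * f (take p (permute_list \<sigma> (permute_list \<tau> ws))) *
        g (drop p (permute_list \<sigma> (permute_list \<tau> ws))) =
        of_int (sign \<tau>) * (of_int (sign (\<tau> \<circ> \<sigma>)) * ?h p (\<tau> \<circ> \<sigma>))"
        unfolding permute_list_compose[OF \<sigma>, of \<tau>] by (simp flip: mult.assoc)
    qed
    also have "\<dots> = of_int (sign \<tau>) * (\<Sum>\<sigma>\<in>?S. of_int (sign (\<tau> \<circ> \<sigma>)) * ?h p (\<tau> \<circ> \<sigma>))"
      by (rule sum_distrib_left[symmetric])
    also have "(\<Sum>\<sigma>\<in>?S. of_int (sign (\<tau> \<circ> \<sigma>)) * ?h p (\<tau> \<circ> \<sigma>)) = (\<Sum>\<sigma>\<in>?S. of_int (sign \<sigma>) * ?h p \<sigma>)"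
      by (rule setum_permutations_compose_left[OF \<tau>, symmetric])
    finally show ?thesis by (simp add: mult.assoc)
  qed
  then show ?thesis
    unfolding wedge_def length_permute_list by (simp add: sum_distrib_left mult.left_commute)
qed

lemma wedge_ext_alg:
  assumes "f \<in> ext_alg d k" "g \<in> ext_alg d k"
  shows "wedge f g \<in> ext_alg d k"
  unfolding ext_alg_def
proof (intro CollectI conjI allI impI)
  fix ws
  show "set ws \<subseteq> basis_index d k" if "wedge f g ws \<noteq> 0"
    using that assms by (intro wedge_nonzero_set[OF that]) (auto simp: ext_alg_def)
  show "wedge f g (permute_list \<sigma> ws) = of_int (sign \<sigma>) * wedge f g ws"
    if "\<sigma> permutes {..<length ws}" for \<sigma> using that by (rule wedge_permute_list)
qed

lemma linear_wedge: "Vector_Spaces.linear cscale cscale (wedge f)"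
  unfolding Vector_Spaces.linear_iff
proof (intro conjI allI cfun.vector_space_axioms)
  show "wedge f (g + h) = wedge f g + wedge f h" for g h
    by (auto simp: wedge_def fun_eq_iff ring_distribs sum.distrib)
  show "wedge f (cscale c g) = cscale c (wedge f g)" for c g
    by (auto simp: wedge_def fun_eq_iff cscale_def sum_distrib_left mult_ac)
qed

lemma wedge_cscale_left: "wedge (cscale c f) g = cscale c (wedge f g)"
  by (auto simp: wedge_def fun_eq_iff cscale_def sum_distrib_left mult_ac)

section \<open>Equivariance of the wedge product\<close>

lemma gl_act_eq:
  assumes "set ws \<subseteq> basis_index d k"
  shows "gl_act d k As f ws = (\<Sum>us\<in>index_lists (length ws) d k.
    (\<Prod>r<length ws. \<Prod>j<d. As ! j $$ (ws ! r ! j, us ! r ! j)) * f us)"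
  using assms by (simp add: gl_act_def index_lists_def)

lemma prod_lessThan_add:
  fixes h :: "nat \<Rightarrow> complex"
  shows "(\<Prod>r<p + q. h r) = (\<Prod>r<p. h r) * (\<Prod>r<q. h (p + r))"
  by (induction q) (simp_all add: mult.assoc)

lemma bij_betw_append_index_lists:
  "bij_betw (\<lambda>(u, v). u @ v) (index_lists p d k \<times> index_lists q d k) (index_lists (p + q) d k)"
  by (rule bij_betw_byWitness[where f' = "\<lambda>w. (take p w, drop p w)"])
    (auto simp: index_lists_def dest: in_set_takeD in_set_dropD)

text \<open>The matrix of a tensor power is a product over positions, so cutting words at
  \<open>p\<close> splits both the sum and the product.\<close>

lemma gl_act_split:
  assumes ws: "set ws \<subseteq> basis_index d k" and p: "p \<le> length ws"
  shows "(\<Sum>us\<in>index_lists (length ws) d k.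
      (\<Prod>r<length ws. \<Prod>j<d. As ! j $$ (ws ! r ! j, us ! r ! j)) * (f (take p us) * g (drop p us))) =
    gl_act d k As f (take p ws) * gl_act d k As g (drop p ws)"
proof -
  let ?q = "length ws - p"
  let ?m = "\<lambda>w u. \<Prod>j<d. As ! j $$ (w ! j, u ! j)"
  let ?Yp = "index_lists p d k" and ?Yq = "index_lists ?q d k"
  have n: "length ws = p + ?q" using p by simp
  have sets: "set (take p ws) \<subseteq> basis_index d k" "set (drop p ws) \<subseteq> basis_index d k"
    using order_trans[OF set_take_subset ws] order_trans[OF set_drop_subset ws] .
  have "(\<Sum>us\<in>index_lists (length ws) d k. (\<Prod>r<length ws. ?m (ws ! r) (us ! r)) * (f (take p us) * g (drop p us))) =
    (\<Sum>us\<in>index_lists (p + ?q) d k. (\<Prod>r<p + ?q. ?m (ws ! r) (us ! r)) * (f (take p us) * g (drop p us)))"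
    using n by simp
  also have "\<dots> = (\<Sum>x\<in>?Yp \<times> ?Yq. (\<Prod>r<p + ?q. ?m (ws ! r) ((case x of (u, v) \<Rightarrow> u @ v) ! r)) *
      (f (take p (case x of (u, v) \<Rightarrow> u @ v)) * g (drop p (case x of (u, v) \<Rightarrow> u @ v))))"
    by (rule sum.reindex_bij_betw[OF bij_betw_append_index_lists, symmetric])
  also have "\<dots> = (\<Sum>(u, v)\<in>?Yp \<times> ?Yq. ((\<Prod>r<p. ?m (take p ws ! r) (u ! r)) * f u) *
      ((\<Prod>r<?q. ?m (drop p ws ! r) (v ! r)) * g v))"
  proof (intro sum.cong refl, clarify)
    fix u v assume u: "u \<in> ?Yp" and v: "v \<in> ?Yq"
    have "(\<Prod>r<p + ?q. ?m (ws ! r) ((u @ v) ! r)) =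
        (\<Prod>r<p. ?m (ws ! r) ((u @ v) ! r)) * (\<Prod>r<?q. ?m (ws ! (p + r)) ((u @ v) ! (p + r)))"
      by (rule prod_lessThan_add)
    also have "(\<Prod>r<p. ?m (ws ! r) ((u @ v) ! r)) = (\<Prod>r<p. ?m (take p ws ! r) (u ! r))"
      using u by (intro prod.cong refl) (simp add: nth_append index_lists_length)
    also have "(\<Prod>r<?q. ?m (ws ! (p + r)) ((u @ v) ! (p + r))) = (\<Prod>r<?q. ?m (drop p ws ! r) (v ! r))"
      using u p by (intro prod.cong refl) (simp add: nth_append index_lists_length)
    finally show "(\<Prod>r<p + ?q. ?m (ws ! r) ((u @ v) ! r)) * (f (take p (u @ v)) * g (drop p (u @ v))) =
      ((\<Prod>r<p. ?m (take p ws ! r) (u ! r)) * f u) * ((\<Prod>r<?q. ?m (drop p ws ! r) (v ! r)) * g v)"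
      using u by (simp add: index_lists_length mult_ac)
  qed
  also have "\<dots> = gl_act d k As f (take p ws) * gl_act d k As g (drop p ws)"
    using p by (simp add: gl_act_eq[OF sets(1)] gl_act_eq[OF sets(2)] sum_product sum.cartesian_product min_absorb2)
  finally show ?thesis .
qed

lemma bij_betw_permute_list_index_lists:
  assumes \<sigma>: "\<sigma> permutes {..<n}"
  shows "bij_betw (permute_list \<sigma>) (index_lists n d k) (index_lists n d k)"
  using \<sigma> permutes_inv[OF \<sigma>]
  by (intro bij_betw_byWitness[where f' = "permute_list (inv_into UNIV \<sigma>)"])
    (auto simp: permute_list_inverse index_lists_length permute_list_index_lists)

text \<open>The same matrices act at every position, so the action commutes with permuting
  positions, and by \<open>gl_act_split\<close> with cutting words. The wedge product is built from
  these two operations.\<close>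

lemma gl_act_wedge:
  assumes f: "f \<in> ext_alg d k" and g: "g \<in> ext_alg d k"
  shows "gl_act d k As (wedge f g) = wedge (gl_act d k As f) (gl_act d k As g)"
proof
  fix ws :: "nat list list"
  let ?n = "length ws"
  let ?S = "{\<sigma>. \<sigma> permutes {..<?n}}"
  let ?M = "\<lambda>ws us. \<Prod>r<?n. \<Prod>j<d. As ! j $$ (ws ! r ! j, us ! r ! j)"
  let ?Y = "index_lists ?n d k"
  let ?c = "\<lambda>p. 1 / (fact p * fact (?n - p)) :: complex"
  let ?t = "\<lambda>p \<sigma> us. f (take p (permute_list \<sigma> us)) * g (drop p (permute_list \<sigma> us))"
  let ?T = "\<lambda>us p \<sigma>. ?c p * of_int (sign \<sigma>) * (?M ws us * ?t p \<sigma> us)"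
  show "gl_act d k As (wedge f g) ws = wedge (gl_act d k As f) (gl_act d k As g) ws"
  proof (cases "set ws \<subseteq> basis_index d k")
    case False
    have "set us \<subseteq> basis_index d k" if "gl_act d k As h us \<noteq> 0" for h us
      using that gl_act_outside by blast
    then have "wedge (gl_act d k As f) (gl_act d k As g) ws = 0"
      using wedge_nonzero_set[of "gl_act d k As f" "gl_act d k As g" ws "basis_index d k"] False by blast
    then show ?thesis using False by (simp add: gl_act_outside)
  next
    case True
    have inner: "(\<Sum>us\<in>?Y. ?M ws us * ?t p \<sigma> us) =
        gl_act d k As f (take p (permute_list \<sigma> ws)) * gl_act d k As g (drop p (permute_list \<sigma> ws))"
      if \<sigma>: "\<sigma> permutes {..<?n}" and p: "p \<le> ?n" for \<sigma> p
    proof -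
      let ?ws = "permute_list \<sigma> ws"
      have ws': "set ?ws \<subseteq> basis_index d k" using set_permute_list[OF \<sigma>] True by simp
      have "(\<Sum>us\<in>?Y. ?M ws us * ?t p \<sigma> us) =
          (\<Sum>us\<in>?Y. ?M ?ws (permute_list \<sigma> us) * ?t p \<sigma> us)"
      proof (intro sum.cong refl arg_cong2[of _ _ _ _ "(*)"])
        fix us assume "us \<in> ?Y"
        then have len: "length us = ?n" by (rule index_lists_length)
        have "?M ws us = (\<Prod>r<?n. ((\<lambda>r. \<Prod>j<d. As ! j $$ (ws ! r ! j, us ! r ! j)) \<circ> \<sigma>) r)"
          by (rule prod.permute[OF \<sigma>])
        also have "\<dots> = ?M ?ws (permute_list \<sigma> us)"
          using \<sigma> len by (intro prod.cong refl) (simp add: permute_list_nth)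
        finally show "?M ws us = ?M ?ws (permute_list \<sigma> us)" .
      qed
      also have "\<dots> = (\<Sum>us\<in>?Y. ?M ?ws us * (f (take p us) * g (drop p us)))"
        by (rule sum.reindex_bij_betw[OF bij_betw_permute_list_index_lists[OF \<sigma>]])
      also have "\<dots> = gl_act d k As f (take p ?ws) * gl_act d k As g (drop p ?ws)"
        using gl_act_split[OF ws', of p As f g] p by simp
      finally show ?thesis .
    qed
    have "gl_act d k As (wedge f g) ws = (\<Sum>us\<in>?Y. ?M ws us * wedge f g us)"
      by (rule gl_act_eq[OF True])
    also have "\<dots> = (\<Sum>us\<in>?Y. \<Sum>p\<le>?n. \<Sum>\<sigma>\<in>?S. ?T us p \<sigma>)"
    proof (intro sum.cong refl)
      fix us assume "us \<in> ?Y"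
      then have len: "length us = ?n" by (rule index_lists_length)
      show "?M ws us * wedge f g us = (\<Sum>p\<le>?n. \<Sum>\<sigma>\<in>?S. ?T us p \<sigma>)"
        unfolding wedge_def len by (simp add: sum_distrib_left mult_ac)
    qed
    also have "\<dots> = (\<Sum>p\<le>?n. \<Sum>us\<in>?Y. \<Sum>\<sigma>\<in>?S. ?T us p \<sigma>)"
      by (rule sum.swap)
    also have "\<dots> = (\<Sum>p\<le>?n. \<Sum>\<sigma>\<in>?S. \<Sum>us\<in>?Y. ?T us p \<sigma>)"
      by (intro sum.cong refl sum.swap)
    also have "\<dots> = (\<Sum>p\<le>?n. \<Sum>\<sigma>\<in>?S. ?c p * of_int (sign \<sigma>) *
        (gl_act d k As f (take p (permute_list \<sigma> ws)) * gl_act d k As g (drop p (permute_list \<sigma> ws))))"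
    proof (intro sum.cong refl)
      fix p \<sigma> assume "p \<in> {..?n}" "\<sigma> \<in> ?S"
      then show "(\<Sum>us\<in>?Y. ?T us p \<sigma>) =
        ?c p * of_int (sign \<sigma>) *
          (gl_act d k As f (take p (permute_list \<sigma> ws)) * gl_act d k As g (drop p (permute_list \<sigma> ws)))"
        unfolding sum_distrib_left[symmetric] using inner by simp
    qed
    also have "\<dots> = wedge (gl_act d k As f) (gl_act d k As g) ws"
      unfolding wedge_def sum_distrib_left by (intro sum.cong refl) (simp add: mult_ac)
    finally show ?thesis .
  qed
qed

lemma HWV_iff:
  "v \<in> HWV d k \<mu> \<longleftrightarrow> weight_vector d k \<mu> v \<and>
    (\<forall>As. length As = d \<and> set As \<subseteq> unitriangular k \<longrightarrow> gl_act d k As v = v)"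
proof (cases "v = 0")
  case True
  have "weight_vector d k \<mu> 0"
    using cfun.subspace_0[OF subspace_ext_alg] by (simp add: weight_vector_iff)
  moreover have "gl_act d k As 0 = 0" for As
    using gl_act_scale[of d k As 0 0] by simp
  ultimately show ?thesis using True by (simp add: HWV_def)
next
  case False
  then show ?thesis by (auto simp: HWV_def highest_weight_vector_def)
qed

lemma HWV_cong:
  assumes "\<And>j i. j < d \<Longrightarrow> i < k \<Longrightarrow> \<mu> j i = \<nu> j i"
  shows "HWV d k \<mu> = HWV d k \<nu>"
proof -
  have "weight_vector d k \<mu> v \<longleftrightarrow> weight_vector d k \<nu> v" for v
    unfolding weight_vector_iff using assms by auto
  then show ?thesis unfolding HWV_def highest_weight_vector_def by simp
qed

lemma wedge_HWV:
  assumes f: "f \<in> HWV d k \<mu>" and g: "g \<in> HWV d k \<nu>"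
  shows "wedge f g \<in> HWV d k (\<lambda>j i. \<mu> j i + \<nu> j i)"
proof -
  have ext: "f \<in> ext_alg d k" "g \<in> ext_alg d k"
    using f g by (auto simp: HWV_iff weight_vector_def)
  have "gl_act d k (map (\<lambda>j. mat_diag k (a j)) [0..<d]) (wedge f g) =
      cscale (\<Prod>j<d. \<Prod>i<k. a j i powi (\<mu> j i + \<nu> j i)) (wedge f g)"
    if a: "\<forall>j<d. \<forall>i<k. a j i \<noteq> 0" for a
  proof -
    have "(\<Prod>j<d. \<Prod>i<k. a j i powi (\<mu> j i + \<nu> j i)) =
        (\<Prod>j<d. \<Prod>i<k. a j i powi \<mu> j i * a j i powi \<nu> j i)"
      using a by (intro prod.cong refl) (simp add: power_int_add)
    then have "(\<Prod>j<d. \<Prod>i<k. a j i powi (\<mu> j i + \<nu> j i)) =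
        (\<Prod>j<d. \<Prod>i<k. a j i powi \<mu> j i) * (\<Prod>j<d. \<Prod>i<k. a j i powi \<nu> j i)"
      by (simp add: prod.distrib)
    then show ?thesis
      using f g a by (simp add: gl_act_wedge[OF ext] HWV_iff weight_vector_def wedge_cscale_left
          cpair.linear_scale[OF linear_wedge])
  qed
  then show ?thesis
    using f g wedge_ext_alg[OF ext] gl_act_wedge[OF ext] by (simp add: HWV_iff weight_vector_def)
qed

section \<open>Wedge products of vectors as determinants\<close>

lemma ext_one_ext_alg: "ext_one \<in> ext_alg d k"
proof -
  have "permute_list \<sigma> ws = [] \<longleftrightarrow> ws = []" for \<sigma> :: "nat \<Rightarrow> nat" and ws :: "nat list list"
    by (metis length_0_conv length_permute_list)
  then show ?thesis
    by (auto simp: ext_alg_def ext_one_def of_bool_def permutes_empty split: if_splits)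
qed

lemma ext_incl_ext_alg:
  assumes "v \<in> supported_on (basis_index d k)"
  shows "ext_incl v \<in> ext_alg d k"
  unfolding ext_alg_def
proof (intro CollectI conjI allI impI)
  fix ws
  show "set ws \<subseteq> basis_index d k" if "ext_incl v ws \<noteq> 0"
    using that assms by (cases ws) (auto simp: ext_incl_def supported_on_def split: if_splits)
  fix \<sigma> assume \<sigma>: "\<sigma> permutes {..<length ws}"
  show "ext_incl v (permute_list \<sigma> ws) = of_int (sign \<sigma>) * ext_incl v ws"
  proof (cases "length ws = 1")
    case True
    then have "\<sigma> = id" using \<sigma> permutes_sing[of \<sigma> 0] by (simp add: lessThan_Suc)
    then show ?thesis by simp
  qed (simp add: ext_incl_def)
qed

lemma wedge_list_ext_alg:
  assumes "set vs \<subseteq> supported_on (basis_index d k)"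
  shows "wedge_list vs \<in> ext_alg d k"
  using assms
proof (induction vs)
  case Nil
  then show ?case by (simp add: wedge_list_def ext_one_ext_alg)
next
  case (Cons v vs)
  then show ?case
    using wedge_ext_alg[OF ext_incl_ext_alg] by (simp add: wedge_list_def)
qed

text \<open>\<open>\<tau>\<close> moved up by one, with 0 fixed: it permutes the places that remain
  after the first vector is split off.\<close>

definition shift_perm :: "nat \<Rightarrow> (nat \<Rightarrow> nat) \<Rightarrow> nat \<Rightarrow> nat" where
  "shift_perm m \<tau> = map_permutation {..<m} Suc \<tau>"

lemma shift_perm:
  assumes \<tau>: "\<tau> permutes {..<m}"
  shows "shift_perm m \<tau> permutes {..<Suc m}" "sign (shift_perm m \<tau>) = sign \<tau>"
    "shift_perm m \<tau> 0 = 0" "\<And>i. i < m \<Longrightarrow> shift_perm m \<tau> (Suc i) = Suc (\<tau> i)"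
proof -
  have "shift_perm m \<tau> permutes Suc ` {..<m}"
    unfolding shift_perm_def using \<tau> by (intro map_permutation_permutes) (auto simp: bij_betw_def)
  then show "shift_perm m \<tau> permutes {..<Suc m}"
    by (rule permutes_subset) auto
  show "sign (shift_perm m \<tau>) = sign \<tau>"
    unfolding shift_perm_def using \<tau> by (intro sign_map_permutation) auto
  show "shift_perm m \<tau> 0 = 0"
    by (auto simp: shift_perm_def map_permutation_def restrict_id_def)
  show "shift_perm m \<tau> (Suc i) = Suc (\<tau> i)" if "i < m" for i
    using that by (auto simp: shift_perm_def map_permutation_def restrict_id_def)
qed

lemma wedge_ext_incl:
  assumes "length ws = Suc m"
  shows "wedge (ext_incl v) g ws = 1 / fact m *
    (\<Sum>\<sigma> | \<sigma> permutes {..<Suc m}. of_int (sign \<sigma>) * v (ws ! \<sigma> 0) * g (map (\<lambda>i. ws ! \<sigma> (Suc i)) [0..<m]))"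
proof -
  let ?S = "{\<sigma>. \<sigma> permutes {..<Suc m}}"
  let ?t = "\<lambda>p. 1 / (fact p * fact (Suc m - p)) * (\<Sum>\<sigma>\<in>?S.
    of_int (sign \<sigma>) * ext_incl v (take p (permute_list \<sigma> ws)) * g (drop p (permute_list \<sigma> ws)))"
  have "wedge (ext_incl v) g ws = (\<Sum>p\<le>Suc m. ?t p)"
    by (simp add: wedge_def assms)
  also have "\<dots> = (\<Sum>p\<in>{1}. ?t p)"
    by (rule sum.mono_neutral_right) (auto simp: ext_incl_def assms min_def intro!: sum.neutral)
  also have "\<dots> = 1 / fact m * (\<Sum>\<sigma>\<in>?S.
      of_int (sign \<sigma>) * ext_incl v (take 1 (permute_list \<sigma> ws)) * g (drop 1 (permute_list \<sigma> ws)))"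
    by simp
  also have "(\<Sum>\<sigma>\<in>?S. of_int (sign \<sigma>) * ext_incl v (take 1 (permute_list \<sigma> ws)) * g (drop 1 (permute_list \<sigma> ws))) =
    (\<Sum>\<sigma>\<in>?S. of_int (sign \<sigma>) * v (ws ! \<sigma> 0) * g (map (\<lambda>i. ws ! \<sigma> (Suc i)) [0..<m]))"
  proof (intro sum.cong refl)
    fix \<sigma> assume "\<sigma> \<in> ?S"
    have "permute_list \<sigma> ws = ws ! \<sigma> 0 # map (\<lambda>i. ws ! \<sigma> (Suc i)) [0..<m]"
      by (simp add: permute_list_def assms upt_conv_Cons map_Suc_upt[symmetric] o_def del: upt_Suc)
    then show "of_int (sign \<sigma>) * ext_incl v (take 1 (permute_list \<sigma> ws)) * g (drop 1 (permute_list \<sigma> ws)) =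
        of_int (sign \<sigma>) * v (ws ! \<sigma> 0) * g (map (\<lambda>i. ws ! \<sigma> (Suc i)) [0..<m])"
      by (simp add: ext_incl_def)
  qed
  finally show ?thesis .
qed

text \<open>The Leibniz formula of a determinant; the normalisation in \<open>wedge\<close> is such
  that no factorial remains.\<close>

lemma wedge_list_eq:
  "wedge_list vs ws = (if length ws = length vs
     then \<Sum>\<sigma> | \<sigma> permutes {..<length vs}. of_int (sign \<sigma>) * (\<Prod>i<length vs. (vs ! i) (ws ! \<sigma> i))
     else 0)"
proof (induction vs arbitrary: ws)
  case Nil
  then show ?case by (simp add: wedge_list_def ext_one_def permutes_empty)
next
  case (Cons v vs)
  let ?m = "length vs"
  have wl: "wedge_list (v # vs) ws = wedge (ext_incl v) (wedge_list vs) ws"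
    by (simp add: wedge_list_def)
  show ?case
  proof (cases "length ws")
    case 0
    then show ?thesis unfolding wl by (simp add: wedge_def ext_incl_def)
  next
    case (Suc n)
    show ?thesis
    proof (cases "n = ?m")
      case False
      then show ?thesis unfolding wl wedge_ext_incl[OF Suc] using Suc by (simp add: Cons.IH)
    next
      case True
      define S where "S = (\<Sum>\<sigma> | \<sigma> permutes {..<Suc ?m}. of_int (sign \<sigma>) *
        (v (ws ! \<sigma> 0) * (\<Prod>i<?m. (vs ! i) (ws ! \<sigma> (Suc i)))))"
      let ?T = "{\<tau>. \<tau> permutes {..<?m}}"
      let ?g = "\<lambda>\<sigma> \<tau>. of_int (sign \<tau>) * (\<Prod>i<?m. (vs ! i) (map (\<lambda>i. ws ! \<sigma> (Suc i)) [0..<?m] ! \<tau> i))"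
      let ?G = "\<lambda>\<sigma> \<tau>. of_int (sign \<sigma>) * v (ws ! \<sigma> 0) * ?g \<sigma> \<tau>"
      have "wedge_list (v # vs) ws = 1 / fact ?m *
        (\<Sum>\<sigma> | \<sigma> permutes {..<Suc ?m}. of_int (sign \<sigma>) * v (ws ! \<sigma> 0) *
          (\<Sum>\<tau>\<in>?T. ?g \<sigma> \<tau>))"
        unfolding wl wedge_ext_incl[OF Suc[unfolded True]] by (simp add: Cons.IH)
      also have "(\<Sum>\<sigma> | \<sigma> permutes {..<Suc ?m}. of_int (sign \<sigma>) * v (ws ! \<sigma> 0) *
          (\<Sum>\<tau>\<in>?T. ?g \<sigma> \<tau>)) =
        (\<Sum>\<tau>\<in>?T. \<Sum>\<sigma> | \<sigma> permutes {..<Suc ?m}. ?G \<sigma> \<tau>)"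
        unfolding sum_distrib_left by (rule sum.swap)
      \<comment> \<open>Absorbing the shifted \<open>\<tau>\<close> into \<open>\<sigma>\<close>
        makes all inner sums equal. Their number, the factorial of \<open>?m\<close>, cancels the
        denominator.\<close>
      also have "\<dots> = (\<Sum>\<tau>\<in>?T. S)"
      proof (intro sum.cong refl)
        fix \<tau> assume "\<tau> \<in> ?T"
        then have \<tau>: "\<tau> permutes {..<?m}" by simp
        note sh = shift_perm[OF \<tau>]
        have lt: "\<tau> i < ?m" if "i < ?m" for i using permutes_in_image[OF \<tau>, of i] that by simp
        have "S = (\<Sum>\<sigma> | \<sigma> permutes {..<Suc ?m}. of_int (sign (\<sigma> \<circ> shift_perm ?m \<tau>)) *
          (v (ws ! (\<sigma> \<circ> shift_perm ?m \<tau>) 0) * (\<Prod>i<?m. (vs ! i) (ws ! (\<sigma> \<circ> shift_perm ?m \<tau>) (Suc i)))))"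
          unfolding S_def by (rule sum_permutations_compose_right[OF sh(1)])
        also have "\<dots> = (\<Sum>\<sigma> | \<sigma> permutes {..<Suc ?m}. ?G \<sigma> \<tau>)"
        proof (intro sum.cong refl)
          fix \<sigma> assume "\<sigma> \<in> {\<sigma>. \<sigma> permutes {..<Suc ?m}}"
          then have \<sigma>: "\<sigma> permutes {..<Suc ?m}" by simp
          have "(\<Prod>i<?m. (vs ! i) (ws ! (\<sigma> \<circ> shift_perm ?m \<tau>) (Suc i))) =
              (\<Prod>i<?m. (vs ! i) (map (\<lambda>i. ws ! \<sigma> (Suc i)) [0..<?m] ! \<tau> i))"
            using sh(4) lt by (intro prod.cong refl) simp
          then show "of_int (sign (\<sigma> \<circ> shift_perm ?m \<tau>)) *
            (v (ws ! (\<sigma> \<circ> shift_perm ?m \<tau>) 0) * (\<Prod>i<?m. (vs ! i) (ws ! (\<sigma> \<circ> shift_perm ?m \<tau>) (Suc i)))) =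
            ?G \<sigma> \<tau>"
            using sign_compose_permutes[OF finite_lessThan \<sigma> sh(1)] sh(2,3) by simp
        qed
        finally show "(\<Sum>\<sigma> | \<sigma> permutes {..<Suc ?m}. ?G \<sigma> \<tau>) = S" by simp
      qed
      also have "\<dots> = fact ?m * S" by (simp add: card_permutations[OF refl finite_lessThan])
      also have "1 / fact ?m * (fact ?m * S) = S" by simp
      finally have "wedge_list (v # vs) ws = S" .
      moreover have "v (ws ! \<sigma> 0) * (\<Prod>i<?m. (vs ! i) (ws ! \<sigma> (Suc i))) =
          (\<Prod>i<Suc ?m. ((v # vs) ! i) (ws ! \<sigma> i))" for \<sigma>
        by (simp add: prod.lessThan_Suc_shift del: prod.lessThan_Suc)
      ultimately show ?thesis using Suc True by (simp add: S_def del: prod.lessThan_Suc)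
    qed
  qed
qed

section \<open>The Cayley form\<close>

lemma prod_of_bool:
  fixes Q :: "nat \<Rightarrow> bool"
  shows "(\<Prod>i<k. of_bool (Q i)) = (of_bool (\<forall>i<k. Q i) :: complex)"
  by (induction k) (auto simp: less_Suc_eq)

text \<open>The left side is the sign tensor of the \<open>k\<close> basis vectors. The constant is
  the sign of the order in which \<open>cell [k]\<close> lists the single row.\<close>

lemma tab_kernel_single_row:
  obtains c where "\<And>u. length u = k \<Longrightarrow>
    (\<Sum>\<pi> | \<pi> permutes {..<k}. of_int (sign \<pi>) * (\<Prod>i<k. of_bool (u ! i = \<pi> i))) =
      c * tab_kernel [k] (replicate k 0) u"
proof -
  have b: "bij_betw (cell [k]) {..<k} (diagram [k])" using bij_betw_cell[of "[k]"] by simp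
  have D: "bij_betw snd (diagram [k]) {..<k}"
    by (rule bij_betw_byWitness[where f' = "\<lambda>j. (0, j)"]) (auto simp: diagram_def)
  define \<kappa> where "\<kappa> = (\<lambda>x. if x \<in> {..<k} then snd (cell [k] x) else x)"
  have "bij_betw (snd \<circ> cell [k]) {..<k} {..<k}" using bij_betw_trans[OF b D] .
  then have "bij_betw \<kappa> {..<k} {..<k}"
    by (subst bij_betw_cong[of _ _ "snd \<circ> cell [k]"]) (auto simp: \<kappa>_def)
  then have \<kappa>: "\<kappa> permutes {..<k}" by (intro bij_imp_permutes) (auto simp: \<kappa>_def)
  have cell: "cell [k] x = (0, \<kappa> x)" if "x < k" for x
  proof -
    have "cell [k] x \<in> diagram [k]" using bij_betwE[OF b] that by blast
    then show ?thesis using that by (auto simp: diagram_def \<kappa>_def prod_eq_iff)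
  qed
  let ?S = "{\<sigma>. \<sigma> permutes {..<k}}"
  have "(\<Sum>\<pi>\<in>?S. of_int (sign \<pi>) * (\<Prod>i<k. of_bool (u ! i = \<pi> i))) =
      of_int (sign \<kappa>) * tab_kernel [k] (replicate k 0) u" if u: "length u = k" for u
  proof -
    have "(\<Sum>\<pi>\<in>?S. of_int (sign \<pi>) * (\<Prod>i<k. of_bool (u ! i = \<pi> i))) =
        (\<Sum>\<pi>\<in>?S. of_int (sign \<pi>) * (of_bool (\<forall>i<k. u ! i = \<pi> i) :: complex))"
      by (simp only: prod_of_bool)
    also have "\<dots> = (\<Sum>\<sigma>\<in>?S. of_int (sign (\<kappa> \<circ> \<sigma>)) * of_bool (\<forall>i<k. u ! i = (\<kappa> \<circ> \<sigma>) i))"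
      by (rule setum_permutations_compose_left[OF \<kappa>])
    also have "\<dots> = (\<Sum>\<sigma>\<in>?S. of_int (sign \<kappa>) * (of_int (sign \<sigma>) *
        of_bool (replicate k 0 = map (\<lambda>x. fst (cell [k] (\<sigma> x))) [0..<k] \<and>
                 u = map (\<lambda>x. snd (cell [k] (\<sigma> x))) [0..<k])))"
    proof (intro sum.cong refl)
      fix \<sigma> assume "\<sigma> \<in> ?S"
      then have \<sigma>: "\<sigma> permutes {..<k}" by simp
      have lt: "\<sigma> i < k" if "i < k" for i using permutes_in_image[OF \<sigma>, of i] that by simp
      have "(\<forall>i<k. u ! i = (\<kappa> \<circ> \<sigma>) i) \<longleftrightarrow> replicate k 0 = map (\<lambda>x. fst (cell [k] (\<sigma> x))) [0..<k] \<and>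
          u = map (\<lambda>x. snd (cell [k] (\<sigma> x))) [0..<k]"
        using u lt by (auto simp: list_eq_iff_nth_eq cell)
      then show "of_int (sign (\<kappa> \<circ> \<sigma>)) * of_bool (\<forall>i<k. u ! i = (\<kappa> \<circ> \<sigma>) i) =
          of_int (sign \<kappa>) * (of_int (sign \<sigma>) *
          (of_bool (replicate k 0 = map (\<lambda>x. fst (cell [k] (\<sigma> x))) [0..<k] \<and>
                   u = map (\<lambda>x. snd (cell [k] (\<sigma> x))) [0..<k]) :: complex))"
        using sign_compose_permutes[OF finite_lessThan \<kappa> \<sigma>] by simp
    qed
    also have "\<dots> = of_int (sign \<kappa>) * tab_kernel [k] (replicate k 0) u"
      by (simp add: tab_kernel_def sum_distrib_left)
    finally show ?thesis .
  qed
  then show ?thesis using that by blast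
qed

lemma sign_foldr_compose:
  fixes k :: nat
  assumes "\<forall>\<pi>\<in>set \<pi>s. \<pi> permutes {..<k}"
  shows "foldr (\<circ>) \<pi>s id permutes {..<k} \<and>
    sign (foldr (\<circ>) \<pi>s id) = (\<Prod>j<length \<pi>s. sign (\<pi>s ! j))"
  using assms
proof (induction \<pi>s)
  case (Cons \<pi> \<pi>s)
  then have \<pi>: "\<pi> permutes {..<k}" and IH: "foldr (\<circ>) \<pi>s id permutes {..<k}"
    "sign (foldr (\<circ>) \<pi>s id) = (\<Prod>j<length \<pi>s. sign (\<pi>s ! j))"
    unfolding list.set(2) by blast+
  have "foldr (\<circ>) (\<pi> # \<pi>s) id = \<pi> \<circ> foldr (\<circ>) \<pi>s id" by simp
  moreover have "(\<Prod>j<length (\<pi> # \<pi>s). sign ((\<pi> # \<pi>s) ! j)) = sign \<pi> * (\<Prod>j<length \<pi>s. sign (\<pi>s ! j))"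
    by (simp add: prod.lessThan_Suc_shift del: prod.lessThan_Suc)
  ultimately show ?case
    using permutes_compose[OF IH(1) \<pi>] sign_compose_permutes[OF finite_lessThan \<pi> IH(1)] IH(2)
    by (simp only:)
qed (simp add: permutes_id)

lemma cayley_form_ext_alg: "cayley_form d k \<in> ext_alg d k"
  unfolding cayley_form_def
proof (intro cfun.subspace_sum[OF subspace_ext_alg] cfun.subspace_scale[OF subspace_ext_alg] wedge_list_ext_alg)
  fix \<pi>s :: "(nat \<Rightarrow> nat) list"
  assume "\<pi>s \<in> {\<pi>s. length \<pi>s = d \<and> (\<forall>\<pi>\<in>set \<pi>s. \<pi> permutes {..<k})}"
  then have \<pi>s: "length \<pi>s = d" "\<And>j. j < d \<Longrightarrow> \<pi>s ! j permutes {..<k}" by auto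
  have "pure_tensor (map (\<lambda>\<pi>. std_basis (\<pi> i)) \<pi>s) \<in> supported_on (basis_index d k)" if i: "i < k" for i
    unfolding supported_on_def
  proof (intro CollectI allI impI)
    fix w assume "pure_tensor (map (\<lambda>\<pi>. std_basis (\<pi> i)) \<pi>s) w \<noteq> 0"
    then have len: "length w = d" and ne: "(\<Prod>j<d. std_basis ((\<pi>s ! j) i) (w ! j)) \<noteq> 0"
      using \<pi>s by (auto simp: pure_tensor_def split: if_splits)
    show "w \<in> basis_index d k"
    proof (rule basis_indexI[OF len])
      fix j assume j: "j < d"
      then have "std_basis ((\<pi>s ! j) i) (w ! j) \<noteq> 0" using ne by auto
      then show "w ! j < k"
        using permutes_in_image[OF \<pi>s(2)[OF j], of i] i by (auto simp: std_basis_def split: if_splits)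
    qed
  qed
  then show "set (map (\<lambda>i. pure_tensor (map (\<lambda>\<pi>. std_basis (\<pi> i)) \<pi>s)) [0..<k])
      \<subseteq> supported_on (basis_index d k)"
    by auto
qed

text \<open>
  Interchanging the sums over \<open>\<sigma> \<in> S\<^sub>k\<close> (from the wedge product) and over \<open>\<pi>\<^sub>1, \<dots>, \<pi>\<^sub>d\<close> turns the
  summand for \<open>\<sigma>\<close> into \<open>sgn \<sigma>\<^sup>d\<^sup>+\<^sup>1 = 1\<close> times a product over the \<open>d\<close> factors.
\<close>

lemma cayley_form_eq_tensor_kernel:
  assumes odd: "odd d"
  obtains c where "cayley_form d k =
    cscale c (tensor_kernel d k (replicate d [k]) (replicate d (replicate k 0)))"
proof -
  let ?K = "tensor_kernel d k (replicate d [k]) (replicate d (replicate k 0))"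
  let ?S = "{\<sigma>. \<sigma> permutes {..<k}}"
  let ?P = "{\<pi>s. length \<pi>s = d \<and> set \<pi>s \<subseteq> ?S}"
  let ?T = "\<lambda>u. tab_kernel [k] (replicate k 0) u"
  have fin: "finite ?S" by (simp add: finite_permutations)
  obtain c where c: "\<And>u. length u = k \<Longrightarrow>
    (\<Sum>\<pi>\<in>?S. of_int (sign \<pi>) * (\<Prod>i<k. of_bool (u ! i = \<pi> i))) = c * ?T u"
    using tab_kernel_single_row[of k] by blast
  have d: "d > 0" using odd by (cases d) auto
  have sh: "shapes d k k (replicate d [k])" if "k > 0"
    using d that by (auto simp: shapes_def partition_of_def)
  have P: "{\<pi>s. length \<pi>s = d \<and> (\<forall>\<pi>\<in>set \<pi>s. \<pi> permutes {..<k})} = ?P" by auto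
  \<comment> \<open>Each of the \<open>d\<close> factors contributes one \<open>c\<close> from
    \<open>tab_kernel_single_row\<close>, and the \<open>k!\<close> permutations in the wedge
    product contribute equally.\<close>
  have "cayley_form d k ws = c ^ d * fact k * ?K ws" for ws
  proof (cases "set ws \<subseteq> basis_index d k")
    case False
    have "cayley_form d k ws = 0" using cayley_form_ext_alg[of d k] False by (auto simp: ext_alg_def)
    then show ?thesis using False by (simp add: tensor_kernel_def)
  next
    case True
    show ?thesis
    proof (cases "length ws = k")
      case False
      have "cayley_form d k ws = 0"
        unfolding cayley_form_def sum_fun_apply cscale_def wedge_list_eq
        using False by (intro sum.neutral) simp
      moreover have "?K ws = 0"
      proof (rule ccontr)
        assume "?K ws \<noteq> 0"
        from tensor_kernel_filling[OF this d] show False using d False by (simp add: filling_def)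
      qed
      ultimately show ?thesis by simp
    next
      case len: True
      then have ws: "ws \<in> index_lists k d k" using True by (simp add: index_lists_def)
      let ?e = "\<lambda>\<sigma> j \<pi>. of_int (sign \<pi>) * (\<Prod>i<k. of_bool (permute_list \<sigma> (column j ws) ! i = \<pi> i)) :: complex"
      have summand: "of_int (sign (foldr (\<circ>) \<pi>s id)) *
          wedge_list (map (\<lambda>i. pure_tensor (map (\<lambda>\<pi>. std_basis (\<pi> i)) \<pi>s)) [0..<k]) ws =
        (\<Sum>\<sigma>\<in>?S. of_int (sign \<sigma>) * (\<Prod>j<d. ?e \<sigma> j (\<pi>s ! j)))" if \<pi>s: "\<pi>s \<in> ?P" for \<pi>s
      proof -
        have s: "of_int (sign (foldr (\<circ>) \<pi>s id)) = (\<Prod>j<d. of_int (sign (\<pi>s ! j)) :: complex)"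
        proof -
          have "\<forall>\<pi>\<in>set \<pi>s. \<pi> permutes {..<k}" "length \<pi>s = d" using \<pi>s by auto
          then show ?thesis using sign_foldr_compose[of \<pi>s k] by simp
        qed
        have t: "(\<Prod>i<k. pure_tensor (map (\<lambda>\<pi>. std_basis (\<pi> i)) \<pi>s) (ws ! \<sigma> i)) =
            (\<Prod>j<d. \<Prod>i<k. of_bool (permute_list \<sigma> (column j ws) ! i = (\<pi>s ! j) i))"
          if \<sigma>: "\<sigma> \<in> ?S" for \<sigma>
        proof -
          have "pure_tensor (map (\<lambda>\<pi>. std_basis (\<pi> i)) \<pi>s) (ws ! \<sigma> i) =
              (\<Prod>j<d. of_bool (permute_list \<sigma> (column j ws) ! i = (\<pi>s ! j) i))" if i: "i < k" for i
          proof -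
            have \<sigma>i: "\<sigma> i < k" using \<sigma> i permutes_in_image[of \<sigma> "{..<k}" i] by simp
            have "length (ws ! \<sigma> i) = d"
              using basis_index_length[OF index_lists_nth[OF ws \<sigma>i]] .
            then show ?thesis
              using \<pi>s \<sigma> i \<sigma>i len
              by (simp add: pure_tensor_def std_basis_def permute_list_nth nth_column)
          qed
          then have "(\<Prod>i<k. pure_tensor (map (\<lambda>\<pi>. std_basis (\<pi> i)) \<pi>s) (ws ! \<sigma> i)) =
              (\<Prod>i<k. \<Prod>j<d. of_bool (permute_list \<sigma> (column j ws) ! i = (\<pi>s ! j) i))"
            by (intro prod.cong refl) simp
          also have "\<dots> = (\<Prod>j<d. \<Prod>i<k. of_bool (permute_list \<sigma> (column j ws) ! i = (\<pi>s ! j) i))"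
            by (rule prod.swap)
          finally show ?thesis .
        qed
        have "of_int (sign (foldr (\<circ>) \<pi>s id)) *
            wedge_list (map (\<lambda>i. pure_tensor (map (\<lambda>\<pi>. std_basis (\<pi> i)) \<pi>s)) [0..<k]) ws =
          (\<Sum>\<sigma>\<in>?S. (\<Prod>j<d. of_int (sign (\<pi>s ! j))) *
            (of_int (sign \<sigma>) * (\<Prod>i<k. pure_tensor (map (\<lambda>\<pi>. std_basis (\<pi> i)) \<pi>s) (ws ! \<sigma> i))))"
          using len by (simp add: s wedge_list_eq sum_distrib_left)
        also have "\<dots> = (\<Sum>\<sigma>\<in>?S. of_int (sign \<sigma>) * (\<Prod>j<d. ?e \<sigma> j (\<pi>s ! j)))"
          by (intro sum.cong refl) (simp add: t prod.distrib)
        finally show ?thesis .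
      qed
      have "cayley_form d k ws = (\<Sum>\<pi>s\<in>?P. \<Sum>\<sigma>\<in>?S. of_int (sign \<sigma>) * (\<Prod>j<d. ?e \<sigma> j (\<pi>s ! j)))"
        unfolding cayley_form_def P sum_fun_apply cscale_def by (intro sum.cong refl summand)
      also have "\<dots> = (\<Sum>\<sigma>\<in>?S. of_int (sign \<sigma>) * (\<Sum>\<pi>s\<in>?P. \<Prod>j<d. ?e \<sigma> j (\<pi>s ! j)))"
        unfolding sum_distrib_left by (rule sum.swap)
      also have "\<dots> = (\<Sum>\<sigma>\<in>?S. c ^ d * (\<Prod>j<d. ?T (column j ws)))"
      proof (intro sum.cong refl)
        fix \<sigma> assume "\<sigma> \<in> ?S"
        then have \<sigma>: "\<sigma> permutes {..<k}" by simp
        have row: "permute_list \<sigma> (replicate k 0) = replicate k (0::nat)"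
          by (rule nth_equalityI)
            (use \<sigma> permutes_in_image[OF \<sigma>] in \<open>simp_all add: permute_list_nth nth_replicate\<close>)
        have "(\<Sum>\<pi>s\<in>?P. \<Prod>j<d. ?e \<sigma> j (\<pi>s ! j)) = (\<Prod>j<d. \<Sum>\<pi>\<in>?S. ?e \<sigma> j \<pi>)"
          by (rule prod_sum_lists[OF fin])
        also have "\<dots> = (\<Prod>j<d. c * (of_int (sign \<sigma>) * ?T (column j ws)))"
        proof (intro prod.cong refl)
          fix j
          have "(\<Sum>\<pi>\<in>?S. ?e \<sigma> j \<pi>) = c * ?T (permute_list \<sigma> (column j ws))"
            using len by (intro c) simp
          also have "?T (permute_list \<sigma> (column j ws)) = of_int (sign \<sigma>) * ?T (column j ws)"
            using tab_kernel_permute_list[of \<sigma> "[k]" "replicate k 0" "column j ws"] \<sigma> len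
            by (simp add: row)
          finally show "(\<Sum>\<pi>\<in>?S. ?e \<sigma> j \<pi>) = c * (of_int (sign \<sigma>) * ?T (column j ws))" .
        qed
        also have "\<dots> = c ^ d * (of_int (sign \<sigma>) ^ d * (\<Prod>j<d. ?T (column j ws)))"
          by (simp add: prod.distrib)
        also have "(of_int (sign \<sigma>) :: complex) ^ d = of_int (sign \<sigma>)"
          using odd by (cases \<sigma> rule: sign_cases) auto
        finally show "of_int (sign \<sigma>) * (\<Sum>\<pi>s\<in>?P. \<Prod>j<d. ?e \<sigma> j (\<pi>s ! j)) =
            c ^ d * (\<Prod>j<d. ?T (column j ws))"
          by (cases \<sigma> rule: sign_cases) simp_all
      qed
      also have "\<dots> = fact k * (c ^ d * (\<Prod>j<d. ?T (column j ws)))"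
        by (simp add: card_permutations[OF refl finite_lessThan])
      also have "(\<Prod>j<d. ?T (column j ws)) = ?K ws"
        using True by (simp add: tensor_kernel_def)
      finally show ?thesis by simp
    qed
  qed
  then have "cayley_form d k = cscale (c ^ d * fact k) ?K" by (simp add: cscale_def fun_eq_iff)
  then show ?thesis by (rule that)
qed

text \<open>The shape \<open>[k]\<close> has one cell in each of its \<open>k\<close> columns,
  whence the weight with all entries 1.\<close>

lemma cayley_form_HWV:
  assumes odd: "odd d" and k: "k > 0"
  shows "cayley_form d k \<in> HWV d k (\<lambda>j i. 1)"
proof -
  have d: "d > 0" using odd by (cases d) auto
  let ?ls = "replicate d [k]"
  have sh: "shapes d k k ?ls" using d k by (auto simp: shapes_def partition_of_def)
  obtain c where c: "cayley_form d k = cscale c (tensor_kernel d k ?ls (replicate d (replicate k 0)))"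
    using cayley_form_eq_tensor_kernel[OF odd] by blast
  have "cayley_form d k \<in> unipotent_invariants d k ?ls"
    unfolding c by (intro cfun.subspace_scale[OF subspace_unipotent_invariants] tensor_kernel_unipotent[OF sh])
  then have "cayley_form d k \<in> HWV d k (padded_weight (map conjugate ?ls))"
    unfolding HWV_eq[OF sh] using cayley_form_ext_alg by blast
  also have "HWV d k (padded_weight (map conjugate ?ls)) = HWV d k (\<lambda>j i. 1)"
  proof (rule HWV_cong)
    fix j i assume "j < d" "i < k"
    moreover from this have "{j. j < length [k] \<and> i < [k] ! j} = {0}" by auto
    then have "content [k] i = 1" by (simp add: content_def)
    ultimately show "padded_weight (map conjugate ?ls) j i = 1"
      by (simp add: padded_weight_def nth_default_conjugate)
  qed
  finally show ?thesis .
qed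

section \<open>Adding and removing parts equal to \<open>k\<close>\<close>

lemma rho_pow_Suc:
  assumes sorted: "sorted_wrt (\<ge>) l" and le: "\<forall>p\<in>set l. p \<le> k" and k: "k > 0"
    and n: "- int (content l (k - 1)) \<le> n"
  shows "rho_pow k (n + 1) l = k # rho_pow k n l"
proof (cases "n \<ge> 0")
  case True
  then have "nat (n + 1) = Suc (nat n)" by simp
  then show ?thesis using True by (simp add: rho_pow_def)
next
  case False
  \<comment> \<open>Passing from \<open>n\<close> to \<open>n + 1\<close> restores the part with
    index \<open>-n - 1\<close>. The bound on \<open>n\<close> makes this row reach column
    \<open>k - 1\<close>, and no part exceeds \<open>k\<close>, so the part equals
    \<open>k\<close>.\<close>
  define p where "p = nat (- n) - 1"
  have p: "nat (- n) = Suc p" using False by (simp add: p_def)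
  have "p < content l (k - 1)" using n p by linarith
  then have "p < length l" "k - 1 < l ! p"
    using column_height_iff[OF sorted, of p "k - 1"] by (auto simp: content_def)
  moreover from this have "l ! p = k" using le k nth_mem[of p l] by fastforce
  moreover have "rho_pow k (n + 1) l = drop p l"
  proof (cases "n + 1 \<ge> 0")
    case True
    then have "n = -1" using False by simp
    then show ?thesis using p by (simp add: rho_pow_def)
  next
    case False
    then have "nat (- (n + 1)) = p" using p by simp
    then show ?thesis using False by (simp add: rho_pow_def)
  qed
  moreover have "rho_pow k n l = drop (Suc p) l" using False p by (simp add: rho_pow_def)
  ultimately show ?thesis using Cons_nth_drop_Suc[of p l] by simp
qed

lemma sum_list_rho_pow:
  assumes sorted: "sorted_wrt (\<ge>) l" and le: "\<forall>p\<in>set l. p \<le> k" and k: "k > 0"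
    and n: "- int (content l (k - 1)) \<le> n"
  shows "int (sum_list (rho_pow k n l)) = int (sum_list l) + n * int k"
proof (cases "n \<ge> 0")
  case True
  then show ?thesis by (simp add: rho_pow_def sum_list_replicate)
next
  case False
  have "int p \<le> int (content l (k - 1)) \<Longrightarrow>
      int (sum_list (rho_pow k (- int p) l)) = int (sum_list l) - int p * int k" for p
  proof (induction p)
    case 0
    then show ?case by (simp add: rho_pow_def)
  next
    case (Suc p)
    have "rho_pow k (- int (Suc p) + 1) l = k # rho_pow k (- int (Suc p)) l"
      using Suc.prems by (intro rho_pow_Suc[OF sorted le k]) simp
    then have "rho_pow k (- int p) l = k # rho_pow k (- int (Suc p)) l" by simp
    then have "int (sum_list (rho_pow k (- int p) l)) = int k + int (sum_list (rho_pow k (- int (Suc p)) l))"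
      by simp
    then show ?case using Suc by (simp add: algebra_simps)
  qed
  from this[of "nat (- n)"] show ?thesis using False n by simp
qed

lemma partition_rho_pow:
  assumes l: "partition_of m l" and le: "\<forall>p\<in>set l. p \<le> k" and k: "k > 0"
    and n: "- int (content l (k - 1)) \<le> n"
  shows "partition_of (nat (int m + n * int k)) (rho_pow k n l) \<and> (\<forall>p\<in>set (rho_pow k n l). p \<le> k)"
proof -
  have sorted: "sorted_wrt (\<ge>) l" using l by (simp add: partition_of_def)
  have "sorted_wrt (\<ge>) (rho_pow k n l)"
  proof -
    have "sorted_wrt (\<ge>) (replicate n k)" for n by (simp add: sorted_wrt_iff_nth_less)
    then show ?thesis using sorted le by (auto simp: rho_pow_def sorted_wrt_append sorted_wrt_drop)
  qed
  moreover have "0 \<notin> set (rho_pow k n l)" "\<forall>p\<in>set (rho_pow k n l). p \<le> k"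
    using l le k by (auto simp: rho_pow_def partition_of_def dest: in_set_dropD)
  moreover have "sum_list (rho_pow k n l) = nat (int m + n * int k)"
    using sum_list_rho_pow[OF sorted le k n] l by (simp add: partition_of_def)
  ultimately show ?thesis by (simp add: partition_of_def)
qed

lemma content_Cons:
  assumes "i < k"
  shows "content (k # l) i = Suc (content l i)"
proof -
  have "{j. j < length (k # l) \<and> i < (k # l) ! j} = insert 0 (Suc ` {j. j < length l \<and> i < l ! j})"
    using assms by (auto simp: nth_Cons image_iff split: nat.splits) (metis Suc_less_eq old.nat.exhaust)
  then show ?thesis by (simp add: content_def card_image)
qed

theorem proposition1p7:
  fixes d k m :: nat and ls :: "nat list list"
  assumes "d \<ge> 3" and "odd d" and "k > 0" and "even k"
    and "length ls = d"
    and "\<forall>l\<in>set ls. partition_of m l \<and> (\<forall>p\<in>set l. p \<le> k)"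
    and "2 * m \<le> k ^ d"
    and "LP d k ls"
  shows "unimodal_on (- b_min k ls) (int (k ^ (d - 1)) - a_max ls)
           (\<lambda>n. kronecker (map (rho_pow k n) ls))"
proof -
  let ?b = "b_min k ls" and ?e = "int (k ^ (d - 1)) - a_max ls"
  let ?r = "\<lambda>n. map (rho_pow k n) ls"
  let ?N = "\<lambda>n. nat (int m + n * int k)"
  let ?L = "wedge (cayley_form d k)"
  \<comment> \<open>\<open>?b\<close> is the least number of parts equal to \<open>k\<close> among
    the partitions, so in the range at hand only such parts are removed.\<close>
  have ge: "- int (content l (k - 1)) \<le> n" if "l \<in> set ls" "- ?b \<le> n" for l n
  proof -
    have "sorted_wrt (\<ge>) l" using assms(6) that by (simp add: partition_of_def)
    then have "?b \<le> int (content l (k - 1))"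
      using that(1) by (auto simp: b_min_def simp flip: nth_default_conjugate intro!: Min_le)
    then show ?thesis using that(2) by simp
  qed
  have sh: "shapes d k (?N n) (?r n)" if "- ?b \<le> n" for n
    unfolding shapes_def
  proof (intro conjI ballI)
    show "0 < d" "length (?r n) = d" using assms(1,5) by simp_all
    fix l' assume "l' \<in> set (?r n)"
    then obtain l where l: "l \<in> set ls" "l' = rho_pow k n l" by auto
    then show "partition_of (?N n) l'" "\<And>p. p \<in> set l' \<Longrightarrow> p \<le> k"
      using partition_rho_pow[of m l k n] assms(3,6) ge[OF l(1) that] by simp_all
  qed
  have rho: "HWV_rho d k ls n = HWV d k (padded_weight (map conjugate (?r n)))" for n
    by (simp add: HWV_rho_def o_def)
  have dim: "kronecker (?r n) = cfun.dim (HWV_rho d k ls n)" if "- ?b \<le> n" for n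
    unfolding rho by (rule kronecker_eq_dim_HWV[OF sh[OF that] assms(2)])
  have supp: "HWV_rho d k ls n \<subseteq> supported_on (index_lists (?N n) d k)" if "- ?b \<le> n" for n
    unfolding rho by (rule HWV_support[OF sh[OF that]])
  \<comment> \<open>Wedging with the Cayley form adds 1 to every entry of the weight, while
    prefixing a part \<open>k\<close> adds one cell to each of the \<open>k\<close> columns. The two
    shifts agree.\<close>
  have maps: "?L ` HWV_rho d k ls n \<subseteq> HWV_rho d k ls (n + 1)" if n: "- ?b \<le> n" for n
  proof clarify
    fix v assume "v \<in> HWV_rho d k ls n"
    then have "?L v \<in> HWV d k (\<lambda>j i. 1 + padded_weight (map conjugate (?r n)) j i)"
      unfolding rho by (rule wedge_HWV[OF cayley_form_HWV[OF assms(2,3)]])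
    also have "\<dots> = HWV_rho d k ls (n + 1)"
      unfolding rho
    proof (rule HWV_cong)
      fix j i assume j: "j < d" and i: "i < k"
      have n1: "- ?b \<le> n + 1" using n by simp
      have l: "ls ! j \<in> set ls" using j assms(5) by simp
      have "sorted_wrt (\<ge>) (ls ! j)" using assms(6) l by (simp add: partition_of_def)
      then have "rho_pow k (n + 1) (ls ! j) = k # rho_pow k n (ls ! j)"
        using assms(3,6) l ge[OF l n] by (intro rho_pow_Suc) auto
      then have "content (rho_pow k (n + 1) (ls ! j)) i = Suc (content (rho_pow k n (ls ! j)) i)"
        using content_Cons[OF i] by simp
      then show "1 + padded_weight (map conjugate (?r n)) j i =
          padded_weight (map conjugate (?r (n + 1))) j i"
        using shapesD(1)[OF sh[OF n] j] shapesD(1)[OF sh[OF n1] j] j assms(5)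
        by (simp add: padded_weight_def nth_default_conjugate)
    qed
    finally show "?L v \<in> HWV_rho d k ls (n + 1)" .
  qed
  obtain n0 where n0: "n0 \<in> {- ?b..?e}"
    and inj: "\<And>n. n \<in> {- ?b..<n0} \<Longrightarrow> inj_on ?L (HWV_rho d k ls n)"
    and surj: "\<And>n. n \<in> {n0..<?e} \<Longrightarrow> ?L ` HWV_rho d k ls n = HWV_rho d k ls (n + 1)"
    using assms(8) unfolding LP_def by blast
  show ?thesis
    unfolding unimodal_on_def
  \<comment> \<open>The peak is placed where the maps change from injective to surjective.\<close>
  proof (intro bexI[OF _ n0] conjI ballI)
    fix n assume n: "n \<in> {- ?b..<n0}"
    have "cfun.subspace (HWV_rho d k ls n)"
      unfolding rho using n by (intro subspace_HWV[OF sh]) simp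
    then have "cfun.dim (HWV_rho d k ls n) \<le> cfun.dim (HWV_rho d k ls (n + 1))"
      using n by (intro dim_le_of_inj[OF linear_wedge _ maps inj supp finite_index_lists]) auto
    then show "kronecker (?r n) \<le> kronecker (?r (n + 1))" using n by (simp add: dim)
  next
    fix n assume n: "n \<in> {n0..<?e}"
    have "cfun.dim (HWV_rho d k ls (n + 1)) \<le> cfun.dim (HWV_rho d k ls n)"
      using n n0 by (intro dim_le_of_surj[OF linear_wedge surj supp finite_index_lists]) auto
    then show "kronecker (?r (n + 1)) \<le> kronecker (?r n)" using n n0 by (simp add: dim)
  qed
qed

end
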